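(* Let $R$ be a commutative Noetherian regular ring of finite Krull dimension $d$ containing a field of characteristic zero. Let $P$ be a prime ideal of $R$ such that $(R/P)_{\mathfrak{q}}$ is regular for every non-maximal prime ideal $\mathfrak{q}$ of $R$. Then for every $i \geq 0$ the local cohomology module $H^i_P(R)$ has only finitely many associated primes, i.e. $\operatorname{Ass}_R H^i_P(R)$ is a finite set.
   Context: All rings are commutative and Noetherian. A ring is regular if its localization at every prime ideal is a regular local ring. For an ideal $I$ of $R$ and an $R$-module $M$, $H^i_I(M)$ denotes the $i$-th local cohomology module of $M$ with support in $I$. The regularity condition on $(R/P)_{\mathfrak{q}}$ has content only for primes $\mathfrak{q} \supseteq P$; if $\mathfrak{q} \not\supseteq P$ then $(R/P)_{\mathfrak{q}} = 0$, and the condition is regarded as vacuous. $\mathfrak{q}$ is non-maximal if it is not a maximal ideal of $R$. The ring $R$ is not assumed to be local or excellent. *)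

theory Defs
  imports "HOL-Algebra.Module" "HOL-Algebra.Ideal_Product" "HOL-Algebra.Ring_Divisibility"
    "HOL-Algebra.Subrings" "HOL-Library.Extended_Nat"
begin

section \<open>Localization of a commutative ring\<close>

text \<open>\<open>S\<close> is meant to be a multiplicative subset of \<open>R\<close>. It may contain \<open>\<zero>\<close>, in which case
  the localization is the zero ring.\<close>

definition frac_rel :: "('a, 'm) ring_scheme \<Rightarrow> 'a set \<Rightarrow> (('a \<times> 'a) \<times> ('a \<times> 'a)) set"
  where "frac_rel R S = {((a, s), (b, t)). a \<in> carrier R \<and> b \<in> carrier R \<and> s \<in> S \<and> t \<in> S \<and>
    (\<exists>u \<in> S. u \<otimes>\<^bsub>R\<^esub> (a \<otimes>\<^bsub>R\<^esub> t) = u \<otimes>\<^bsub>R\<^esub> (b \<otimes>\<^bsub>R\<^esub> s))}"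

definition fraction :: "('a, 'm) ring_scheme \<Rightarrow> 'a set \<Rightarrow> 'a \<Rightarrow> 'a \<Rightarrow> ('a \<times> 'a) set"
  where "fraction R S a s = frac_rel R S `` {(a, s)}"

definition localization :: "('a, 'm) ring_scheme \<Rightarrow> 'a set \<Rightarrow> (('a \<times> 'a) set) ring"
  where "localization R S =
    \<lparr>carrier = (carrier R \<times> S) // frac_rel R S,
     monoid.mult = (\<lambda>U V. \<Union>(a, s) \<in> U. \<Union>(b, t) \<in> V. fraction R S (a \<otimes>\<^bsub>R\<^esub> b) (s \<otimes>\<^bsub>R\<^esub> t)),
     one = fraction R S \<one>\<^bsub>R\<^esub> \<one>\<^bsub>R\<^esub>,
     ring.zero = fraction R S \<zero>\<^bsub>R\<^esub> \<one>\<^bsub>R\<^esub>,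
     add = (\<lambda>U V. \<Union>(a, s) \<in> U. \<Union>(b, t) \<in> V.
              fraction R S (a \<otimes>\<^bsub>R\<^esub> t \<oplus>\<^bsub>R\<^esub> b \<otimes>\<^bsub>R\<^esub> s) (s \<otimes>\<^bsub>R\<^esub> t))\<rparr>"

definition localization_at :: "('a, 'm) ring_scheme \<Rightarrow> 'a set \<Rightarrow> (('a \<times> 'a) set) ring"
  where "localization_at R p = localization R (carrier R - p)"

text \<open>The ring \<open>(R/I)\<^sub>q\<close> for a prime \<open>q\<close> of \<open>R\<close>: the elements of \<open>R - q\<close> are inverted in \<open>R/I\<close>.\<close>

definition quot_localization_at ::
    "('a, 'm) ring_scheme \<Rightarrow> 'a set \<Rightarrow> 'a set \<Rightarrow> (('a set \<times> 'a set) set) ring"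
  where "quot_localization_at R I q =
    localization (R Quot I) ((\<lambda>a. I +>\<^bsub>R\<^esub> a) ` (carrier R - q))"


section \<open>Krull dimension and regular rings\<close>

definition krull_dim :: "('a, 'm) ring_scheme \<Rightarrow> enat"
  where "krull_dim R = Sup {enat n | n. \<exists>p :: nat \<Rightarrow> 'a set.
    (\<forall>i \<le> n. primeideal (p i) R) \<and> (\<forall>i < n. p i \<subset> p (Suc i))}"

definition regular_local_ring :: "('a, 'm) ring_scheme \<Rightarrow> bool"
  where "regular_local_ring R \<longleftrightarrow>
    cring R \<and> noetherian_ring R \<and> (\<exists>!m. maximalideal m R) \<and>
    (\<exists>A. finite A \<and> A \<subseteq> carrier R \<and> enat (card A) = krull_dim R \<and>
         maximalideal (genideal R A) R)"

definition regular_ring :: "('a, 'm) ring_scheme \<Rightarrow> bool"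
  where "regular_ring R \<longleftrightarrow>
    cring R \<and> noetherian_ring R \<and>
    (\<forall>p. primeideal p R \<longrightarrow> regular_local_ring (localization_at R p))"

text \<open>\<open>[n] \<cdot>\<^bsub>R\<^esub> \<one>\<^bsub>R\<^esub>\<close> is the \<open>n\<close>-fold sum of \<open>\<one>\<^bsub>R\<^esub>\<close>, which is also the unit of \<open>K\<close>.\<close>

definition contains_char_zero_field :: "('a, 'm) ring_scheme \<Rightarrow> bool"
  where "contains_char_zero_field R \<longleftrightarrow>
    (\<exists>K. subfield K R \<and> (\<forall>n :: nat. n > 0 \<longrightarrow> [n] \<cdot>\<^bsub>R\<^esub> \<one>\<^bsub>R\<^esub> \<noteq> \<zero>\<^bsub>R\<^esub>))"


section \<open>Modules\<close>

definition self_module :: "('a, 'm) ring_scheme \<Rightarrow> ('a, 'a) module"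
  where "self_module R =
    \<lparr>carrier = carrier R, monoid.mult = monoid.mult R, one = one R, ring.zero = ring.zero R,
     add = add R, smult = monoid.mult R\<rparr>"

definition mod_hom :: "('a, 'm) ring_scheme \<Rightarrow> ('a, 'b) module \<Rightarrow> ('a, 'c) module \<Rightarrow> ('b \<Rightarrow> 'c) set"
  where "mod_hom R M N = {f \<in> carrier M \<rightarrow> carrier N.
    (\<forall>x \<in> carrier M. \<forall>y \<in> carrier M. f (x \<oplus>\<^bsub>M\<^esub> y) = f x \<oplus>\<^bsub>N\<^esub> f y) \<and>
    (\<forall>r \<in> carrier R. \<forall>x \<in> carrier M. f (r \<odot>\<^bsub>M\<^esub> x) = r \<odot>\<^bsub>N\<^esub> f x)}"

text \<open>The module record extends the ring record; its fields \<^const>\<open>monoid.mult\<close> and \<^const>\<open>one\<close>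
  carry no meaning for modules.\<close>

definition quot_module :: "('a, 'b) module \<Rightarrow> 'b set \<Rightarrow> ('a, 'b set) module"
  where "quot_module M N =
    \<lparr>carrier = a_rcosets\<^bsub>M\<^esub> N, monoid.mult = undefined, one = undefined, ring.zero = N,
     add = set_add M,
     smult = (\<lambda>r X. \<Union>x \<in> X. N +>\<^bsub>M\<^esub> (r \<odot>\<^bsub>M\<^esub> x))\<rparr>"

definition annihilator :: "('a, 'm) ring_scheme \<Rightarrow> ('a, 'b) module \<Rightarrow> 'b \<Rightarrow> 'a set"
  where "annihilator R M x = {r \<in> carrier R. r \<odot>\<^bsub>M\<^esub> x = \<zero>\<^bsub>M\<^esub>}"

definition associated_primes :: "('a, 'm) ring_scheme \<Rightarrow> ('a, 'b) module \<Rightarrow> 'a set set"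
  where "associated_primes R M =
    {p. primeideal p R \<and> (\<exists>x \<in> carrier M. p = annihilator R M x)}"

text \<open>Every homomorphism into \<open>E\<close> extends along every monomorphism \<open>f : A \<rightarrow> B\<close>.
  A definition cannot quantify over types, so \<open>A\<close> and \<open>B\<close> range over the modules whose
  elements have the type of the elements of \<open>R\<close>. These include \<open>R\<close> and its ideals, hence by
  Baer's criterion the extension property then holds for modules over any type.\<close>

definition injective_module :: "('a, 'm) ring_scheme \<Rightarrow> ('a, 'b) module \<Rightarrow> bool"
  where "injective_module R E \<longleftrightarrow> module R E \<and>
    (\<forall>(A :: ('a, 'a) module) (B :: ('a, 'a) module).
       module R A \<longrightarrow> module R B \<longrightarrow>
       (\<forall>f \<in> mod_hom R A B. inj_on f (carrier A) \<longrightarrow>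
         (\<forall>g \<in> mod_hom R A E. \<exists>h \<in> mod_hom R B E. \<forall>x \<in> carrier A. h (f x) = g x)))"


section \<open>Local cohomology\<close>

text \<open>\<open>0 \<rightarrow> M \<rightarrow> E 0 \<rightarrow> E 1 \<rightarrow> \<dots>\<close> with augmentation \<open>\<epsilon>\<close> and differentials \<open>\<delta> i : E i \<rightarrow> E (i + 1)\<close>.\<close>

definition injective_resolution ::
    "('a, 'm) ring_scheme \<Rightarrow> ('a, 'b) module \<Rightarrow> (nat \<Rightarrow> ('a, 'e) module) \<Rightarrow>
     ('b \<Rightarrow> 'e) \<Rightarrow> (nat \<Rightarrow> 'e \<Rightarrow> 'e) \<Rightarrow> bool"
  where "injective_resolution R M E \<epsilon> \<delta> \<longleftrightarrow>
    module R M \<and> (\<forall>i. injective_module R (E i)) \<and>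
    \<epsilon> \<in> mod_hom R M (E 0) \<and> (\<forall>i. \<delta> i \<in> mod_hom R (E i) (E (Suc i))) \<and>
    inj_on \<epsilon> (carrier M) \<and>
    \<epsilon> ` carrier M = a_kernel (E 0) (E 1) (\<delta> 0) \<and>
    (\<forall>i. \<delta> i ` carrier (E i) = a_kernel (E (Suc i)) (E (Suc (Suc i))) (\<delta> (Suc i)))"

primrec ideal_power :: "('a, 'm) ring_scheme \<Rightarrow> 'a set \<Rightarrow> nat \<Rightarrow> 'a set"
  where
    "ideal_power R I 0 = carrier R"
  | "ideal_power R I (Suc n) = ideal_prod R I (ideal_power R I n)"

definition torsion_module :: "('a, 'm) ring_scheme \<Rightarrow> 'a set \<Rightarrow> ('a, 'b) module \<Rightarrow> ('a, 'b) module"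
    \<comment> \<open>the submodule \<open>\<Gamma>\<^sub>I(M)\<close>\<close>
  where "torsion_module R I M =
    M\<lparr>carrier := {x \<in> carrier M. \<exists>n. \<forall>a \<in> ideal_power R I n. a \<odot>\<^bsub>M\<^esub> x = \<zero>\<^bsub>M\<^esub>}\<rparr>"

definition coboundaries :: "(nat \<Rightarrow> ('a, 'e) module) \<Rightarrow> (nat \<Rightarrow> 'e \<Rightarrow> 'e) \<Rightarrow> nat \<Rightarrow> 'e set"
  where "coboundaries C \<delta> i =
    (case i of 0 \<Rightarrow> {\<zero>\<^bsub>C 0\<^esub>} | Suc j \<Rightarrow> \<delta> j ` carrier (C j))"

definition cohomology :: "(nat \<Rightarrow> ('a, 'e) module) \<Rightarrow> (nat \<Rightarrow> 'e \<Rightarrow> 'e) \<Rightarrow> nat \<Rightarrow> ('a, 'e set) module"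
  where "cohomology C \<delta> i =
    quot_module ((C i)\<lparr>carrier := a_kernel (C i) (C (Suc i)) (\<delta> i)\<rparr>) (coboundaries C \<delta> i)"

text \<open>\<open>H\<^sup>i\<^sub>I(M)\<close> is the \<open>i\<close>-th right derived functor of \<open>\<Gamma>\<^sub>I\<close> at \<open>M\<close>, computed from an injective
  resolution \<open>E\<close>, \<open>\<delta>\<close> of \<open>M\<close>; up to isomorphism it does not depend on the resolution. On
  morphisms \<open>\<Gamma>\<^sub>I\<close> is restriction, so the differentials remain the functions \<open>\<delta> i\<close>.\<close>

definition local_cohomology ::
    "('a, 'm) ring_scheme \<Rightarrow> 'a set \<Rightarrow> (nat \<Rightarrow> ('a, 'e) module) \<Rightarrow> (nat \<Rightarrow> 'e \<Rightarrow> 'e) \<Rightarrow> nat \<Rightarrow>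
     ('a, 'e set) module"
  where "local_cohomology R I E \<delta> i = cohomology (\<lambda>j. torsion_module R I (E j)) \<delta> i"

end

(*
  If R_q and (R/P)_q are regular, then P R_q is generated by a regular sequence, and this persists
  at all primes in a neighbourhood of q. So the primes p containing P at which P R_p is not generated
  by a regular sequence form a closed set of maximal ideals, which is finite because R is Noetherian.
  At any other prime p containing P, say with P R_p generated by a regular sequence of length c, the
  module H^i_P(R)_p vanishes for i different from c, and the part of H^c_P(R)_p annihilated by P is
  R_p/P R_p; hence P is the only such p that can be associated to H^i_P(R).

  Localization at a prime q of R is replaced by saturation: an ideal I is replaced by the ideal of
  all r with s r in I for some s outside q, and identities in modules are proved up to a factor
  outside q.
*)

theory Submission
  imports Defs
begin

section \<open>Ideals and saturation at a prime\<close>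

text \<open>Dimension enters only through chains of primes: modulo J, the prime q is locally
  generated by n elements, while a chain of primes with n steps starts above J and ends inside q. By
  Krull's principal ideal theorem an element of q can be absorbed into such a chain at the cost of
  one step. This shows that R_q/J R_q is a domain, and it allows elements of P to be exchanged
  against generators of q until they generate P.

  For the cohomology, take an injective resolution E of R and a sequence z regular at p. The
  elements of E annihilated by the first k members form Hom(R/(z_1,...,z_k), E). Injective modules
  are divisible by nonzerodivisors, so locally the next member acts surjectively on this complex,
  with the next complex as kernel; the long exact sequences then give Ext of R/(z_1,...,z_k) and R.
  The same must work inside the P-torsion of E, where division has to preserve torsion: this is the
  one use of the Artin-Rees property. After all members of z are used, the two complexes agree at p,
  and the result is carried from there back to the whole P-torsion complex.\<close>

lemma (in ring) ideal_mem:
  assumes "ideal I R"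
  shows "I \<subseteq> carrier R"
    and "a \<in> I \<Longrightarrow> a \<in> carrier R"
    and "\<zero> \<in> I"
    and "a \<in> I \<Longrightarrow> b \<in> I \<Longrightarrow> a \<oplus> b \<in> I"
    and "a \<in> I \<Longrightarrow> \<ominus> a \<in> I"
    and "a \<in> I \<Longrightarrow> b \<in> I \<Longrightarrow> a \<ominus> b \<in> I"
    and "r \<in> carrier R \<Longrightarrow> a \<in> I \<Longrightarrow> r \<otimes> a \<in> I"
    and "r \<in> carrier R \<Longrightarrow> a \<in> I \<Longrightarrow> a \<otimes> r \<in> I"
proof -
  interpret ideal I R by fact
  show "I \<subseteq> carrier R" "a \<in> I \<Longrightarrow> a \<in> carrier R" "\<zero> \<in> I"
    "a \<in> I \<Longrightarrow> b \<in> I \<Longrightarrow> a \<oplus> b \<in> I" "a \<in> I \<Longrightarrow> \<ominus> a \<in> I"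
    "a \<in> I \<Longrightarrow> b \<in> I \<Longrightarrow> a \<ominus> b \<in> I"
    "r \<in> carrier R \<Longrightarrow> a \<in> I \<Longrightarrow> r \<otimes> a \<in> I" "r \<in> carrier R \<Longrightarrow> a \<in> I \<Longrightarrow> a \<otimes> r \<in> I"
    by (auto simp: a_minus_def I_l_closed I_r_closed)
qed

lemma (in cring) cring_idealI:
  assumes "I \<subseteq> carrier R" "\<zero> \<in> I" "\<And>a b. a \<in> I \<Longrightarrow> b \<in> I \<Longrightarrow> a \<oplus> b \<in> I"
    "\<And>r a. r \<in> carrier R \<Longrightarrow> a \<in> I \<Longrightarrow> r \<otimes> a \<in> I"
  shows "ideal I R"
proof (rule idealI)
  show "ring R" by (rule ring_axioms)
  show "subgroup I (add_monoid R)"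
  proof (rule add.subgroupI)
    fix a assume "a \<in> I"
    then have "(\<ominus> \<one>) \<otimes> a \<in> I" using assms(4) by simp
    moreover have "(\<ominus> \<one>) \<otimes> a = \<ominus> a" using \<open>a \<in> I\<close> assms(1) by (simp add: l_minus subset_iff)
    ultimately show "\<ominus> a \<in> I" by simp
  next
    show "I \<subseteq> carrier R" "I \<noteq> {}" using assms(1,2) by auto
    show "a \<oplus> b \<in> I" if "a \<in> I" "b \<in> I" for a b using assms(3)[OF that] .
  qed
  show "x \<otimes> a \<in> I" if "a \<in> I" "x \<in> carrier R" for a x using assms(4)[OF that(2,1)] .
  show "a \<otimes> x \<in> I" if "a \<in> I" "x \<in> carrier R" for a x
    using assms(4)[OF that(2,1)] m_comm[of a x] that assms(1) by auto
qed

lemma primeidealD: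
  fixes R (structure)
  assumes "primeideal p R"
  shows prime_ideal: "ideal p R" and prime_one: "\<one> \<notin> p"
    and prime_mult: "a \<in> carrier R \<Longrightarrow> b \<in> carrier R \<Longrightarrow> a \<otimes> b \<in> p \<Longrightarrow> a \<in> p \<or> b \<in> p"
    and prime_carrier: "p \<subseteq> carrier R"
proof -
  interpret primeideal p R by fact
  show "ideal p R" by (rule is_ideal)
  show "\<one> \<notin> p" using I_notcarr one_imp_carrier by auto
  show "p \<subseteq> carrier R" using Icarr by auto
  show "a \<in> carrier R \<Longrightarrow> b \<in> carrier R \<Longrightarrow> a \<otimes> b \<in> p \<Longrightarrow> a \<in> p \<or> b \<in> p"
    by (rule I_prime)
qed

lemma (in cring) prime_compl:
  assumes "primeideal p R"
  shows prime_compl_one: "\<one> \<in> carrier R - p"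
    and prime_compl_mult: "a \<in> carrier R - p \<Longrightarrow> b \<in> carrier R - p \<Longrightarrow> a \<otimes> b \<in> carrier R - p"
  using primeidealD[OF assms] by auto

text \<open>The contraction to \<open>R\<close> of the extension of \<open>I\<close> to R_q. For
  ideals, \<open>J \<subseteq> sat q I\<close> says that J R_q is contained in I R_q.\<close>

definition (in cring) sat :: "'a set \<Rightarrow> 'a set \<Rightarrow> 'a set"
  where "sat q I = {r \<in> carrier R. \<exists>s \<in> carrier R - q. s \<otimes> r \<in> I}"

definition (in cring) adjoin :: "'a set \<Rightarrow> 'a \<Rightarrow> 'a set"
  where "adjoin J x = {j \<oplus> c \<otimes> x | j c. j \<in> J \<and> c \<in> carrier R}"

text \<open>The ideal J + (xs). Generators are absorbed into the base ideal one at a time, so that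
  inductions on the list pass from \<open>J\<close> to \<open>adjoin J x\<close>, and the order that
  matters for regular sequences is kept.\<close>

primrec (in cring) adjoin_list :: "'a set \<Rightarrow> 'a list \<Rightarrow> 'a set" where
  "adjoin_list J [] = J"
| "adjoin_list J (x # xs) = adjoin_list (adjoin J x) xs"

definition (in cring) colon :: "'a set \<Rightarrow> 'a \<Rightarrow> 'a set"
  where "colon I a = {r \<in> carrier R. a \<otimes> r \<in> I}"

context cring begin

lemma satI: "r \<in> carrier R \<Longrightarrow> s \<in> carrier R - q \<Longrightarrow> s \<otimes> r \<in> I \<Longrightarrow> r \<in> sat q I"
  by (auto simp: sat_def)

lemma satE:
  assumes "r \<in> sat q I"
  obtains s where "s \<in> carrier R" "s \<notin> q" "s \<otimes> r \<in> I" "r \<in> carrier R"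
  using assms by (auto simp: sat_def)

lemma sat_ideal:
  assumes "primeideal q R" "ideal I R"
  shows "ideal (sat q I) R"
proof (rule cring_idealI)
  note I = ideal_mem[OF assms(2)]
  note q = prime_compl[OF assms(1)]
  show "sat q I \<subseteq> carrier R" by (auto simp: sat_def)
  show "\<zero> \<in> sat q I" using q(1) I(3) by (intro satI[of _ \<one>]) auto
  fix a assume "a \<in> sat q I"
  then obtain s where s: "s \<in> carrier R" "s \<notin> q" "s \<otimes> a \<in> I" "a \<in> carrier R" by (rule satE)
  { fix b assume "b \<in> sat q I"
    then obtain t where t: "t \<in> carrier R" "t \<notin> q" "t \<otimes> b \<in> I" "b \<in> carrier R" by (rule satE)
    have "s \<otimes> t \<otimes> (a \<oplus> b) = t \<otimes> (s \<otimes> a) \<oplus> s \<otimes> (t \<otimes> b)" using s t by algebra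
    then have "s \<otimes> t \<otimes> (a \<oplus> b) \<in> I" using s t I by simp
    then show "a \<oplus> b \<in> sat q I" using s t q(2)[of s t] by (intro satI[of _ "s \<otimes> t"]) auto }
  { fix r assume r: "r \<in> carrier R"
    have "s \<otimes> (r \<otimes> a) = r \<otimes> (s \<otimes> a)" using s r by algebra
    then show "r \<otimes> a \<in> sat q I" using s r I by (intro satI[of _ s]) auto }
qed

lemma sat_mono: "I \<subseteq> J \<Longrightarrow> sat q I \<subseteq> sat q J"
  by (auto simp: sat_def)

lemma sat_anti: "q \<subseteq> q' \<Longrightarrow> sat q' I \<subseteq> sat q I"
  by (auto simp: sat_def)

lemma subset_sat:
  assumes "primeideal q R" "I \<subseteq> carrier R"
  shows "I \<subseteq> sat q I"
  using prime_compl_one[OF assms(1)] assms(2) by (auto intro!: satI[of _ \<one>] simp: subset_iff)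

lemma sat_sat:
  assumes "primeideal q R"
  shows "sat q (sat q I) \<subseteq> sat q I"
proof
  fix a assume "a \<in> sat q (sat q I)"
  then obtain s t where *: "s \<in> carrier R" "s \<notin> q" "a \<in> carrier R" "t \<in> carrier R" "t \<notin> q" "t \<otimes> (s \<otimes> a) \<in> I"
    by (auto elim!: satE)
  then show "a \<in> sat q I" using prime_compl_mult[OF assms, of t s]
    by (intro satI[of _ "t \<otimes> s"]) (auto simp: m_assoc)
qed

lemma sat_prime:
  assumes "primeideal p R" "p \<subseteq> q"
  shows "sat q p \<subseteq> p"
  using primeidealD(3)[OF assms(1)] assms(2) by (auto elim!: satE)

lemma colon_ideal:
  assumes "ideal I R" "a \<in> carrier R"
  shows "ideal (colon I a) R"
proof (rule cring_idealI)
  note I = ideal_mem[OF assms(1)]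
  show "colon I a \<subseteq> carrier R" "\<zero> \<in> colon I a" using I assms(2) by (auto simp: colon_def)
  show "x \<oplus> y \<in> colon I a" if "x \<in> colon I a" "y \<in> colon I a" for x y
    using that I assms(2) by (auto simp: colon_def r_distr)
  show "r \<otimes> x \<in> colon I a" if "r \<in> carrier R" "x \<in> colon I a" for r x
  proof -
    have "a \<otimes> (r \<otimes> x) = r \<otimes> (a \<otimes> x)" using that assms(2) by (simp add: colon_def m_lcomm)
    then show ?thesis using that I assms(2) by (auto simp: colon_def)
  qed
qed

lemma subset_colon: "ideal I R \<Longrightarrow> a \<in> carrier R \<Longrightarrow> I \<subseteq> colon I a"
  using ideal_mem(2,7)[of I] by (auto simp: colon_def)

lemma adjoin_ideal:
  assumes "ideal J R" "x \<in> carrier R"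
  shows "ideal (adjoin J x) R"
proof (rule cring_idealI)
  note J = ideal_mem[OF assms(1)]
  show "adjoin J x \<subseteq> carrier R" using J(2) assms by (auto simp: adjoin_def)
  show "\<zero> \<in> adjoin J x" unfolding adjoin_def
    using J(3) assms(2) by (intro CollectI exI[of _ \<zero>]) simp
  show "a \<oplus> b \<in> adjoin J x" if ab: "a \<in> adjoin J x" "b \<in> adjoin J x" for a b
  proof -
    obtain j c i d where *: "a = j \<oplus> c \<otimes> x" "b = i \<oplus> d \<otimes> x" "j \<in> J" "i \<in> J" "c \<in> carrier R" "d \<in> carrier R"
      using ab by (auto simp: adjoin_def)
    then have "a \<oplus> b = (j \<oplus> i) \<oplus> (c \<oplus> d) \<otimes> x" using J(2)[of i] J(2)[of j] assms(2) by algebra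
    then show ?thesis using * J(4) unfolding adjoin_def by blast
  qed
  show "r \<otimes> a \<in> adjoin J x" if ra: "r \<in> carrier R" "a \<in> adjoin J x" for r a
  proof -
    obtain j c where *: "a = j \<oplus> c \<otimes> x" "j \<in> J" "c \<in> carrier R"
      using ra by (auto simp: adjoin_def)
    then have "r \<otimes> a = (r \<otimes> j) \<oplus> (r \<otimes> c) \<otimes> x" using J(2)[of j] ra assms(2) by algebra
    then show ?thesis using * ra J(7) unfolding adjoin_def by blast
  qed
qed

lemma adjoinE:
  assumes "a \<in> adjoin J x"
  obtains j c where "j \<in> J" "c \<in> carrier R" "a = j \<oplus> c \<otimes> x"
  using assms by (auto simp: adjoin_def)

lemma subset_adjoin:
  assumes "ideal J R" "x \<in> carrier R"
  shows "J \<subseteq> adjoin J x"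
proof
  fix a assume "a \<in> J"
  then have "a = a \<oplus> \<zero> \<otimes> x" using ideal_mem(2)[OF assms(1)] assms(2) by simp
  then show "a \<in> adjoin J x" using \<open>a \<in> J\<close> unfolding adjoin_def by blast
qed

lemma mem_adjoin:
  assumes "ideal J R" "x \<in> carrier R"
  shows "x \<in> adjoin J x"
proof -
  have "x = \<zero> \<oplus> \<one> \<otimes> x" using assms(2) by simp
  then show "x \<in> adjoin J x" using ideal_mem(3)[OF assms(1)] unfolding adjoin_def by blast
qed

lemma adjoin_subset:
  assumes "ideal K R" "J \<subseteq> K" "x \<in> K"
  shows "adjoin J x \<subseteq> K"
  using ideal_mem[OF assms(1)] assms by (auto simp: adjoin_def)

lemma adjoin_list_ideal:
  "ideal J R \<Longrightarrow> set xs \<subseteq> carrier R \<Longrightarrow> ideal (adjoin_list J xs) R"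
  by (induction xs arbitrary: J) (auto intro: adjoin_ideal)

lemma subset_adjoin_list:
  "ideal J R \<Longrightarrow> set xs \<subseteq> carrier R \<Longrightarrow> J \<subseteq> adjoin_list J xs"
  by (induction xs arbitrary: J) (use subset_adjoin adjoin_ideal in \<open>auto, blast\<close>)

lemma adjoin_list_subset:
  "ideal K R \<Longrightarrow> J \<subseteq> K \<Longrightarrow> set xs \<subseteq> K \<Longrightarrow> adjoin_list J xs \<subseteq> K"
proof (induction xs arbitrary: J)
  case (Cons x xs)
  then have "adjoin J x \<subseteq> K" by (intro adjoin_subset) auto
  then show ?case using Cons by simp
qed simp

lemma set_subset_adjoin_list:
  "ideal J R \<Longrightarrow> set xs \<subseteq> carrier R \<Longrightarrow> set xs \<subseteq> adjoin_list J xs"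
proof (induction xs arbitrary: J)
  case (Cons x xs)
  have J: "ideal (adjoin J x) R" using Cons.prems by (auto intro: adjoin_ideal)
  have xs: "set xs \<subseteq> carrier R" "x \<in> carrier R" using Cons.prems(2) by auto
  have "x \<in> adjoin_list (adjoin J x) xs"
    using subset_adjoin_list[OF J xs(1)] mem_adjoin[OF Cons.prems(1) xs(2)] by blast
  with Cons.IH[OF J xs(1)] show ?case by auto
qed simp

lemma adjoin_list_snoc: "adjoin_list J (xs @ [x]) = adjoin (adjoin_list J xs) x"
  by (induction xs arbitrary: J) auto

lemma adjoin_list_mono:
  assumes "ideal K R" "J \<subseteq> K" "set ys \<subseteq> carrier R" "set xs \<subseteq> adjoin_list K ys"
  shows "adjoin_list J xs \<subseteq> adjoin_list K ys"
  using assms subset_adjoin_list[OF assms(1,3)] by (intro adjoin_list_subset adjoin_list_ideal) auto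

lemma not_prime_ideal_witnesses:
  assumes "ideal J R" "\<not> primeideal J R" "J \<noteq> carrier R"
  obtains a b where "a \<in> carrier R" "b \<in> carrier R" "a \<otimes> b \<in> J" "a \<notin> J" "b \<notin> J"
  using assms primeidealI[OF assms(1) cring_axioms] by metis

end

section \<open>Noetherian induction and common denominators\<close>

locale noetherian_cring = cring R + noetherian_ring R for R (structure)
begin

text \<open>If \<open>Q\<close> failed at \<open>J\<close>, the step would supply a strictly larger
  failure each time, and dependent choice would turn these into an infinite strict chain.\<close>

lemma ideal_induct [consumes 1, case_names step]:
  assumes "ideal J R"
    and step: "\<And>J. ideal J R \<Longrightarrow> (\<And>K. ideal K R \<Longrightarrow> J \<subset> K \<Longrightarrow> Q K) \<Longrightarrow> Q J"
  shows "Q J"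
proof (rule ccontr)
  assume "\<not> Q J"
  have "\<exists>f. \<forall>n. (ideal (f n) R \<and> \<not> Q (f n)) \<and> f n \<subset> f (Suc n)"
  proof (rule dependent_nat_choice)
    show "\<exists>J. ideal J R \<and> \<not> Q J" using assms(1) \<open>\<not> Q J\<close> by blast
    show "\<exists>K. (ideal K R \<and> \<not> Q K) \<and> I \<subset> K" if "ideal I R \<and> \<not> Q I" for I n
    proof (rule ccontr)
      assume *: "\<not> ?thesis"
      have "Q I"
      proof (rule step)
        show "ideal I R" using that ..
        show "Q K" if "ideal K R" "I \<subset> K" for K using * that by metis
      qed
      then show False using that by simp
    qed
  qed
  then obtain f where f0: "\<forall>n. (ideal (f n) R \<and> \<not> Q (f n)) \<and> f n \<subset> f (Suc n)" ..
  have f: "ideal (f n) R" "f n \<subset> f (Suc n)" for n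
    using spec[OF f0, of n] by simp_all
  have mono: "i \<le> j \<Longrightarrow> f i \<subseteq> f j" for i j
    by (rule lift_Suc_mono_le[of f]) (rule psubset_imp_subset[OF f(2)])
  have "subset.chain {I. ideal I R} (range f)"
    unfolding subset.chain_def
  proof (intro conjI ballI)
    fix A B assume "A \<in> range f" "B \<in> range f"
    then obtain i j where ij: "A = f i" "B = f j" by blast
    show "subset.Peq A B \<or> subset.Peq B A"
      using mono[of i j] mono[of j i] ij by (cases "i \<le> j") auto
  qed (use f(1) in auto)
  from ideal_chain_is_trivial[OF _ this] obtain n where "\<Union> (range f) = f n" by auto
  then show False using f(2)[of n] by auto
qed

text \<open>Noetherian induction on the value \<open>f n\<close>. One repetition is all that
  \<open>artin_rees_weak\<close> asks for; there the equality propagates by itself.\<close>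

lemma ideal_chain_stable:
  assumes "\<And>n. ideal (f n) R" "\<And>n. f n \<subseteq> f (Suc n)"
  obtains n where "f (Suc n) = f n"
proof -
  have "\<forall>n. f n = J \<longrightarrow> (\<exists>n. f (Suc n) = f n)" if "ideal J R" for J
    using that
  proof (induction J rule: ideal_induct)
    case (step J)
    show ?case
    proof (intro allI impI)
      fix n assume "f n = J"
      then show "\<exists>n. f (Suc n) = f n" using assms step.IH[of "f (Suc n)"] by blast
    qed
  qed
  then show ?thesis using that assms(1) by blast
qed

lemma ideal_list:
  assumes "ideal I R"
  obtains xs where "set xs \<subseteq> I" "adjoin_list {\<zero>} xs = I"
proof -
  obtain A where A: "A \<subseteq> carrier R" "finite A" "I = Idl A" using finetely_gen[OF assms] by blast
  obtain xs where xs: "set xs = A" using finite_list[OF A(2)] by blast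
  have AI: "A \<subseteq> I" using A genideal_self by auto
  have "adjoin_list {\<zero>} xs \<subseteq> I"
    using assms AI xs ideal_mem(3)[OF assms] by (intro adjoin_list_subset) auto
  moreover have "Idl A \<subseteq> adjoin_list {\<zero>} xs"
    using xs A set_subset_adjoin_list[OF zeroideal, of xs] by (intro genideal_minimal adjoin_list_ideal zeroideal) auto
  ultimately show ?thesis using that[of xs] xs AI A by auto
qed

text \<open>Finitely many generators need only finitely many denominators, and their product serves
  for all of \<open>K\<close> because the elements that it sends into \<open>I\<close> form the
  ideal \<open>colon I s\<close>. The same \<open>s\<close> works at every prime that avoids it;
  this is where openness comes from.\<close>

lemma sat_uniform:
  assumes q: "primeideal q R" and I: "ideal I R" and K: "ideal K R" "K \<subseteq> sat q I"
  obtains s where "s \<in> carrier R - q" "\<And>k. k \<in> K \<Longrightarrow> s \<otimes> k \<in> I"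
proof -
  obtain xs where xs: "set xs \<subseteq> K" "adjoin_list {\<zero>} xs = K" using ideal_list[OF K(1)] .
  have "\<exists>s \<in> carrier R - q. \<forall>x \<in> set xs. s \<otimes> x \<in> I" if "set xs \<subseteq> sat q I" for xs
    using that
  proof (induction xs)
    case Nil
    then show ?case using prime_compl_one[OF q] by auto
  next
    case (Cons x xs)
    obtain s where s: "s \<in> carrier R - q" "\<forall>x \<in> set xs. s \<otimes> x \<in> I" using Cons by auto
    obtain t where t: "t \<in> carrier R" "t \<notin> q" "t \<otimes> x \<in> I" "x \<in> carrier R" using Cons.prems by (auto elim: satE)
    have "(s \<otimes> t) \<otimes> y \<in> I" if y: "y \<in> set (x # xs)" for y
    proof (cases "y = x")
      case True
      then have "(s \<otimes> t) \<otimes> y = s \<otimes> (t \<otimes> x)" using s t by (simp add: m_assoc)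
      then show ?thesis using s t ideal_mem(7)[OF I] by auto
    next
      case False
      then have y: "y \<in> set xs" "y \<in> carrier R" using y Cons.prems by (auto elim: satE)
      then have "(s \<otimes> t) \<otimes> y = t \<otimes> (s \<otimes> y)" using s t by (simp add: m_ac)
      then show ?thesis using s t y ideal_mem(7)[OF I] by auto
    qed
    then show ?case using s t prime_compl_mult[OF q, of s t] by blast
  qed
  then obtain s where s: "s \<in> carrier R - q" "\<forall>x \<in> set xs. s \<otimes> x \<in> I" using xs K by blast
  have sc: "s \<in> carrier R" using s(1) by blast
  have "adjoin_list {\<zero>} xs \<subseteq> colon I s"
    using s sc xs K I ideal_mem(1)[OF K(1)]
    by (intro adjoin_list_subset colon_ideal) (auto simp: colon_def ideal_mem(3)[OF I])
  then show ?thesis using that[OF s(1)] xs(2) by (auto simp: colon_def)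
qed

end


section \<open>Nakayama's lemma and descending chains\<close>

lemma (in ring) ideal_prod_subset:
  assumes "ideal K R" "\<And>a b. a \<in> I \<Longrightarrow> b \<in> J \<Longrightarrow> a \<otimes> b \<in> K"
  shows "I \<cdot> J \<subseteq> K"
proof
  fix x assume "x \<in> I \<cdot> J"
  then show "x \<in> K" by induction (auto intro: assms(2) ideal_mem(4)[OF assms(1)])
qed

context cring begin

text \<open>\<open>k\<close> counts the strict inclusions. The chain is unfolded from its bottom
  because the inductions below replace the bottom prime by a larger one. If the top lies in
  \<open>q\<close>, the chain bounds the dimension of R_q from below.\<close>

primrec prime_chain :: "nat \<Rightarrow> 'a set \<Rightarrow> 'a set \<Rightarrow> bool" where
  "prime_chain 0 P Q \<longleftrightarrow> primeideal P R \<and> P = Q"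
| "prime_chain (Suc k) P Q \<longleftrightarrow> primeideal P R \<and> (\<exists>P'. P \<subset> P' \<and> prime_chain k P' Q)"

lemma prime_chain_prime: "prime_chain k P Q \<Longrightarrow> primeideal P R"
  by (cases k) auto

lemma prime_chain_subset: "prime_chain k P Q \<Longrightarrow> P \<subseteq> Q"
proof (induction k arbitrary: P)
  case (Suc k)
  then obtain P' where P': "P \<subset> P'" "prime_chain k P' Q" by auto
  show ?case using psubset_imp_subset[OF P'(1)] Suc.IH[OF P'(2)] by (rule subset_trans)
qed simp

text \<open>Only the last prime changes. One step is required, since in a chain of length 0
  enlarging the top would also move the bottom.\<close>

lemma prime_chain_extend:
  assumes "primeideal q R" "Q \<subseteq> q"
  shows "prime_chain (Suc k) P Q \<Longrightarrow> prime_chain (Suc k) P q"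
proof (induction k arbitrary: P)
  case 0
  then have "primeideal P R" "P \<subset> Q" by auto
  then have "P \<subset> q" using assms(2) by (auto simp: psubset_eq)
  then show ?case using \<open>primeideal P R\<close> assms(1) by auto
next
  case (Suc k)
  then obtain P' where "primeideal P R" "P \<subset> P'" "prime_chain (Suc k) P' Q" by auto
  then show ?case using Suc.IH[of P'] by auto
qed

text \<open>The list is a weakly regular sequence on R_q/J R_q: the quotients are allowed to vanish.
  Testing elements \<open>r\<close> of \<open>R\<close> covers all fractions, since denominators are
  units of R_q.\<close>

primrec regular_seq_at :: "'a set \<Rightarrow> 'a set \<Rightarrow> 'a list \<Rightarrow> bool" where
  "regular_seq_at q J [] \<longleftrightarrow> True"
| "regular_seq_at q J (z # zs) \<longleftrightarrow>
     (\<forall>r \<in> carrier R. r \<otimes> z \<in> J \<longrightarrow> r \<in> sat q J) \<and> regular_seq_at q (adjoin J z) zs"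

end

context noetherian_cring begin

text \<open>Hypothesis \<open>H\<close> expresses that N is locally contained in L + q N, without
  forming the sum: it tests all ideals \<open>K\<close> that contain both. Generators of
  \<open>N\<close> are discarded one by one. If N lies locally in L' + (g), then g lies locally in
  L' + q g, and 1 - a is a unit of R_q for a in q.\<close>

lemma nakayama_at:
  assumes q: "primeideal q R" and L: "ideal L R" and N: "ideal N R"
    and H: "\<And>K. ideal K R \<Longrightarrow> L \<subseteq> K \<Longrightarrow> (\<And>a b. a \<in> q \<Longrightarrow> b \<in> N \<Longrightarrow> a \<otimes> b \<in> K) \<Longrightarrow> N \<subseteq> sat q K"
  shows "N \<subseteq> sat q L"
proof -
  note qi = ideal_mem[OF prime_ideal[OF q]]
  have main: "N \<subseteq> sat q L'" if "set gs \<subseteq> N" "ideal L' R" "L \<subseteq> L'" "N \<subseteq> sat q (adjoin_list L' gs)" for gs L'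
    using that
  proof (induction gs arbitrary: L')
    case Nil
    then show ?case by simp
  next
    case (Cons g gs)
    note L' = ideal_mem[OF Cons.prems(2)]
    have gN: "g \<in> N" and g: "g \<in> carrier R" using Cons.prems(1) ideal_mem(2)[OF N] by auto
    have aL: "ideal (adjoin L' g) R" by (rule adjoin_ideal[OF Cons.prems(2) g])
    have "L \<subseteq> adjoin L' g" using Cons.prems(3) subset_adjoin[OF Cons.prems(2) g] by blast
    then have 1: "N \<subseteq> sat q (adjoin L' g)" using Cons.IH[OF _ aL] Cons.prems by auto
    \<comment> \<open>The ideal L' + q g. By fact \<open>1\<close> it contains q N locally, so
      \<open>H\<close> applies to its saturation.\<close>
    define M where "M = {l \<oplus> a \<otimes> g | l a. l \<in> L' \<and> a \<in> q}"
    have M: "ideal M R"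
    proof (rule cring_idealI)
      show "M \<subseteq> carrier R" using L'(2) qi(2) g by (auto simp: M_def)
      have "\<zero> = \<zero> \<oplus> \<zero> \<otimes> g" using g by simp
      then show "\<zero> \<in> M" using L'(3) qi(3) unfolding M_def by blast
      fix x assume "x \<in> M"
      then obtain l a where x: "x = l \<oplus> a \<otimes> g" "l \<in> L'" "a \<in> q" by (auto simp: M_def)
      { fix y assume "y \<in> M"
        then obtain k b where y: "y = k \<oplus> b \<otimes> g" "k \<in> L'" "b \<in> q" by (auto simp: M_def)
        have "x \<oplus> y = (l \<oplus> k) \<oplus> (a \<oplus> b) \<otimes> g"
          using x y g L'(2)[of l] L'(2)[of k] qi(2)[of a] qi(2)[of b] by algebra
        then show "x \<oplus> y \<in> M" using x y L'(4) qi(4) unfolding M_def by blast }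
      { fix r assume r: "r \<in> carrier R"
        have "r \<otimes> x = (r \<otimes> l) \<oplus> (r \<otimes> a) \<otimes> g"
          using x r g L'(2)[of l] qi(2)[of a] by algebra
        then show "r \<otimes> x \<in> M" using x r L'(7) qi(7) unfolding M_def by blast }
    qed
    have LM: "L' \<subseteq> M"
    proof
      fix l assume l: "l \<in> L'"
      then have "l = l \<oplus> \<zero> \<otimes> g" using L'(2) g by simp
      then show "l \<in> M" using l qi(3) unfolding M_def by blast
    qed
    have sM: "ideal (sat q M) R" by (rule sat_ideal[OF q M])
    have "N \<subseteq> sat q (sat q M)"
    proof (rule H[OF sM])
      show "L \<subseteq> sat q M" using Cons.prems(3) LM subset_sat[OF q ideal_mem(1)[OF M]] by blast
      fix a b assume ab: "a \<in> q" "b \<in> N"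
      then have "b \<in> sat q (adjoin L' g)" using 1 by blast
      then obtain t where t: "t \<in> carrier R" "t \<notin> q" "t \<otimes> b \<in> adjoin L' g" "b \<in> carrier R" by (rule satE)
      from t(3) obtain l c where lc: "l \<in> L'" "c \<in> carrier R" "t \<otimes> b = l \<oplus> c \<otimes> g" by (rule adjoinE)
      have a: "a \<in> carrier R" using qi(2) ab by blast
      have "t \<otimes> (a \<otimes> b) = a \<otimes> (t \<otimes> b)" using a t by algebra
      also have "\<dots> = a \<otimes> l \<oplus> (a \<otimes> c) \<otimes> g" unfolding lc(3) using a lc g L'(2)[of l] by algebra
      also have "\<dots> \<in> M" using ab a lc L'(7) qi(8) unfolding M_def by blast
      finally show "a \<otimes> b \<in> sat q M" using t a by (intro satI[of _ t]) auto
    qed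
    then have "N \<subseteq> sat q M" using sat_sat[OF q, of M] by blast
    then have "g \<in> sat q M" using gN by blast
    then obtain t where t: "t \<in> carrier R" "t \<notin> q" "t \<otimes> g \<in> M" by (rule satE)
    then obtain l a where la: "t \<otimes> g = l \<oplus> a \<otimes> g" "l \<in> L'" "a \<in> q" by (auto simp: M_def)
    have a: "a \<in> carrier R" using qi(2) la by blast
    have "(t \<ominus> a) \<otimes> g = t \<otimes> g \<ominus> a \<otimes> g" using t a g by algebra
    also have "\<dots> = l" unfolding la(1) using a g L'(2)[OF la(2)] by algebra
    finally have e: "(t \<ominus> a) \<otimes> g \<in> L'" using la by simp
    have "t \<ominus> a \<notin> q"
    proof
      assume "t \<ominus> a \<in> q"
      then have "(t \<ominus> a) \<oplus> a \<in> q" using la qi(4) by blast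
      moreover have "(t \<ominus> a) \<oplus> a = t" using t a by algebra
      ultimately show False using t by simp
    qed
    then have gL: "g \<in> sat q L'" using e t a g by (intro satI[of _ "t \<ominus> a"]) auto
    have "adjoin L' g \<subseteq> sat q L'"
      using gL subset_sat[OF q L'(1)] sat_ideal[OF q Cons.prems(2)] by (intro adjoin_subset)
    then show ?case using 1 sat_sat[OF q, of L'] sat_mono[of "adjoin L' g" "sat q L'" q] by blast
  qed
  obtain gs where gs: "set gs \<subseteq> N" "adjoin_list {\<zero>} gs = N" using ideal_list[OF N] .
  have gsc: "set gs \<subseteq> carrier R" using gs ideal_mem(1)[OF N] by blast
  have "N \<subseteq> adjoin_list L gs"
    using adjoin_list_mono[OF L, of "{\<zero>}" gs gs] gs(2) gsc ideal_mem(3)[OF L] set_subset_adjoin_list[OF L gsc] by simp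
  also have "\<dots> \<subseteq> sat q (adjoin_list L gs)"
    using subset_sat[OF q] ideal_mem(1)[OF adjoin_list_ideal[OF L gsc]] by blast
  finally show ?thesis using main[OF gs(1) L] by blast
qed

lemma saturated_eq_carrier:
  assumes "ideal I R" "sat q I \<subseteq> I" "s \<in> I" "s \<notin> q"
  shows "carrier R \<subseteq> I"
proof
  fix r assume r: "r \<in> carrier R"
  have "s \<otimes> r \<in> I" "s \<in> carrier R" using r assms ideal_mem[OF assms(1)] by auto
  with assms(4) r have "r \<in> sat q I" by (intro satI[of r s]) auto
  then show "r \<in> I" using assms(2) by blast
qed

text \<open>If \<open>a b \<in> J\<close>, then the chain is controlled by the chains \<open>f n + (a)\<close> and \<open>f n : a\<close>, which lie
  above the larger ideals \<open>J + (a)\<close> and \<open>J : a\<close>.\<close>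

lemma saturated_descending_chain:
  assumes q: "primeideal q R" and J: "ideal J R"
    and "\<And>p. primeideal p R \<Longrightarrow> J \<subseteq> p \<Longrightarrow> p \<subseteq> q \<Longrightarrow> p = q"
    and "\<And>n. ideal (f n) R" "\<And>n. sat q (f n) \<subseteq> f n" "\<And>n. f (Suc n) \<subseteq> f n" "\<And>n. J \<subseteq> f n"
  shows "\<exists>N. \<forall>n \<ge> N. f n \<subseteq> f (Suc n)"
  using J assms(3-)
proof (induction J arbitrary: f rule: ideal_induct)
  case (step J)
  note f = step.prems(2-5)
  have fc: "f n \<subseteq> carrier R" for n using ideal_mem(1)[OF f(1)] .
  have unit: "carrier R \<subseteq> f n" if "s \<in> f n" "s \<notin> q" for s n
    using saturated_eq_carrier[OF f(1,2) that] .
  consider "\<not> J \<subseteq> q" | "J \<subseteq> q" "primeideal J R" | "J \<subseteq> q" "\<not> primeideal J R" by blast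
  then show ?case
  proof cases
    case 1
    then obtain s where "s \<in> J" "s \<notin> q" by blast
    then have "carrier R \<subseteq> f n" for n using unit[OF subsetD[OF f(4)]] by simp
    then show ?thesis using fc by blast
  next
    case 2
    \<comment> \<open>Each \<open>f n\<close> contains the prime q and is saturated, so it is either
      q or the whole ring.\<close>
    then have Jq: "J = q" using step.prems(1) by blast
    show ?thesis
    proof (cases "\<exists>N. f N \<subseteq> q")
      case True
      then obtain N where N: "f N \<subseteq> q" ..
      have "f n \<subseteq> f (Suc n)" if "n \<ge> N" for n
      proof -
        have "f n \<subseteq> f N" using that f(3) by (rule lift_Suc_antimono_le[of f, rotated])
        then show ?thesis using N f(4)[of "Suc n"] Jq by blast
      qed
      then show ?thesis by blast
    next
      case False
      have "carrier R \<subseteq> f n" for n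
      proof -
        obtain s where "s \<in> f n" "s \<notin> q" using False by auto
        then show ?thesis by (rule unit)
      qed
      then show ?thesis using fc by blast
    qed
  next
    case 3
    have "J \<noteq> carrier R" using 3(1) prime_one[OF q] by auto
    then obtain a b where ab: "a \<in> carrier R" "b \<in> carrier R" "a \<otimes> b \<in> J" "a \<notin> J" "b \<notin> J"
      using not_prime_ideal_witnesses[OF step.hyps 3(2)] by blast
    note a = ab(1)
    define g where "g n = sat q (adjoin (f n) a)" for n
    define h where "h n = colon (f n) a" for n
    have ai: "ideal (adjoin (f n) a) R" for n by (rule adjoin_ideal[OF f(1) a])
    have gsub: "adjoin (f n) a \<subseteq> g n" for n
      unfolding g_def by (rule subset_sat[OF q ideal_mem(1)[OF ai]])
    have Ja: "J \<subset> adjoin J a" "J \<subset> colon J a"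
      using subset_adjoin[OF step.hyps a] mem_adjoin[OF step.hyps a] ab(4)
        subset_colon[OF step.hyps a] ab unfolding psubset_eq colon_def by blast+
    have gN: "\<exists>N. \<forall>n \<ge> N. g n \<subseteq> g (Suc n)"
    proof (rule step.IH[OF _ Ja(1)])
      show "ideal (adjoin J a) R" by (rule adjoin_ideal[OF step.hyps a])
      show "p = q" if "primeideal p R" "adjoin J a \<subseteq> p" "p \<subseteq> q" for p
        using step.prems(1)[OF that(1)] that Ja(1) by blast
      show "ideal (g n) R" for n unfolding g_def by (rule sat_ideal[OF q ai])
      show "sat q (g n) \<subseteq> g n" for n unfolding g_def by (rule sat_sat[OF q])
      show "g (Suc n) \<subseteq> g n" for n unfolding g_def
        using f(3)[of n] subset_adjoin[OF f(1) a, of n] mem_adjoin[OF f(1) a, of n]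
        by (intro sat_mono adjoin_subset[OF ai]) auto
      show "adjoin J a \<subseteq> g n" for n
        using f(4)[of n] subset_adjoin[OF f(1) a, of n] mem_adjoin[OF f(1) a, of n] gsub[of n]
          adjoin_subset[OF ai[of n], of J a] by blast
    qed
    have hN: "\<exists>N. \<forall>n \<ge> N. h n \<subseteq> h (Suc n)"
    proof (rule step.IH[OF _ Ja(2)])
      show "ideal (colon J a) R" by (rule colon_ideal[OF step.hyps a])
      show "p = q" if "primeideal p R" "colon J a \<subseteq> p" "p \<subseteq> q" for p
        using step.prems(1)[OF that(1)] that Ja(2) by blast
      show "ideal (h n) R" for n unfolding h_def by (rule colon_ideal[OF f(1) a])
      show "sat q (h n) \<subseteq> h n" for n
      proof
        fix r assume "r \<in> sat q (h n)"
        then obtain s where s: "s \<in> carrier R" "s \<notin> q" "s \<otimes> r \<in> h n" "r \<in> carrier R" by (rule satE)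
        have "s \<otimes> (a \<otimes> r) = a \<otimes> (s \<otimes> r)" using s a by algebra
        then have "a \<otimes> r \<in> sat q (f n)" using s a by (intro satI[of _ s]) (auto simp: h_def colon_def)
        then show "r \<in> h n" using f(2)[of n] s by (auto simp: h_def colon_def)
      qed
      show "h (Suc n) \<subseteq> h n" for n using f(3)[of n] by (auto simp: h_def colon_def)
      show "colon J a \<subseteq> h n" for n using f(4)[of n] by (auto simp: h_def colon_def)
    qed
    obtain N1 where N1: "\<And>n. n \<ge> N1 \<Longrightarrow> g n \<subseteq> g (Suc n)" using gN by blast
    obtain N2 where N2: "\<And>n. n \<ge> N2 \<Longrightarrow> h n \<subseteq> h (Suc n)" using hN by blast
    \<comment> \<open>Stability of \<open>g\<close> gives s i = j + c a with j in
      \<open>f (Suc n)\<close>. Then c lies in \<open>h n\<close>, hence in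
      \<open>h (Suc n)\<close>, so c a lies in \<open>f (Suc n)\<close> as well.\<close>
    have "f n \<subseteq> f (Suc n)" if n: "n \<ge> max N1 N2" for n
    proof
      fix i assume i: "i \<in> f n"
      then have "i \<in> g (Suc n)"
        using N1[of n] n gsub[of n] subset_adjoin[OF f(1) a, of n] by auto
      then obtain s where s: "s \<in> carrier R" "s \<notin> q" "s \<otimes> i \<in> adjoin (f (Suc n)) a" "i \<in> carrier R"
        unfolding g_def by (rule satE)
      from s(3) obtain j c where jc: "j \<in> f (Suc n)" "c \<in> carrier R" "s \<otimes> i = j \<oplus> c \<otimes> a" by (rule adjoinE)
      have j: "j \<in> f n" "j \<in> carrier R" using jc f(3)[of n] fc[of n] by auto
      have "a \<otimes> c = s \<otimes> i \<ominus> j" unfolding jc(3) using jc j a by algebra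
      then have "a \<otimes> c \<in> f n"
        using ideal_mem(6)[OF f(1), of "s \<otimes> i" n j] ideal_mem(7)[OF f(1) s(1) i] j by simp
      then have "c \<in> h (Suc n)" using N2[of n] n jc by (auto simp: h_def colon_def)
      then have "c \<otimes> a \<in> f (Suc n)" using a jc by (simp add: h_def colon_def m_comm)
      then have "s \<otimes> i \<in> f (Suc n)" unfolding jc(3) using jc ideal_mem(4)[OF f(1)] by blast
      then show "i \<in> f (Suc n)" using f(2)[of "Suc n"] s by (auto intro!: satI[of i s])
    qed
    then show ?thesis by blast
  qed
qed

end


section \<open>Chains of primes and regular sequences\<close>

context noetherian_cring begin

lemma prime_pow:
  assumes "primeideal p R" "y \<in> carrier R" "y \<notin> p"
  shows "y [^] (n::nat) \<notin> p"
proof (induction n)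
  case 0
  then show ?case using prime_one[OF assms(1)] by simp
next
  case (Suc n)
  then show ?case using prime_mult[OF assms(1), of "y [^] n" y] assms by auto
qed

text \<open>Krull's principal ideal theorem: if \<open>P2\<close> were minimal over \<open>P0 + (x)\<close>, then the saturations
  \<open>I n\<close> of \<open>P0 + (y\<^sup>n)\<close> at \<open>Q\<close>, for some \<open>y \<in> Q - P0\<close>, would be eventually constant modulo \<open>x\<close> at
  \<open>P2\<close>, hence eventually constant by Nakayama's lemma, which forces \<open>y \<in> P0\<close>.\<close>

lemma prime_between:
  assumes P0: "primeideal P0 R" and Q: "primeideal Q R" and P2: "primeideal P2 R"
    and sub: "P0 \<subset> Q" "Q \<subset> P2" and x: "x \<in> P2"
  shows "\<exists>P1. primeideal P1 R \<and> P0 \<subset> P1 \<and> P1 \<subset> P2 \<and> x \<in> P1"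
proof (cases "x \<in> Q")
  case True
  then show ?thesis using Q sub by auto
next
  case False
  note i0 = prime_ideal[OF P0] and iQ = prime_ideal[OF Q] and i2 = prime_ideal[OF P2]
  have xc: "x \<in> carrier R" using ideal_mem(2)[OF i2 x] .
  show ?thesis
  proof (rule ccontr)
    assume no: "\<not> ?thesis"
    obtain y where y: "y \<in> Q" "y \<notin> P0" using sub(1) by blast
    have yc: "y \<in> carrier R" using ideal_mem(2)[OF iQ y(1)] .
    define A where "A n = adjoin P0 (y [^] (n::nat))" for n
    define I where "I n = sat Q (A n)" for n
    define f where "f n = sat P2 (adjoin (I n) x)" for n
    have Ai: "ideal (A n) R" for n unfolding A_def by (rule adjoin_ideal[OF i0]) (use yc in simp)
    have Ii: "ideal (I n) R" for n unfolding I_def by (rule sat_ideal[OF Q Ai])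
    have AI: "A n \<subseteq> I n" for n unfolding I_def by (rule subset_sat[OF Q ideal_mem(1)[OF Ai]])
    have Idec: "I (Suc n) \<subseteq> I n" for n
    proof -
      have "y [^] n \<in> A n" unfolding A_def by (rule mem_adjoin[OF i0]) (use yc in simp)
      then have "y [^] Suc n \<in> A n" using ideal_mem(8)[OF Ai yc] by simp
      then have "A (Suc n) \<subseteq> A n"
        using subset_adjoin[OF i0, of "y [^] n"] yc unfolding A_def[of "Suc n"]
        by (intro adjoin_subset[OF Ai]) (auto simp: A_def)
      then show ?thesis unfolding I_def by (rule sat_mono)
    qed
    have PI: "P0 \<subseteq> I n" for n
      using AI[of n] subset_adjoin[OF i0, of "y [^] n"] yc by (auto simp: A_def)
    have adi: "ideal (adjoin (I n) x) R" for n by (rule adjoin_ideal[OF Ii xc])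
    have adf: "adjoin (I n) x \<subseteq> f n" for n
      unfolding f_def by (rule subset_sat[OF P2 ideal_mem(1)[OF adi]])
    have "\<exists>N. \<forall>n \<ge> N. f n \<subseteq> f (Suc n)"
    proof (rule saturated_descending_chain[OF P2])
      show "ideal (adjoin P0 x) R" by (rule adjoin_ideal[OF i0 xc])
      show "p = P2" if p: "primeideal p R" "adjoin P0 x \<subseteq> p" "p \<subseteq> P2" for p
      proof (rule ccontr)
        assume "p \<noteq> P2"
        have "x \<in> p" "P0 \<subseteq> p" using p(2) mem_adjoin[OF i0 xc] subset_adjoin[OF i0 xc] by auto
        moreover have "x \<notin> P0" using False sub(1) by auto
        ultimately have "P0 \<subset> p" "p \<subset> P2" using \<open>p \<noteq> P2\<close> p(3) by auto
        then show False using no p(1) \<open>x \<in> p\<close> by metis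
      qed
      show "ideal (f n) R" for n unfolding f_def by (rule sat_ideal[OF P2 adi])
      show "sat P2 (f n) \<subseteq> f n" for n unfolding f_def by (rule sat_sat[OF P2])
      show "f (Suc n) \<subseteq> f n" for n unfolding f_def
        using Idec[of n] subset_adjoin[OF Ii xc, of n] mem_adjoin[OF Ii xc, of n]
        by (intro sat_mono adjoin_subset[OF adi]) auto
      show "adjoin P0 x \<subseteq> f n" for n
        using PI[of n] subset_adjoin[OF Ii xc, of n] mem_adjoin[OF Ii xc, of n] adf[of n]
          adjoin_subset[OF adi[of n], of P0 x] by blast
    qed
    then obtain n where n: "f n \<subseteq> f (Suc n)" by blast
    have "I n \<subseteq> sat P2 (I (Suc n))"
    proof (rule nakayama_at[OF P2 Ii Ii])
      fix K assume K: "ideal K R" "I (Suc n) \<subseteq> K" "\<And>a b. a \<in> P2 \<Longrightarrow> b \<in> I n \<Longrightarrow> a \<otimes> b \<in> K"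
      show "I n \<subseteq> sat P2 K"
      proof
        fix r assume r: "r \<in> I n"
        then have "r \<in> f (Suc n)" using n adf[of n] subset_adjoin[OF Ii xc, of n] by blast
        then obtain s where s: "s \<in> carrier R" "s \<notin> P2" "s \<otimes> r \<in> adjoin (I (Suc n)) x" "r \<in> carrier R"
          unfolding f_def by (rule satE)
        from s(3) obtain i c where ic: "i \<in> I (Suc n)" "c \<in> carrier R" "s \<otimes> r = i \<oplus> c \<otimes> x" by (rule adjoinE)
        have i: "i \<in> I n" "i \<in> carrier R" using ic Idec[of n] ideal_mem(2)[OF Ii] by auto
        have "x \<otimes> c = s \<otimes> r \<ominus> i" unfolding ic(3) using ic i xc by algebra
        then have "x \<otimes> c \<in> I n" using ideal_mem(6,7)[OF Ii] s r i by simp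
        \<comment> \<open>\<open>I n\<close> is saturated at \<open>Q\<close> and x is outside
          \<open>Q\<close>, so x can be cancelled. Thus, locally at \<open>P2\<close>,
          \<open>I n\<close> is contained in \<open>I (Suc n)\<close> + x \<open>I n\<close>, as
          Nakayama's lemma requires.\<close>
        then have "c \<in> sat Q (I n)" using False xc ic by (intro satI[of _ x]) auto
        then have "c \<in> I n" using sat_sat[OF Q, of "A n"] unfolding I_def by blast
        then have "c \<otimes> x \<in> K" using K(3)[OF x] m_comm[OF ic(2) xc] by simp
        then have "s \<otimes> r \<in> K" unfolding ic(3) using K(2) ic ideal_mem(4)[OF K(1)] by blast
        then show "r \<in> sat P2 K" using s by (intro satI[of _ s]) auto
      qed
    qed
    also have "\<dots> \<subseteq> sat Q (I (Suc n))" using sub(2) by (intro sat_anti) auto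
    also have "\<dots> \<subseteq> I (Suc n)" unfolding I_def by (rule sat_sat[OF Q])
    finally have "y [^] n \<in> I (Suc n)"
      using AI[of n] mem_adjoin[OF i0, of "y [^] n"] yc by (auto simp: A_def)
    then obtain t where t: "t \<in> carrier R" "t \<notin> Q" "t \<otimes> y [^] n \<in> A (Suc n)" unfolding I_def by (rule satE)
    from t(3) obtain p c where pc: "p \<in> P0" "c \<in> carrier R" "t \<otimes> y [^] n = p \<oplus> c \<otimes> y [^] Suc n"
      unfolding A_def by (rule adjoinE)
    have pcar: "p \<in> carrier R" using ideal_mem(2)[OF i0 pc(1)] .
    define w where "w = y [^] n"
    have w: "w \<in> carrier R" "t \<otimes> w = p \<oplus> c \<otimes> (w \<otimes> y)" using yc pc by (auto simp: w_def)
    \<comment> \<open>Modulo the prime \<open>P0\<close> the power w of y can be cancelled, which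
      leaves t = c y there. As y lies in \<open>Q\<close>, this forces t into
      \<open>Q\<close>.\<close>
    have "(t \<ominus> c \<otimes> y) \<otimes> w = t \<otimes> w \<ominus> c \<otimes> (w \<otimes> y)" using t pc yc w(1) by algebra
    also have "\<dots> = p" unfolding w(2) using t pc yc w(1) pcar by algebra
    finally have "(t \<ominus> c \<otimes> y) \<otimes> w \<in> P0" using pc by simp
    moreover have "w \<notin> P0" unfolding w_def by (rule prime_pow[OF P0 yc y(2)])
    ultimately have "t \<ominus> c \<otimes> y \<in> P0"
      using prime_mult[OF P0, of "t \<ominus> c \<otimes> y" w] t pc yc w by auto
    then have "t \<ominus> c \<otimes> y \<in> Q" using sub(1) by auto
    then have "(t \<ominus> c \<otimes> y) \<oplus> c \<otimes> y \<in> Q" using ideal_mem(4,7)[OF iQ] y pc by simp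
    moreover have "(t \<ominus> c \<otimes> y) \<oplus> c \<otimes> y = t" using t pc yc by algebra
    ultimately show False using t by simp
  qed
qed

text \<open>\<open>prime_between\<close>, applied from the top down, moves \<open>x\<close> into
  ever lower primes without shortening the chain, until only the bottom may miss it. In terms of
  dimension, dividing by one element of \<open>Q\<close> costs at most one step.\<close>

lemma prime_chain_through:
  "prime_chain (Suc k) P Q \<Longrightarrow> x \<in> Q \<Longrightarrow> \<exists>P'. P \<subset> P' \<and> x \<in> P' \<and> prime_chain k P' Q"
proof (induction k arbitrary: P)
  case 0
  then show ?case by auto
next
  case (Suc k)
  then obtain P1 where P1: "primeideal P R" "P \<subset> P1" "prime_chain (Suc k) P1 Q" by auto
  from Suc.IH[OF P1(3) Suc.prems(2)] obtain P2 where P2: "P1 \<subset> P2" "x \<in> P2" "prime_chain k P2 Q" by auto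
  obtain P' where "primeideal P' R" "P \<subset> P'" "P' \<subset> P2" "x \<in> P'"
    using prime_between[OF P1(1) prime_chain_prime[OF P1(3)] prime_chain_prime[OF P2(3)] P1(2) P2(1,2)] by auto
  then show ?case using P2(3) by auto
qed

text \<open>For \<open>J = 0\<close> this is the theorem that a regular local ring is a domain.\<close>

lemma chain_bottom_subset:
  assumes q: "primeideal q R" and "Q \<subseteq> q"
    and "ideal J R" "set xs \<subseteq> q" "q \<subseteq> sat q (adjoin_list J xs)" "prime_chain (length xs) P Q" "J \<subseteq> P"
  shows "P \<subseteq> sat q J"
  using assms(2-)
proof (induction xs arbitrary: J P Q)
  case Nil
  then show ?case by auto
next
  case (Cons x xs)
  note Qq = Cons.prems(1)
  note prems = Cons.prems(2-)
  have c: "prime_chain (Suc (length xs)) P Q" using prems(4) by (simp only: list.size add_0_right add_Suc_right)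
  have xq: "x \<in> q" using prems(2) by simp
  \<comment> \<open>\<open>x\<close> need not lie in \<open>Q\<close>, so the chain is first made to
    end at \<open>q\<close>.\<close>
  obtain P' where P': "P \<subset> P'" "x \<in> P'" "prime_chain (length xs) P' q"
    using prime_chain_through[OF prime_chain_extend[OF q Qq c] xq] by (elim exE conjE)
  have xc: "x \<in> carrier R" using prime_carrier[OF q] xq by auto
  have P: "primeideal P R" by (rule prime_chain_prime[OF prems(4)])
  note iP = prime_ideal[OF P] and iP' = prime_ideal[OF prime_chain_prime[OF P'(3)]]
  have Pq: "P \<subseteq> q" using P'(1) prime_chain_subset[OF P'(3)] by auto
  have jx: "ideal (adjoin J x) R" by (rule adjoin_ideal[OF prems(1) xc])
  have "adjoin J x \<subseteq> P'" using prems(5) P' by (intro adjoin_subset[OF iP']) auto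
  then have sub: "P' \<subseteq> sat q (adjoin J x)"
    using Cons.IH[OF subset_refl jx _ _ P'(3)] prems(2,3) by simp
  \<comment> \<open>By induction P' is locally contained in J + (x), so x in P would give P' inside
    P.\<close>
  have xP: "x \<notin> P"
  proof
    assume "x \<in> P"
    then have "adjoin J x \<subseteq> P" using prems(5) by (intro adjoin_subset[OF iP])
    then have "sat q (adjoin J x) \<subseteq> sat q P" by (rule sat_mono)
    then show False using sub sat_prime[OF P Pq] P'(1) by blast
  qed
  \<comment> \<open>As x is outside the prime P, an equation s r = j + c x with r and j in P puts c
    into P. Hence P lies locally in J + x P, and Nakayama's lemma removes the second
    summand.\<close>
  show ?case
  proof (rule nakayama_at[OF q prems(1) iP])
    fix K assume K: "ideal K R" "J \<subseteq> K" "\<And>a b. a \<in> q \<Longrightarrow> b \<in> P \<Longrightarrow> a \<otimes> b \<in> K"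
    show "P \<subseteq> sat q K"
    proof
      fix r assume r: "r \<in> P"
      then have "r \<in> sat q (adjoin J x)" using sub P'(1) by auto
      then obtain s where s: "s \<in> carrier R" "s \<notin> q" "s \<otimes> r \<in> adjoin J x" "r \<in> carrier R" by (rule satE)
      from s(3) obtain j c where jc: "j \<in> J" "c \<in> carrier R" "s \<otimes> r = j \<oplus> c \<otimes> x" by (rule adjoinE)
      have j: "j \<in> P" "j \<in> carrier R" using jc prems(5) ideal_mem(2)[OF iP] by auto
      have "c \<otimes> x = s \<otimes> r \<ominus> j" unfolding jc(3) using jc j xc by algebra
      then have "c \<otimes> x \<in> P" using ideal_mem(6,7)[OF iP] s r j by simp
      then have "c \<in> P" using prime_mult[OF P jc(2) xc] xP by blast
      then have "c \<otimes> x \<in> K" using K(3)[OF xq] m_comm[OF jc(2) xc] by simp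
      then have "s \<otimes> r \<in> K" unfolding jc(3) using K(2) jc ideal_mem(4)[OF K(1)] by blast
      then show "r \<in> sat q K" using s by (intro satI[of _ s]) auto
    qed
  qed
qed

text \<open>Steinitz exchange in q/(J + q^2) over the residue field of q; \<open>ws\<close>
  generates q^2. Suppose z lies locally in J + (x) + q^2. If the coefficient of x is in q, its
  product with x is in q^2 and x drops out; otherwise the coefficient is a unit of R_q and z can
  replace x. In the remaining case the induction replaces a later generator.\<close>

lemma exchange_generator:
  assumes q: "primeideal q R" and ws: "adjoin_list {\<zero>} ws = q \<cdot> q" "set ws \<subseteq> q \<cdot> q" and z: "z \<in> q"
    and "ideal J R" "set xs \<subseteq> q" "q \<subseteq> sat q (adjoin_list J xs)"
  shows "z \<in> sat q (adjoin_list J ws) \<or>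
    (\<exists>ys. Suc (length ys) = length xs \<and> set ys \<subseteq> q \<and> q \<subseteq> sat q (adjoin_list (adjoin J z) ys))"
  using assms(5-)
proof (induction xs arbitrary: J)
  case Nil
  have "set ws \<subseteq> carrier R"
    using ws(2) ideal_prod_in_carrier[OF prime_ideal[OF q] prime_ideal[OF q]] by blast
  then show ?case using Nil sat_mono[OF subset_adjoin_list[of J ws], of q] z by auto
next
  case (Cons x xs)
  note iq = prime_ideal[OF q]
  have wc: "set ws \<subseteq> carrier R" using ws(2) ideal_prod_in_carrier[OF iq iq] by blast
  have xq: "x \<in> q" and xsq: "set xs \<subseteq> q" using Cons.prems(2) by auto
  have zc: "z \<in> carrier R" and xc: "x \<in> carrier R" and xsc: "set xs \<subseteq> carrier R"
    using prime_carrier[OF q] xq xsq z by auto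
  note iJ = Cons.prems(1)
  have jx: "ideal (adjoin J x) R" and jz: "ideal (adjoin J z) R"
    using adjoin_ideal[OF iJ] xc zc by auto
  have jw: "ideal (adjoin_list J ws) R" by (rule adjoin_list_ideal[OF iJ wc])
  have qq: "a \<otimes> b \<in> adjoin_list J ws" if "a \<in> q" "b \<in> q" for a b
  proof -
    have "a \<otimes> b \<in> adjoin_list {\<zero>} ws" unfolding ws(1) using that by (rule ideal_prod.prod)
    moreover have "adjoin_list {\<zero>} ws \<subseteq> adjoin_list J ws"
      by (intro adjoin_list_mono[OF iJ] set_subset_adjoin_list[OF iJ] wc) (use ideal_mem(3)[OF iJ] in auto)
    ultimately show ?thesis by blast
  qed
  have "q \<subseteq> sat q (adjoin_list (adjoin J x) xs)" using Cons.prems(3) by simp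
  from Cons.IH[OF jx xsq this]
  show ?case
  proof
    assume "z \<in> sat q (adjoin_list (adjoin J x) ws)"
    moreover have "adjoin_list J (x # ws) \<subseteq> adjoin_list J (ws @ [x])"
      using set_subset_adjoin_list[OF iJ, of "ws @ [x]"] wc xc by (intro adjoin_list_mono[OF iJ]) auto
    ultimately have "z \<in> sat q (adjoin (adjoin_list J ws) x)"
      using sat_mono[of "adjoin_list (adjoin J x) ws" "adjoin (adjoin_list J ws) x" q]
      by (auto simp: adjoin_list_snoc)
    then obtain t where t: "t \<in> carrier R" "t \<notin> q" "t \<otimes> z \<in> adjoin (adjoin_list J ws) x" by (rule satE)
    from t(3) obtain k c where kc: "k \<in> adjoin_list J ws" "c \<in> carrier R" "t \<otimes> z = k \<oplus> c \<otimes> x" by (rule adjoinE)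
    have kcar: "k \<in> carrier R" using ideal_mem(2)[OF jw kc(1)] .
    show ?thesis
    proof (cases "c \<in> q")
      case True
      then have "t \<otimes> z \<in> adjoin_list J ws"
        unfolding kc(3) using qq[OF True xq] kc ideal_mem(4)[OF jw] by blast
      then show ?thesis using t zc by (auto intro!: satI[of z t])
    next
      case False
      let ?L = "adjoin_list (adjoin J z) xs"
      have Li: "ideal ?L R" by (rule adjoin_list_ideal[OF jz xsc])
      \<comment> \<open>An ideal \<open>K\<close> containing \<open>?L\<close> and q^2 contains c x
        = t z - k, hence locally x because c is outside q. So it contains all old generators
        locally.\<close>
      have "q \<subseteq> sat q ?L"
      proof (rule nakayama_at[OF q Li iq])
        fix K assume K: "ideal K R" "?L \<subseteq> K" "\<And>a b. a \<in> q \<Longrightarrow> b \<in> q \<Longrightarrow> a \<otimes> b \<in> K"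
        have sK: "ideal (sat q K) R" and KsK: "K \<subseteq> sat q K"
          using sat_ideal[OF q K(1)] subset_sat[OF q ideal_mem(1)[OF K(1)]] by auto
        have zK: "z \<in> K" and JK: "J \<subseteq> K" and xsK: "set xs \<subseteq> K"
          using K(2) subset_adjoin_list[OF jz xsc] mem_adjoin[OF iJ zc] subset_adjoin[OF iJ zc]
            set_subset_adjoin_list[OF jz xsc] by blast+
        have "q \<cdot> q \<subseteq> K" by (rule ideal_prod_subset[OF K(1) K(3)])
        then have "k \<in> K" using adjoin_list_subset[OF K(1) JK, of ws] ws(2) kc(1) by blast
        moreover have "c \<otimes> x = t \<otimes> z \<ominus> k" unfolding kc(3) using kc kcar xc by algebra
        ultimately have "c \<otimes> x \<in> K" using ideal_mem(6,7)[OF K(1)] zK t by simp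
        then have "x \<in> sat q K" using kc xc False by (intro satI[of _ c]) auto
        then have "adjoin_list J (x # xs) \<subseteq> sat q K"
          using JK xsK KsK by (intro adjoin_list_subset[OF sK]) auto
        then show "q \<subseteq> sat q K"
          using Cons.prems(3) sat_mono[of "adjoin_list J (x # xs)" "sat q K" q] sat_sat[OF q, of K] by blast
      qed
      then show ?thesis using xsq by auto
    qed
  next
    assume "\<exists>ys. Suc (length ys) = length xs \<and> set ys \<subseteq> q \<and> q \<subseteq> sat q (adjoin_list (adjoin (adjoin J x) z) ys)"
    then obtain ys where ys: "Suc (length ys) = length xs" "set ys \<subseteq> q"
      "q \<subseteq> sat q (adjoin_list (adjoin (adjoin J x) z) ys)" by auto
    have ysc: "set ys \<subseteq> carrier R" using ys(2) prime_carrier[OF q] by auto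
    have "adjoin_list J (x # z # ys) \<subseteq> adjoin_list J (z # x # ys)"
      using set_subset_adjoin_list[OF iJ, of "z # x # ys"] zc xc ysc by (intro adjoin_list_mono[OF iJ]) auto
    then have "q \<subseteq> sat q (adjoin_list (adjoin J z) (x # ys))"
      using ys(3) sat_mono[of "adjoin_list J (x # z # ys)" "adjoin_list J (z # x # ys)" q] by auto
    then show ?thesis using ys xq by (intro disjI2 exI[of _ "x # ys"]) auto
  qed
qed

text \<open>Elements of \<open>P\<close> that do not lie in \<open>J + q\<^sup>2\<close> locally are moved one by one into \<open>J\<close>, each in
  exchange for one of \<open>xs\<close>. When none is left, \<open>q\<close> is generated locally by \<open>J\<close> and \<open>ys\<close>, and
  the chain above \<open>P\<close> shows that \<open>J\<close> has become \<open>P\<close>.\<close>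

lemma regular_generators_at:
  assumes q: "primeideal q R" and P: "primeideal P R" "P \<subseteq> q"
    and ys: "set ys \<subseteq> q" "q \<subseteq> sat q (adjoin_list P ys)" "prime_chain (length ys) P' Q'" "P \<subseteq> P'" "Q' \<subseteq> q"
    and "ideal J R" "J \<subseteq> P" "set xs \<subseteq> q" "q \<subseteq> sat q (adjoin_list J xs)"
      "prime_chain (length xs) P0 Q" "J \<subseteq> P0" "Q \<subseteq> q"
  shows "\<exists>zs. set zs \<subseteq> P \<and> P \<subseteq> sat q (adjoin_list J zs) \<and> regular_seq_at q J zs"
proof -
  note iq = prime_ideal[OF q] and iP = prime_ideal[OF P(1)]
  obtain ws where ws: "set ws \<subseteq> q \<cdot> q" "adjoin_list {\<zero>} ws = q \<cdot> q"
    using ideal_list[OF ideal_prod_is_ideal[OF iq iq]] .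
  have wc: "set ws \<subseteq> carrier R" using ws(1) ideal_prod_in_carrier[OF iq iq] by blast
  have ysc: "set ys \<subseteq> carrier R" using ys(1) prime_carrier[OF q] by blast
  show ?thesis using assms(9-)
  proof (induction "length xs" arbitrary: xs J P0 Q rule: less_induct)
    case less
    note iJ = less.prems(1)
    show ?case
    proof (cases "P \<subseteq> sat q (adjoin_list J ws)")
      case True
      let ?L = "adjoin_list J ys"
      have Li: "ideal ?L R" by (rule adjoin_list_ideal[OF iJ ysc])
      \<comment> \<open>Here P lies locally in J + q^2, so J, \<open>ys\<close> and q^2 generate q,
        and Nakayama's lemma drops q^2. The chain above \<open>P\<close> has as many steps as
        \<open>ys\<close> has entries, which then forces its bottom into
        \<open>sat q J\<close>.\<close>
      have "q \<subseteq> sat q ?L"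
      proof (rule nakayama_at[OF q Li iq])
        fix K assume K: "ideal K R" "?L \<subseteq> K" "\<And>a b. a \<in> q \<Longrightarrow> b \<in> q \<Longrightarrow> a \<otimes> b \<in> K"
        have sK: "ideal (sat q K) R" and KsK: "K \<subseteq> sat q K"
          using sat_ideal[OF q K(1)] subset_sat[OF q ideal_mem(1)[OF K(1)]] by auto
        have JK: "J \<subseteq> K" and ysK: "set ys \<subseteq> K"
          using K(2) subset_adjoin_list[OF iJ ysc] set_subset_adjoin_list[OF iJ ysc] by blast+
        have "q \<cdot> q \<subseteq> K" by (rule ideal_prod_subset[OF K(1) K(3)])
        then have "adjoin_list J ws \<subseteq> K" using adjoin_list_subset[OF K(1) JK, of ws] ws(1) by blast
        then have "P \<subseteq> sat q K" using True sat_mono by blast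
        then have "adjoin_list P ys \<subseteq> sat q K" using ysK KsK by (intro adjoin_list_subset[OF sK]) auto
        then show "q \<subseteq> sat q K"
          using ys(2) sat_mono[of "adjoin_list P ys" "sat q K" q] sat_sat[OF q, of K] by blast
      qed
      then have "P' \<subseteq> sat q J"
        using chain_bottom_subset[OF q ys(5) iJ ys(1) _ ys(3)] less.prems(2) ys(4) by blast
      then show ?thesis using ys(4) by (intro exI[of _ "[]"]) auto
    next
      case False
      then obtain z where z: "z \<in> P" "z \<notin> sat q (adjoin_list J ws)" by blast
      have zq: "z \<in> q" and zc: "z \<in> carrier R" using z P prime_carrier[OF q] by auto
      obtain ys' where ys': "Suc (length ys') = length xs" "set ys' \<subseteq> q" "q \<subseteq> sat q (adjoin_list (adjoin J z) ys')"
        using exchange_generator[OF q ws(2,1) zq iJ less.prems(3,4)] z(2) by blast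
      have c: "prime_chain (Suc (length ys')) P0 Q"
        using less.prems(5) unfolding ys'(1) .
      \<comment> \<open>Absorbing z shortens the list of generators and the chain by one each, so
        their lengths still agree.\<close>
      obtain P1 where P1: "P0 \<subset> P1" "z \<in> P1" "prime_chain (length ys') P1 q"
        using prime_chain_through[OF prime_chain_extend[OF q less.prems(7) c] zq] by (elim exE conjE)
      have jz: "ideal (adjoin J z) R" by (rule adjoin_ideal[OF iJ zc])
      have "\<exists>zs. set zs \<subseteq> P \<and> P \<subseteq> sat q (adjoin_list (adjoin J z) zs) \<and> regular_seq_at q (adjoin J z) zs"
      proof (rule less.hyps[OF _ jz _ ys'(2,3) P1(3) _ subset_refl])
        show "length ys' < length xs" using ys'(1) by simp
        show "adjoin J z \<subseteq> P" by (rule adjoin_subset[OF iP less.prems(2) z(1)])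
        have "ideal P1 R" using prime_ideal[OF prime_chain_prime[OF P1(3)]] .
        then show "adjoin J z \<subseteq> P1" using less.prems(6) P1(1,2) by (intro adjoin_subset) auto
      qed
      then obtain zs where zs: "set zs \<subseteq> P" "P \<subseteq> sat q (adjoin_list (adjoin J z) zs)"
        "regular_seq_at q (adjoin J z) zs" by blast
      \<comment> \<open>Locally \<open>J\<close> equals the prime \<open>P0\<close>. As z avoids
        even J + q^2, it avoids \<open>P0\<close> and is therefore a nonzerodivisor modulo
        \<open>J\<close>.\<close>
      have P0s: "P0 \<subseteq> sat q J"
        by (rule chain_bottom_subset[OF q less.prems(7) iJ less.prems(3,4,5,6)])
      have P0: "primeideal P0 R" by (rule prime_chain_prime[OF less.prems(5)])
      have "sat q J \<subseteq> sat q (adjoin_list J ws)" by (intro sat_mono subset_adjoin_list[OF iJ wc])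
      then have "z \<notin> P0" using P0s z(2) by blast
      then have "r \<in> sat q J" if "r \<in> carrier R" "r \<otimes> z \<in> J" for r
        using prime_mult[OF P0 that(1) zc] that less.prems(6) P0s by blast
      then show ?thesis using zs z(1) by (intro exI[of _ "z # zs"]) auto
    qed
  qed
qed

end


section \<open>Localizing homomorphisms and regular local rings\<close>

lemma (in cring) Units_mult_iff:
  assumes "a \<in> carrier R" "b \<in> carrier R"
  shows "a \<otimes> b \<in> Units R \<longleftrightarrow> a \<in> Units R \<and> b \<in> Units R"
  using unit_factor[of a b] unit_factor[of b a] assms by (auto simp: m_comm)

lemma (in cring) ideal_unit:
  assumes "ideal I R" "u \<in> I" "u \<in> Units R"
  shows "I = carrier R"
proof -
  obtain v where v: "v \<in> carrier R" "v \<otimes> u = \<one>" using assms(3) by (auto simp: Units_def)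
  then have "\<one> \<in> I" using ideal_mem(7)[OF assms(1) v(1) assms(2)] by simp
  then show ?thesis by (rule ideal.one_imp_carrier[OF assms(1)])
qed

text \<open>These properties characterise \<open>C\<close>, up to isomorphism, as (R/K)_q with its
  canonical map. They suffice for moving generators and primes between \<open>R\<close> and
  \<open>C\<close>, and they can be verified for a composite of two localizations, so that no
  isomorphism between different constructions of the same ring has to be built.\<close>

locale localizing_hom = R: cring R + C: cring C
  for R :: "('a, 'm) ring_scheme" (structure) and q K :: "'a set"
    and C :: "('c, 'n) ring_scheme" (structure) and \<phi> :: "'a \<Rightarrow> 'c" +
  assumes q: "primeideal q R"
    and hom: "\<phi> \<in> ring_hom R C"
    and frac: "c \<in> carrier C \<Longrightarrow> \<exists>a \<in> carrier R. \<exists>s \<in> carrier R - q. \<phi> s \<otimes>\<^bsub>C\<^esub> c = \<phi> a"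
    and unit_iff: "a \<in> carrier R \<Longrightarrow> \<phi> a \<in> Units C \<longleftrightarrow> a \<notin> q"
    and ker_iff: "a \<in> carrier R \<Longrightarrow> \<phi> a = \<zero>\<^bsub>C\<^esub> \<longleftrightarrow> (\<exists>s \<in> carrier R - q. s \<otimes> a \<in> K)"
begin

sublocale h: ring_hom_cring R C \<phi>
  by (intro ring_hom_cring.intro ring_hom_cring_axioms.intro R.cring_axioms C.cring_axioms hom)

lemma fracE:
  assumes "c \<in> carrier C"
  obtains a s where "a \<in> carrier R" "s \<in> carrier R" "s \<notin> q" "\<phi> s \<in> Units C" "\<phi> s \<otimes>\<^bsub>C\<^esub> c = \<phi> a"
  using frac[OF assms] unit_iff by auto

lemma unit_frac_iff:
  assumes "c \<in> carrier C" "a \<in> carrier R" "s \<in> carrier R" "s \<notin> q" "\<phi> s \<otimes>\<^bsub>C\<^esub> c = \<phi> a"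
  shows "c \<in> Units C \<longleftrightarrow> a \<notin> q"
  using assms unit_iff C.Units_mult_iff[of "\<phi> s" c] by (metis h.hom_closed)

definition nonunits :: "'c set" where "nonunits = carrier C - Units C"

lemma nonunits_maximal: "maximalideal nonunits C"
proof (rule maximalidealI)
  show "ideal nonunits C"
  proof (rule C.cring_idealI)
    show "nonunits \<subseteq> carrier C" by (auto simp: nonunits_def)
    have "\<phi> \<zero> \<notin> Units C" using unit_iff[of \<zero>] R.ideal_mem(3)[OF prime_ideal[OF q]] by simp
    then show "\<zero>\<^bsub>C\<^esub> \<in> nonunits" by (simp add: nonunits_def)
    fix c assume c: "c \<in> nonunits"
    { fix d assume d: "d \<in> nonunits"
      have cd: "c \<in> carrier C" "d \<in> carrier C" using c d by (auto simp: nonunits_def)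
      obtain a s where s: "a \<in> carrier R" "s \<in> carrier R" "s \<notin> q" "\<phi> s \<otimes>\<^bsub>C\<^esub> c = \<phi> a"
        using fracE[OF cd(1)] by metis
      obtain b t where t: "b \<in> carrier R" "t \<in> carrier R" "t \<notin> q" "\<phi> t \<otimes>\<^bsub>C\<^esub> d = \<phi> b"
        using fracE[OF cd(2)] by metis
      have "a \<in> q" "b \<in> q" using unit_frac_iff[OF cd(1) s] unit_frac_iff[OF cd(2) t] c d by (auto simp: nonunits_def)
      then have "t \<otimes> a \<oplus> s \<otimes> b \<in> q"
        using R.ideal_mem(4,7)[OF prime_ideal[OF q]] s t by simp
      moreover have "\<phi> (s \<otimes> t) \<otimes>\<^bsub>C\<^esub> (c \<oplus>\<^bsub>C\<^esub> d) = \<phi> t \<otimes>\<^bsub>C\<^esub> (\<phi> s \<otimes>\<^bsub>C\<^esub> c) \<oplus>\<^bsub>C\<^esub> \<phi> s \<otimes>\<^bsub>C\<^esub> (\<phi> t \<otimes>\<^bsub>C\<^esub> d)"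
        using s(2) t(2) cd h.hom_closed by (simp add: C.r_distr C.m_ac)
      then have "\<phi> (s \<otimes> t) \<otimes>\<^bsub>C\<^esub> (c \<oplus>\<^bsub>C\<^esub> d) = \<phi> (t \<otimes> a \<oplus> s \<otimes> b)" using s t by simp
      moreover have "s \<otimes> t \<notin> q" using R.prime_compl_mult[OF q, of s t] s t by blast
      ultimately show "c \<oplus>\<^bsub>C\<^esub> d \<in> nonunits"
        using unit_frac_iff[of "c \<oplus>\<^bsub>C\<^esub> d" "t \<otimes> a \<oplus> s \<otimes> b" "s \<otimes> t"] s t cd by (auto simp: nonunits_def) }
    { fix r assume "r \<in> carrier C"
      then show "r \<otimes>\<^bsub>C\<^esub> c \<in> nonunits" using c C.Units_mult_iff[of r c] by (auto simp: nonunits_def) }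
  qed
  show "carrier C \<noteq> nonunits" using C.one_closed C.Units_one_closed by (auto simp: nonunits_def)
  show "J = nonunits \<or> J = carrier C" if "ideal J C" "nonunits \<subseteq> J" "J \<subseteq> carrier C" for J
    using that C.ideal_unit[OF that(1)] by (auto simp: nonunits_def)
qed

lemma maximal_eq_nonunits:
  assumes "maximalideal m C"
  shows "m = nonunits"
proof -
  have m: "ideal m C" "m \<noteq> carrier C"
    using assms maximalideal.I_notcarr[OF assms] by (auto simp: maximalideal_def)
  have "m \<subseteq> nonunits"
  proof
    fix c assume c: "c \<in> m"
    then have "c \<notin> Units C" using C.ideal_unit[OF m(1) c] m(2) by blast
    then show "c \<in> nonunits" using C.ideal_mem(2)[OF m(1) c] by (simp add: nonunits_def)
  qed
  moreover have "ideal nonunits C" "nonunits \<subseteq> carrier C" "nonunits \<noteq> carrier C"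
    using nonunits_maximal maximalideal.I_notcarr[OF nonunits_maximal]
    by (auto simp: maximalideal_def nonunits_def)
  ultimately show ?thesis using maximalideal.I_maximal[OF assms, of nonunits] by metis
qed

lemma contract_prime:
  assumes p: "primeideal p C"
  shows "primeideal {a \<in> carrier R. \<phi> a \<in> p} R"
proof (rule primeidealI)
  note P = C.ideal_mem[OF prime_ideal[OF p]]
  show "ideal {a \<in> carrier R. \<phi> a \<in> p} R"
    by (rule R.cring_idealI) (use P in auto)
  show "cring R" by (rule R.cring_axioms)
  show "carrier R \<noteq> {a \<in> carrier R. \<phi> a \<in> p}"
    using prime_one[OF p] R.one_closed h.hom_one by force
  show "a \<in> {a \<in> carrier R. \<phi> a \<in> p} \<or> b \<in> {a \<in> carrier R. \<phi> a \<in> p}"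
    if "a \<in> carrier R" "b \<in> carrier R" "a \<otimes> b \<in> {a \<in> carrier R. \<phi> a \<in> p}" for a b
    using that prime_mult[OF p, of "\<phi> a" "\<phi> b"] by auto
qed

lemma prime_no_unit: "primeideal p C \<Longrightarrow> u \<in> Units C \<Longrightarrow> u \<notin> p"
  using C.ideal_unit[OF prime_ideal, of p u] prime_one[of p C] by auto

text \<open>An element of \<open>p'\<close> outside \<open>p\<close> differs from its numerator by a
  unit, so the numerator separates the contractions too.\<close>

lemma contract_strict:
  assumes p: "primeideal p C" and p': "primeideal p' C" and sub: "p \<subset> p'"
  shows "{a \<in> carrier R. \<phi> a \<in> p} \<subset> {a \<in> carrier R. \<phi> a \<in> p'}"
proof -
  obtain x where x: "x \<in> p'" "x \<notin> p" using sub by auto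
  have xc: "x \<in> carrier C" using x prime_carrier[OF p'] by auto
  then obtain a s where as: "a \<in> carrier R" "s \<in> carrier R" "\<phi> s \<in> Units C" "\<phi> s \<otimes>\<^bsub>C\<^esub> x = \<phi> a" by (rule fracE)
  have "\<phi> a \<in> p'" using C.ideal_mem(7)[OF prime_ideal[OF p'], of "\<phi> s" x] as x by simp
  moreover have "\<phi> a \<notin> p"
    using prime_mult[OF p, of "\<phi> s" x] prime_no_unit[OF p as(3)] as x(2) xc by auto
  ultimately show ?thesis using sub as(1) by auto
qed

end

lemma (in cring) prime_chain_fun:
  assumes "\<And>i. i \<le> n \<Longrightarrow> primeideal (f i) R" "\<And>i. i < n \<Longrightarrow> f i \<subset> f (Suc i)"
  shows "prime_chain n (f 0) (f n)"
  using assms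
proof (induction n arbitrary: f)
  case 0
  then show ?case by simp
next
  case (Suc n)
  have "prime_chain n (f (Suc 0)) (f (Suc n))"
  proof (rule Suc.IH[of "\<lambda>i. f (Suc i)"])
    show "primeideal (f (Suc i)) R" if "i \<le> n" for i using Suc.prems(1)[of "Suc i"] that by simp
    show "f (Suc i) \<subset> f (Suc (Suc i))" if "i < n" for i using Suc.prems(2)[of "Suc i"] that by simp
  qed
  moreover have "primeideal (f 0) R" "f 0 \<subset> f (Suc 0)" using Suc.prems(1)[of 0] Suc.prems(2)[of 0] by simp_all
  ultimately show ?case by auto
qed

text \<open>An infinite set of extended naturals has infinite supremum, so a finite dimension is a
  maximum. The prime \<open>p0\<close> makes the set nonempty; 0 is also the supremum of the empty
  set, where nothing is attained.\<close>

lemma krull_dim_attained: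
  assumes "krull_dim R = enat n" "primeideal p0 R"
  obtains p where "\<And>i. i \<le> n \<Longrightarrow> primeideal (p i) R" "\<And>i. i < n \<Longrightarrow> p i \<subset> p (Suc i)"
proof -
  define X where "X = {enat n | n. \<exists>p :: nat \<Rightarrow> 'a set. (\<forall>i \<le> n. primeideal (p i) R) \<and> (\<forall>i < n. p i \<subset> p (Suc i))}"
  have "enat 0 \<in> X" unfolding X_def
    using assms(2) by (intro CollectI exI[of _ "0::nat"] conjI exI[of _ "\<lambda>_. p0"]) auto
  then have ne: "X \<noteq> {}" by blast
  have S: "Sup X = enat n" using assms(1) by (simp only: krull_dim_def X_def)
  then have fin: "finite X" using ne unfolding Sup_enat_def by (auto split: if_splits)
  then have "Max X = enat n" using S ne unfolding Sup_enat_def by simp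
  then have "enat n \<in> X" using Max_in[OF fin ne] by simp
  then obtain p where "\<forall>i \<le> n. primeideal (p i) R" "\<forall>i < n. p i \<subset> p (Suc i)"
    unfolding X_def by auto
  then show ?thesis using that by metis
qed

context localizing_hom begin

text \<open>Numerators of generators of the maximal ideal of \<open>C\<close> generate q locally
  modulo \<open>K\<close>, and a longest chain of primes of \<open>C\<close> contracts to a chain of
  the same length in \<open>R\<close>. Regularity of \<open>C\<close> says that the two numbers
  agree.\<close>

lemma regular_local_ring_parameters:
  assumes C: "regular_local_ring C" and K: "ideal K R"
  shows "\<exists>ys P Q. set ys \<subseteq> q \<and> q \<subseteq> R.sat q (R.adjoin_list K ys) \<and>
    R.prime_chain (length ys) P Q \<and> K \<subseteq> P \<and> Q \<subseteq> q"
proof -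
  obtain A where A: "finite A" "A \<subseteq> carrier C" "enat (card A) = krull_dim C" "maximalideal (genideal C A) C"
    using C by (auto simp: regular_local_ring_def)
  have m: "genideal C A = nonunits" by (rule maximal_eq_nonunits[OF A(4)])
  have An: "A \<subseteq> nonunits" using C.genideal_self[OF A(2)] m by simp
  \<comment> \<open>A list keeps the number of numerators equal to \<open>card A\<close> even if two
    generators share a numerator.\<close>
  obtain cs where cs: "set cs = A" "length cs = card A"
  proof -
    obtain cs where "set cs = A" "distinct cs" using finite_distinct_list[OF A(1)] by (elim exE conjE)
    then show thesis using that distinct_card[of cs] by simp
  qed
  have "\<forall>c \<in> A. \<exists>a. \<exists>s. a \<in> carrier R \<and> s \<in> carrier R \<and> s \<notin> q \<and> \<phi> s \<otimes>\<^bsub>C\<^esub> c = \<phi> a"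
  proof
    fix c assume "c \<in> A"
    then have "c \<in> carrier C" using A(2) by blast
    then show "\<exists>a. \<exists>s. a \<in> carrier R \<and> s \<in> carrier R \<and> s \<notin> q \<and> \<phi> s \<otimes>\<^bsub>C\<^esub> c = \<phi> a"
      using frac by blast
  qed
  then obtain num den where nd: "\<And>c. c \<in> A \<Longrightarrow> num c \<in> carrier R" "\<And>c. c \<in> A \<Longrightarrow> den c \<in> carrier R"
    "\<And>c. c \<in> A \<Longrightarrow> den c \<notin> q" "\<And>c. c \<in> A \<Longrightarrow> \<phi> (den c) \<otimes>\<^bsub>C\<^esub> c = \<phi> (num c)" by metis
  define ys where "ys = map num cs"
  have ysq: "set ys \<subseteq> q"
  proof -
    have "num c \<in> q" if c: "c \<in> A" for c
    proof -
      have "c \<in> carrier C" "c \<notin> Units C" using An c unfolding nonunits_def by blast+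
      then show ?thesis using unit_frac_iff[OF _ nd(1,2,3,4)[OF c]] by blast
    qed
    then show ?thesis unfolding ys_def using cs(1) by auto
  qed
  have ysc: "set ys \<subseteq> carrier R" using ysq prime_carrier[OF q] by blast
  let ?L = "R.adjoin_list K ys"
  note L = R.ideal_mem[OF R.adjoin_list_ideal[OF K ysc]]
  \<comment> \<open>The extension of the ideal \<open>?L\<close> to \<open>C\<close>, described
    through numerators.\<close>
  define T where "T = {c \<in> carrier C. \<exists>a \<in> ?L. \<exists>s \<in> carrier R - q. \<phi> s \<otimes>\<^bsub>C\<^esub> c = \<phi> a}"
  have T: "ideal T C"
  proof (rule C.cring_idealI)
    show "T \<subseteq> carrier C" by (auto simp: T_def)
    have "\<phi> \<one> \<otimes>\<^bsub>C\<^esub> \<zero>\<^bsub>C\<^esub> = \<phi> \<zero>" by simp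
    then show "\<zero>\<^bsub>C\<^esub> \<in> T" unfolding T_def using L(3) R.prime_compl_one[OF q] by blast
    fix c assume "c \<in> T"
    then obtain a s where c: "c \<in> carrier C" "a \<in> ?L" "s \<in> carrier R - q" "\<phi> s \<otimes>\<^bsub>C\<^esub> c = \<phi> a" by (auto simp: T_def)
    have ac: "a \<in> carrier R" "s \<in> carrier R" using c L(2) by auto
    { fix d assume "d \<in> T"
      then obtain b t where d: "d \<in> carrier C" "b \<in> ?L" "t \<in> carrier R - q" "\<phi> t \<otimes>\<^bsub>C\<^esub> d = \<phi> b" by (auto simp: T_def)
      have bc: "b \<in> carrier R" "t \<in> carrier R" using d L(2) by auto
      have "\<phi> (s \<otimes> t) \<otimes>\<^bsub>C\<^esub> (c \<oplus>\<^bsub>C\<^esub> d) = \<phi> t \<otimes>\<^bsub>C\<^esub> (\<phi> s \<otimes>\<^bsub>C\<^esub> c) \<oplus>\<^bsub>C\<^esub> \<phi> s \<otimes>\<^bsub>C\<^esub> (\<phi> t \<otimes>\<^bsub>C\<^esub> d)"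
        using ac bc c(1) d(1) h.hom_closed by (simp add: C.r_distr C.m_ac)
      then have "\<phi> (s \<otimes> t) \<otimes>\<^bsub>C\<^esub> (c \<oplus>\<^bsub>C\<^esub> d) = \<phi> (t \<otimes> a \<oplus> s \<otimes> b)" using ac bc c d by simp
      moreover have "s \<otimes> t \<in> carrier R - q" using R.prime_compl_mult[OF q] c d by blast
      moreover have "t \<otimes> a \<oplus> s \<otimes> b \<in> ?L" using L(4,7) ac bc c d by simp
      ultimately show "c \<oplus>\<^bsub>C\<^esub> d \<in> T" using c d unfolding T_def by blast }
    { fix r assume r: "r \<in> carrier C"
      then obtain b t where t: "b \<in> carrier R" "t \<in> carrier R" "t \<notin> q" "\<phi> t \<otimes>\<^bsub>C\<^esub> r = \<phi> b" by (rule fracE)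
      have "\<phi> (t \<otimes> s) \<otimes>\<^bsub>C\<^esub> (r \<otimes>\<^bsub>C\<^esub> c) = (\<phi> t \<otimes>\<^bsub>C\<^esub> r) \<otimes>\<^bsub>C\<^esub> (\<phi> s \<otimes>\<^bsub>C\<^esub> c)"
        using ac t(1,2) c(1) r h.hom_closed by (simp add: C.m_ac)
      then have "\<phi> (t \<otimes> s) \<otimes>\<^bsub>C\<^esub> (r \<otimes>\<^bsub>C\<^esub> c) = \<phi> (b \<otimes> a)" using t c ac by simp
      moreover have "t \<otimes> s \<in> carrier R - q" using R.prime_compl_mult[OF q, of t s] c t by blast
      moreover have "b \<otimes> a \<in> ?L" using L(7) t c by simp
      ultimately show "r \<otimes>\<^bsub>C\<^esub> c \<in> T" using c r unfolding T_def by blast }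
  qed
  have "A \<subseteq> T"
  proof
    fix c assume c: "c \<in> A"
    have "num c \<in> ?L" using R.set_subset_adjoin_list[OF K ysc] c cs by (auto simp: ys_def)
    then show "c \<in> T" unfolding T_def using nd[OF c] c A(2) by blast
  qed
  then have nT: "nonunits \<subseteq> T" using C.genideal_minimal[OF T, of A] unfolding m by blast
  have "q \<subseteq> R.sat q ?L"
  proof
    fix a assume a: "a \<in> q"
    have ac: "a \<in> carrier R" using a prime_carrier[OF q] by blast
    have "\<phi> a \<in> nonunits" using unit_iff[OF ac] a ac by (simp add: nonunits_def)
    then have "\<phi> a \<in> T" using nT by blast
    then obtain b s where b: "b \<in> ?L" "s \<in> carrier R" "s \<notin> q" "\<phi> s \<otimes>\<^bsub>C\<^esub> \<phi> a = \<phi> b" by (auto simp: T_def)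
    have bc: "b \<in> carrier R" using L(2) b by blast
    have "\<phi> (s \<otimes> a \<ominus> b) = \<phi> s \<otimes>\<^bsub>C\<^esub> \<phi> a \<ominus>\<^bsub>C\<^esub> \<phi> b" using b(2) ac bc by (simp add: R.minus_eq C.minus_eq)
    also have "\<dots> = \<zero>\<^bsub>C\<^esub>" unfolding b(4) using bc by (simp add: C.minus_eq C.r_neg)
    finally obtain t where t: "t \<in> carrier R - q" "t \<otimes> (s \<otimes> a \<ominus> b) \<in> K"
      using ker_iff[of "s \<otimes> a \<ominus> b"] b(2) ac bc by auto
    have tc: "t \<in> carrier R" using t by blast
    have "(t \<otimes> s) \<otimes> a = t \<otimes> (s \<otimes> a \<ominus> b) \<oplus> t \<otimes> b" using tc b(2) ac bc by algebra
    also have "\<dots> \<in> ?L" using L(4,7) R.subset_adjoin_list[OF K ysc] t b tc by blast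
    finally show "a \<in> R.sat q ?L"
      using R.prime_compl_mult[OF q t(1), of s] b ac by (intro R.satI[of _ "t \<otimes> s"]) auto
  qed
  moreover
  have "primeideal nonunits C" by (rule C.maximalideal_prime[OF nonunits_maximal])
  then obtain p where p: "\<And>i. i \<le> card A \<Longrightarrow> primeideal (p i) C" "\<And>i. i < card A \<Longrightarrow> p i \<subset> p (Suc i)"
    using krull_dim_attained[OF A(3)[symmetric]] by metis
  define f where "f i = {a \<in> carrier R. \<phi> a \<in> p i}" for i
  have "R.prime_chain (card A) (f 0) (f (card A))"
  proof (rule R.prime_chain_fun)
    show "primeideal (f i) R" if "i \<le> card A" for i unfolding f_def by (rule contract_prime[OF p(1)[OF that]])
    show "f i \<subset> f (Suc i)" if "i < card A" for i unfolding f_def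
      using that by (intro contract_strict p) simp_all
  qed
  moreover have "K \<subseteq> f 0"
  proof
    fix k assume k: "k \<in> K"
    then have kc: "k \<in> carrier R" using R.ideal_mem(2)[OF K] by blast
    have "\<phi> k = \<zero>\<^bsub>C\<^esub>" using ker_iff[OF kc] R.prime_compl_one[OF q] k kc by (auto intro!: bexI[of _ \<one>])
    then show "k \<in> f 0" using C.ideal_mem(3)[OF prime_ideal[OF p(1)[of 0]]] kc by (simp add: f_def)
  qed
  moreover have "f (card A) \<subseteq> q"
    using prime_no_unit[OF p(1)[of "card A"]] unit_iff by (auto simp: f_def)
  moreover have "length ys = card A" by (simp add: ys_def cs)
  ultimately show ?thesis using ysq by metis
qed

end


section \<open>Localization\<close>

locale mult_subset = cring R for R (structure) +
  fixes S
  assumes S_subset: "S \<subseteq> carrier R" and S_one: "\<one> \<in> S"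
    and S_mult: "s \<in> S \<Longrightarrow> t \<in> S \<Longrightarrow> s \<otimes> t \<in> S"
begin

lemma S_carrier: "s \<in> S \<Longrightarrow> s \<in> carrier R"
  using S_subset by blast

lemma frac_rel_iff: "((a, s), (b, t)) \<in> frac_rel R S \<longleftrightarrow> a \<in> carrier R \<and> b \<in> carrier R \<and> s \<in> S \<and> t \<in> S \<and>
    (\<exists>u \<in> S. u \<otimes> (a \<otimes> t) = u \<otimes> (b \<otimes> s))"
  by (auto simp: frac_rel_def)

lemma equiv_frac_rel: "equiv (carrier R \<times> S) (frac_rel R S)"
proof (rule equivI)
  show "frac_rel R S \<subseteq> (carrier R \<times> S) \<times> (carrier R \<times> S)" by (auto simp: frac_rel_def)
  show "refl_on (carrier R \<times> S) (frac_rel R S)"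
    using S_one by (auto simp: refl_on_def frac_rel_iff)
  show "sym (frac_rel R S)"
  proof (rule symI)
    fix x y assume "(x, y) \<in> frac_rel R S"
    then show "(y, x) \<in> frac_rel R S" by (cases x; cases y) (auto simp: frac_rel_iff intro: sym)
  qed
  show "trans (frac_rel R S)"
  proof (rule transI)
    fix x y z assume xy: "(x, y) \<in> frac_rel R S" and yz: "(y, z) \<in> frac_rel R S"
    obtain a s b t c r where e: "x = (a, s)" "y = (b, t)" "z = (c, r)" by (metis surj_pair)
    obtain u where u: "u \<in> S" "u \<otimes> (a \<otimes> t) = u \<otimes> (b \<otimes> s)" using xy e by (auto simp: frac_rel_iff)
    obtain v where v: "v \<in> S" "v \<otimes> (b \<otimes> r) = v \<otimes> (c \<otimes> t)" using yz e by (auto simp: frac_rel_iff)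
    have m: "a \<in> carrier R" "b \<in> carrier R" "c \<in> carrier R" "s \<in> S" "t \<in> S" "r \<in> S"
      using xy yz e by (auto simp: frac_rel_iff)
    note c = m(1-3) S_carrier[OF m(4)] S_carrier[OF m(5)] S_carrier[OF m(6)] S_carrier[OF u(1)] S_carrier[OF v(1)]
    \<comment> \<open>The middle denominator t joins the multiplier, because it cannot be cancelled
      in the presence of zero divisors.\<close>
    have "(u \<otimes> v \<otimes> t) \<otimes> (a \<otimes> r) = (v \<otimes> r) \<otimes> (u \<otimes> (a \<otimes> t))" using c by (simp add: m_ac)
    also have "\<dots> = (u \<otimes> s) \<otimes> (v \<otimes> (b \<otimes> r))" unfolding u(2) using c by (simp add: m_ac)
    also have "\<dots> = (u \<otimes> v \<otimes> t) \<otimes> (c \<otimes> s)" unfolding v(2) using c by (simp add: m_ac)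
    finally show "(x, z) \<in> frac_rel R S"
      unfolding e frac_rel_iff using m u v S_mult by blast
  qed
qed

lemma fraction_eq_iff:
  assumes "a \<in> carrier R" "s \<in> S" "b \<in> carrier R" "t \<in> S"
  shows "fraction R S a s = fraction R S b t \<longleftrightarrow> (\<exists>u \<in> S. u \<otimes> (a \<otimes> t) = u \<otimes> (b \<otimes> s))"
  using eq_equiv_class_iff[OF equiv_frac_rel, of "(a, s)" "(b, t)"] assms
  by (auto simp: fraction_def frac_rel_iff)

lemma mem_fraction_iff:
  "x \<in> fraction R S a s \<longleftrightarrow> ((a, s), x) \<in> frac_rel R S"
  by (auto simp: fraction_def)

lemma fraction_self: "a \<in> carrier R \<Longrightarrow> s \<in> S \<Longrightarrow> (a, s) \<in> fraction R S a s"
  using S_one by (auto simp: mem_fraction_iff frac_rel_iff)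

lemma carrier_localization: "carrier (localization R S) = {fraction R S a s | a s. a \<in> carrier R \<and> s \<in> S}"
  by (auto simp: localization_def quotient_def fraction_def)

text \<open>Operations on classes are unions over pairs of representatives. If the result does not
  depend on them, all members of the union coincide, and classes are nonempty.\<close>

lemma UN_fraction:
  assumes "a \<in> carrier R" "s \<in> S" "b \<in> carrier R" "t \<in> S"
    and "\<And>a' s' b' t'. a' \<in> carrier R \<Longrightarrow> s' \<in> S \<Longrightarrow> b' \<in> carrier R \<Longrightarrow> t' \<in> S \<Longrightarrow>
      ((a, s), (a', s')) \<in> frac_rel R S \<Longrightarrow> ((b, t), (b', t')) \<in> frac_rel R S \<Longrightarrow> F a' s' b' t' = F a s b t"
  shows "(\<Union>(a', s') \<in> fraction R S a s. \<Union>(b', t') \<in> fraction R S b t. F a' s' b' t') = F a s b t"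
proof -
  have "F a' s' b' t' = F a s b t" if "(a', s') \<in> fraction R S a s" "(b', t') \<in> fraction R S b t" for a' s' b' t'
    using that assms(5)[of a' s' b' t'] by (auto simp: mem_fraction_iff frac_rel_iff)
  then show ?thesis using fraction_self[OF assms(1,2)] fraction_self[OF assms(3,4)] by fast
qed

lemma localization_mult:
  assumes "a \<in> carrier R" "s \<in> S" "b \<in> carrier R" "t \<in> S"
  shows "fraction R S a s \<otimes>\<^bsub>localization R S\<^esub> fraction R S b t = fraction R S (a \<otimes> b) (s \<otimes> t)"
proof -
  have "fraction R S (a' \<otimes> b') (s' \<otimes> t') = fraction R S (a \<otimes> b) (s \<otimes> t)"
    if m: "a' \<in> carrier R" "s' \<in> S" "b' \<in> carrier R" "t' \<in> S"
      "((a, s), (a', s')) \<in> frac_rel R S" "((b, t), (b', t')) \<in> frac_rel R S" for a' s' b' t'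
  proof -
    obtain u where u: "u \<in> S" "u \<otimes> (a \<otimes> s') = u \<otimes> (a' \<otimes> s)" using m by (auto simp: frac_rel_iff)
    obtain v where v: "v \<in> S" "v \<otimes> (b \<otimes> t') = v \<otimes> (b' \<otimes> t)" using m by (auto simp: frac_rel_iff)
    note c = assms(1,3) m(1,3) S_carrier[OF assms(2)] S_carrier[OF assms(4)] S_carrier[OF m(2)]
      S_carrier[OF m(4)] S_carrier[OF u(1)] S_carrier[OF v(1)]
    have "(u \<otimes> v) \<otimes> ((a' \<otimes> b') \<otimes> (s \<otimes> t)) = (u \<otimes> (a' \<otimes> s)) \<otimes> (v \<otimes> (b' \<otimes> t))" using c by (simp add: m_ac)
    also have "\<dots> = (u \<otimes> v) \<otimes> ((a \<otimes> b) \<otimes> (s' \<otimes> t'))"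
      unfolding u(2)[symmetric] v(2)[symmetric] using c by (simp add: m_ac)
    finally have "\<exists>u \<in> S. u \<otimes> ((a' \<otimes> b') \<otimes> (s \<otimes> t)) = u \<otimes> ((a \<otimes> b) \<otimes> (s' \<otimes> t'))"
      using S_mult u v by blast
    then show ?thesis using assms m S_mult by (subst fraction_eq_iff) auto
  qed
  from UN_fraction[OF assms, of "\<lambda>a s b t. fraction R S (a \<otimes> b) (s \<otimes> t)", OF this]
  show ?thesis by (simp add: localization_def)
qed

lemma localization_add:
  assumes "a \<in> carrier R" "s \<in> S" "b \<in> carrier R" "t \<in> S"
  shows "fraction R S a s \<oplus>\<^bsub>localization R S\<^esub> fraction R S b t = fraction R S (a \<otimes> t \<oplus> b \<otimes> s) (s \<otimes> t)"
proof -
  have "fraction R S (a' \<otimes> t' \<oplus> b' \<otimes> s') (s' \<otimes> t') = fraction R S (a \<otimes> t \<oplus> b \<otimes> s) (s \<otimes> t)"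
    if m: "a' \<in> carrier R" "s' \<in> S" "b' \<in> carrier R" "t' \<in> S"
      "((a, s), (a', s')) \<in> frac_rel R S" "((b, t), (b', t')) \<in> frac_rel R S" for a' s' b' t'
  proof -
    obtain u where u: "u \<in> S" "u \<otimes> (a \<otimes> s') = u \<otimes> (a' \<otimes> s)" using m by (auto simp: frac_rel_iff)
    obtain v where v: "v \<in> S" "v \<otimes> (b \<otimes> t') = v \<otimes> (b' \<otimes> t)" using m by (auto simp: frac_rel_iff)
    note c = assms(1,3) m(1,3) S_carrier[OF assms(2)] S_carrier[OF assms(4)] S_carrier[OF m(2)]
      S_carrier[OF m(4)] S_carrier[OF u(1)] S_carrier[OF v(1)]
    have "(u \<otimes> v) \<otimes> ((a' \<otimes> t' \<oplus> b' \<otimes> s') \<otimes> (s \<otimes> t)) =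
        (u \<otimes> (a' \<otimes> s)) \<otimes> (v \<otimes> (t \<otimes> t')) \<oplus> (v \<otimes> (b' \<otimes> t)) \<otimes> (u \<otimes> (s \<otimes> s'))" using c by algebra
    also have "\<dots> = (u \<otimes> v) \<otimes> ((a \<otimes> t \<oplus> b \<otimes> s) \<otimes> (s' \<otimes> t'))"
      unfolding u(2)[symmetric] v(2)[symmetric] using c by algebra
    finally have "\<exists>u \<in> S. u \<otimes> ((a' \<otimes> t' \<oplus> b' \<otimes> s') \<otimes> (s \<otimes> t)) = u \<otimes> ((a \<otimes> t \<oplus> b \<otimes> s) \<otimes> (s' \<otimes> t'))"
      using S_mult u v by blast
    then show ?thesis using assms m S_mult S_carrier by (subst fraction_eq_iff) auto
  qed
  from UN_fraction[OF assms, of "\<lambda>a s b t. fraction R S (a \<otimes> t \<oplus> b \<otimes> s) (s \<otimes> t)", OF this]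
  show ?thesis by (simp add: localization_def)
qed

lemma localization_one: "\<one>\<^bsub>localization R S\<^esub> = fraction R S \<one> \<one>"
  and localization_zero: "\<zero>\<^bsub>localization R S\<^esub> = fraction R S \<zero> \<one>"
  by (simp_all add: localization_def)

lemma fraction_ring_hom: "(\<lambda>a. fraction R S a \<one>) \<in> ring_hom R (localization R S)"
proof (rule ring_hom_memI)
  show "fraction R S a \<one> \<in> carrier (localization R S)" if "a \<in> carrier R" for a
    unfolding carrier_localization using that S_one by blast
qed (auto simp: localization_mult localization_add localization_one S_one)

lemma fraction_mult_denominator:
  assumes "a \<in> carrier R" "s \<in> S"
  shows "fraction R S s \<one> \<otimes>\<^bsub>localization R S\<^esub> fraction R S a s = fraction R S a \<one>"
  using assms S_one S_carrier[OF assms(2)] by (auto simp: localization_mult fraction_eq_iff m_ac intro!: bexI[of _ \<one>])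

lemma fraction_zero_iff:
  assumes "a \<in> carrier R"
  shows "fraction R S a \<one> = \<zero>\<^bsub>localization R S\<^esub> \<longleftrightarrow> (\<exists>u \<in> S. u \<otimes> a = \<zero>)"
  unfolding localization_zero using assms S_one S_carrier by (auto simp: fraction_eq_iff)

lemma fraction_unit:
  assumes "cring (localization R S)" "s \<in> S"
  shows "fraction R S s \<one> \<in> Units (localization R S)"
proof -
  interpret L: cring "localization R S" by fact
  have c: "fraction R S s \<one> \<in> carrier (localization R S)" "fraction R S \<one> s \<in> carrier (localization R S)"
    using assms(2) S_one S_carrier by (auto simp: carrier_localization)
  have "fraction R S s \<one> \<otimes>\<^bsub>localization R S\<^esub> fraction R S \<one> s = \<one>\<^bsub>localization R S\<^esub>"
    using fraction_mult_denominator[OF one_closed assms(2)] by (simp add: localization_one)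
  then show ?thesis using c L.m_comm[OF c] by (auto simp: Units_def)
qed

end

text \<open>One statement for R_q, for (R/P)_q and for a further localization of the latter:
  \<open>\<psi>\<close> is the identity or a quotient map. That the localization is a commutative
  ring is supplied by regularity at each use.\<close>

lemma localization_localizing_hom:
  fixes R :: "('a, 'm) ring_scheme" and A :: "('c, 'n) ring_scheme"
  assumes R: "cring R" and q: "primeideal q R" and A: "cring A" and \<psi>: "\<psi> \<in> ring_hom R A"
    and surj: "\<psi> ` carrier R = carrier A"
    and ker: "\<And>a. a \<in> carrier R \<Longrightarrow> \<psi> a = \<zero>\<^bsub>A\<^esub> \<Longrightarrow> a \<in> q"
    and S: "S = \<psi> ` (carrier R - q)"
    and L: "cring (localization A S)"
  shows "localizing_hom R q {a \<in> carrier R. \<psi> a = \<zero>\<^bsub>A\<^esub>} (localization A S) (\<lambda>a. fraction A S (\<psi> a) \<one>\<^bsub>A\<^esub>)"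
proof -
  interpret R: cring R by fact
  interpret A: cring A by fact
  interpret h: ring_hom_cring R A \<psi>
    by (intro ring_hom_cring.intro ring_hom_cring_axioms.intro R A \<psi>)
  interpret S: mult_subset A S
  proof unfold_locales
    show "S \<subseteq> carrier A" using S by auto
    show "\<one>\<^bsub>A\<^esub> \<in> S" using R.prime_compl_one[OF q] unfolding S by (intro image_eqI[of _ _ "\<one>\<^bsub>R\<^esub>"]) auto
    fix s t assume "s \<in> S" "t \<in> S"
    then obtain a b where ab: "s = \<psi> a" "t = \<psi> b" "a \<in> carrier R - q" "b \<in> carrier R - q" unfolding S by blast
    then show "s \<otimes>\<^bsub>A\<^esub> t \<in> S" using R.prime_compl_mult[OF q ab(3,4)] unfolding S
      by (intro image_eqI[of _ _ "a \<otimes>\<^bsub>R\<^esub> b"]) auto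
  qed
  interpret L: cring "localization A S" by fact
  define \<phi> where "\<phi> a = fraction A S (\<psi> a) \<one>\<^bsub>A\<^esub>" for a
  have SI: "\<psi> s \<in> S" if "s \<in> carrier R" "s \<notin> q" for s using that unfolding S by blast
  have "localizing_hom R q {a \<in> carrier R. \<psi> a = \<zero>\<^bsub>A\<^esub>} (localization A S) \<phi>"
  proof (intro localizing_hom.intro localizing_hom_axioms.intro R L q)
    have "\<phi> = (\<lambda>a. fraction A S a \<one>\<^bsub>A\<^esub>) \<circ> \<psi>" by (auto simp: \<phi>_def)
    then show "\<phi> \<in> ring_hom R (localization A S)"
      using ring_hom_trans[OF \<psi> S.fraction_ring_hom] by simp
    show "\<exists>a \<in> carrier R. \<exists>s \<in> carrier R - q. \<phi> s \<otimes>\<^bsub>localization A S\<^esub> c = \<phi> a"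
      if c: "c \<in> carrier (localization A S)" for c
    proof -
      obtain x y where xy: "c = fraction A S x y" "x \<in> carrier A" "y \<in> S" using c unfolding S.carrier_localization by blast
      obtain a where a: "a \<in> carrier R" "x = \<psi> a" using xy(2) surj by blast
      obtain s where s: "s \<in> carrier R - q" "y = \<psi> s" using xy(3) S by blast
      have "\<phi> s \<otimes>\<^bsub>localization A S\<^esub> c = \<phi> a"
        using S.fraction_mult_denominator[OF xy(2,3)] a s xy(1) by (simp add: \<phi>_def)
      then show ?thesis using a s by blast
    qed
    fix a assume a: "a \<in> carrier R"
    show "\<phi> a \<in> Units (localization A S) \<longleftrightarrow> a \<notin> q"
    proof
      assume "a \<notin> q"
      then show "\<phi> a \<in> Units (localization A S)"
        unfolding \<phi>_def by (intro S.fraction_unit[OF L] SI a)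
    next
      assume "\<phi> a \<in> Units (localization A S)"
      then obtain c where c: "c \<in> carrier (localization A S)" "\<phi> a \<otimes>\<^bsub>localization A S\<^esub> c = \<one>\<^bsub>localization A S\<^esub>"
        by (auto simp: Units_def L.m_comm)
      obtain x y where xy: "c = fraction A S x y" "x \<in> carrier A" "y \<in> S" using c(1) unfolding S.carrier_localization by blast
      obtain b where b: "b \<in> carrier R" "x = \<psi> b" using xy(2) surj by blast
      obtain s where s: "s \<in> carrier R" "s \<notin> q" "y = \<psi> s" using xy(3) S by blast
      have "fraction A S (\<psi> (a \<otimes>\<^bsub>R\<^esub> b)) (\<psi> s) = fraction A S \<one>\<^bsub>A\<^esub> \<one>\<^bsub>A\<^esub>"
        using c(2) xy a b s S.S_one SI[OF s(1,2)] by (simp add: \<phi>_def S.localization_mult S.localization_one)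
      then obtain u where u: "u \<in> S" "u \<otimes>\<^bsub>A\<^esub> (\<psi> (a \<otimes>\<^bsub>R\<^esub> b) \<otimes>\<^bsub>A\<^esub> \<one>\<^bsub>A\<^esub>) = u \<otimes>\<^bsub>A\<^esub> (\<one>\<^bsub>A\<^esub> \<otimes>\<^bsub>A\<^esub> \<psi> s)"
        using S.fraction_eq_iff[of "\<psi> (a \<otimes>\<^bsub>R\<^esub> b)" "\<psi> s" "\<one>\<^bsub>A\<^esub>" "\<one>\<^bsub>A\<^esub>"] S.S_one SI[OF s(1,2)] a b by auto
      obtain v where v: "v \<in> carrier R" "v \<notin> q" "u = \<psi> v" using u(1) S by blast
      have "\<psi> (v \<otimes>\<^bsub>R\<^esub> (a \<otimes>\<^bsub>R\<^esub> b)) = \<psi> (v \<otimes>\<^bsub>R\<^esub> s)" using u(2) a b s v by simp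
      \<comment> \<open>The equation between fractions becomes a congruence modulo the kernel of
        \<open>\<psi>\<close>. As the kernel lies in q, having a in q would put v s into q.\<close>
      then have "\<psi> (v \<otimes>\<^bsub>R\<^esub> (a \<otimes>\<^bsub>R\<^esub> b) \<ominus>\<^bsub>R\<^esub> v \<otimes>\<^bsub>R\<^esub> s) = \<zero>\<^bsub>A\<^esub>"
        using a b s v by (simp add: R.minus_eq A.r_neg)
      then have d: "v \<otimes>\<^bsub>R\<^esub> (a \<otimes>\<^bsub>R\<^esub> b) \<ominus>\<^bsub>R\<^esub> v \<otimes>\<^bsub>R\<^esub> s \<in> q" using ker a b s v by simp
      note Q = R.ideal_mem[OF prime_ideal[OF q]]
      show "a \<notin> q"
      proof
        assume "a \<in> q"
        then have "v \<otimes>\<^bsub>R\<^esub> (a \<otimes>\<^bsub>R\<^esub> b) \<in> q" using Q b v by simp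
        then have "v \<otimes>\<^bsub>R\<^esub> (a \<otimes>\<^bsub>R\<^esub> b) \<ominus>\<^bsub>R\<^esub> (v \<otimes>\<^bsub>R\<^esub> (a \<otimes>\<^bsub>R\<^esub> b) \<ominus>\<^bsub>R\<^esub> v \<otimes>\<^bsub>R\<^esub> s) \<in> q" using d Q(6) by blast
        moreover have "v \<otimes>\<^bsub>R\<^esub> (a \<otimes>\<^bsub>R\<^esub> b) \<ominus>\<^bsub>R\<^esub> (v \<otimes>\<^bsub>R\<^esub> (a \<otimes>\<^bsub>R\<^esub> b) \<ominus>\<^bsub>R\<^esub> v \<otimes>\<^bsub>R\<^esub> s) = v \<otimes>\<^bsub>R\<^esub> s"
          using a b s(1) v(1) by algebra
        ultimately show False using prime_mult[OF q v(1) s(1)] v s by auto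
      qed
    qed
    show "\<phi> a = \<zero>\<^bsub>localization A S\<^esub> \<longleftrightarrow> (\<exists>s \<in> carrier R - q. s \<otimes>\<^bsub>R\<^esub> a \<in> {a \<in> carrier R. \<psi> a = \<zero>\<^bsub>A\<^esub>})"
      using a unfolding \<phi>_def by (subst S.fraction_zero_iff) (auto simp: S)
  qed
  then show ?thesis unfolding \<phi>_def .
qed

lemma regular_ring_parameters:
  fixes R (structure)
  assumes R: "regular_ring R" and q: "primeideal q R"
  shows "\<exists>xs P Q. set xs \<subseteq> q \<and> q \<subseteq> cring.sat R q (cring.adjoin_list R {\<zero>\<^bsub>R\<^esub>} xs) \<and>
    cring.prime_chain R (length xs) P Q \<and> {\<zero>\<^bsub>R\<^esub>} \<subseteq> P \<and> Q \<subseteq> q"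
proof -
  interpret cring R using R by (simp add: regular_ring_def)
  have L: "regular_local_ring (localization R (carrier R - q))"
    using R q by (auto simp: regular_ring_def localization_at_def)
  have *: "localizing_hom R q {a \<in> carrier R. a = \<zero>} (localization R (carrier R - q))
      (\<lambda>a. fraction R (carrier R - q) a \<one>)"
  proof (rule localization_localizing_hom[OF cring_axioms q cring_axioms])
    show "(\<lambda>a. a) \<in> ring_hom R R" by (rule ring_hom_memI) auto
    show "cring (localization R (carrier R - q))" using L by (simp add: regular_local_ring_def)
  qed (use ideal_mem(3)[OF prime_ideal[OF q]] in auto)
  have K: "{a \<in> carrier R. a = \<zero>} = {\<zero>}" by auto
  show ?thesis by (rule localizing_hom.regular_local_ring_parameters[OF *[unfolded K] L zeroideal])
qed

text \<open>Regularity of B = (R/P)_q is a condition on the localizations of B, so B is localized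
  once more at its maximal ideal m. Elements outside m are already units of B, hence the composite
  from R to B_m still has the properties of a localization of R/P at q.\<close>

lemma quotient_regular_parameters:
  fixes R (structure)
  assumes R: "cring R" and q: "primeideal q R" and P: "ideal P R" "P \<subseteq> q"
    and B: "regular_ring (quot_localization_at R P q)"
  shows "\<exists>xs P' Q. set xs \<subseteq> q \<and> q \<subseteq> cring.sat R q (cring.adjoin_list R P xs) \<and>
    cring.prime_chain R (length xs) P' Q \<and> P \<subseteq> P' \<and> Q \<subseteq> q"
proof -
  interpret cring R by fact
  interpret P: ideal P R by fact
  define B where "B = quot_localization_at R P q"
  have cB: "cring B" using B by (simp add: regular_ring_def B_def)
  interpret Q: cring "R Quot P" by (rule P.quotient_is_cring[OF R])
  have z: "P +> a = \<zero>\<^bsub>R Quot P\<^esub> \<longleftrightarrow> a \<in> P" if "a \<in> carrier R" for a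
    using that a_rcos_zero[OF P(1), of a] P.rcos_const_imp_mem[of a] by (auto simp: FactRing_def)
  have *: "localizing_hom R q {a \<in> carrier R. P +> a = \<zero>\<^bsub>R Quot P\<^esub>} B
      (\<lambda>a. fraction (R Quot P) ((\<lambda>a. P +> a) ` (carrier R - q)) (P +> a) \<one>\<^bsub>R Quot P\<^esub>)"
    unfolding B_def quot_localization_at_def
  proof (rule localization_localizing_hom[OF R q Q.cring_axioms])
    show "(+>) P \<in> ring_hom R (R Quot P)" by (rule P.rcos_ring_hom)
    show "(+>) P ` carrier R = carrier (R Quot P)"
      by (auto simp: FactRing_def A_RCOSETS_def')
    show "cring (localization (R Quot P) ((+>) P ` (carrier R - q)))"
      using cB by (simp add: B_def quot_localization_at_def)
  qed (use z P(2) in auto)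
  have K: "{a \<in> carrier R. P +> a = \<zero>\<^bsub>R Quot P\<^esub>} = P" using z P.Icarr by blast
  obtain \<phi> where \<phi>: "localizing_hom R q P B \<phi>" using *[unfolded K] by (rule that)
  interpret \<phi>: localizing_hom R q P B \<phi> by fact
  define m where "m = \<phi>.nonunits"
  have m: "primeideal m B" unfolding m_def by (rule \<phi>.C.maximalideal_prime[OF \<phi>.nonunits_maximal])
  define C where "C = localization_at B m"
  have C: "regular_local_ring C" using B m by (auto simp: regular_ring_def B_def C_def)
  have *: "localizing_hom B m {a \<in> carrier B. a = \<zero>\<^bsub>B\<^esub>} C
      (\<lambda>a. fraction B (carrier B - m) a \<one>\<^bsub>B\<^esub>)"
    unfolding C_def localization_at_def
  proof (rule localization_localizing_hom[OF cB m cB])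
    show "(\<lambda>a. a) \<in> ring_hom B B" by (rule ring_hom_memI) auto
    show "cring (localization B (carrier B - m))"
      using C by (simp add: regular_local_ring_def C_def localization_at_def)
  qed (use \<phi>.C.ideal_mem(3)[OF prime_ideal[OF m]] in auto)
  obtain \<psi> where \<psi>: "localizing_hom B m {a \<in> carrier B. a = \<zero>\<^bsub>B\<^esub>} C \<psi>" using * by (rule that)
  interpret \<psi>: localizing_hom B m "{a \<in> carrier B. a = \<zero>\<^bsub>B\<^esub>}" C \<psi> by fact
  have mU: "b \<notin> m \<longleftrightarrow> b \<in> Units B" if "b \<in> carrier B" for b using that by (auto simp: m_def \<phi>.nonunits_def)
  have *: "localizing_hom R q P C (\<psi> \<circ> \<phi>)"
  proof (intro localizing_hom.intro localizing_hom_axioms.intro R q \<psi>.C.cring_axioms)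
    show "\<psi> \<circ> \<phi> \<in> ring_hom R C" by (rule ring_hom_trans[OF \<phi>.hom \<psi>.hom])
    show "\<exists>a \<in> carrier R. \<exists>s \<in> carrier R - q. (\<psi> \<circ> \<phi>) s \<otimes>\<^bsub>C\<^esub> c = (\<psi> \<circ> \<phi>) a" if c: "c \<in> carrier C" for c
    proof -
      obtain b t where bt: "b \<in> carrier B" "t \<in> carrier B" "t \<notin> m" "\<psi> t \<otimes>\<^bsub>C\<^esub> c = \<psi> b" using \<psi>.fracE[OF c] by metis
      obtain a s where as: "a \<in> carrier R" "s \<in> carrier R" "s \<notin> q" "\<phi> s \<otimes>\<^bsub>B\<^esub> t = \<phi> a" using \<phi>.fracE[OF bt(2)] by metis
      obtain a' s' where as': "a' \<in> carrier R" "s' \<in> carrier R" "s' \<notin> q" "\<phi> s' \<otimes>\<^bsub>B\<^esub> b = \<phi> a'" using \<phi>.fracE[OF bt(1)] by metis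
      have "a \<notin> q" using \<phi>.unit_frac_iff[OF bt(2) as] mU[OF bt(2)] bt(3) by blast
      then have n: "a \<otimes> s' \<in> carrier R - q" using prime_compl_mult[OF q] as as' by blast
      have "\<phi> (a \<otimes> s') = \<phi> s' \<otimes>\<^bsub>B\<^esub> (\<phi> s \<otimes>\<^bsub>B\<^esub> t)" using as as' by (simp add: \<phi>.C.m_comm)
      then have "\<psi> (\<phi> (a \<otimes> s')) \<otimes>\<^bsub>C\<^esub> c = \<psi> (\<phi> s') \<otimes>\<^bsub>C\<^esub> (\<psi> (\<phi> s) \<otimes>\<^bsub>C\<^esub> (\<psi> t \<otimes>\<^bsub>C\<^esub> c))"
        using as(2) as'(2) bt(2) c \<psi>.h.hom_closed \<phi>.h.hom_closed by (simp add: \<psi>.C.m_assoc)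
      also have "\<dots> = \<psi> (\<phi> s \<otimes>\<^bsub>B\<^esub> (\<phi> s' \<otimes>\<^bsub>B\<^esub> b))"
        unfolding bt(4) using as(2) as'(2) bt(1) \<psi>.h.hom_closed \<phi>.h.hom_closed by (simp add: \<psi>.C.m_lcomm)
      also have "\<dots> = \<psi> (\<phi> (s \<otimes> a'))" unfolding as'(4) using as as' by simp
      finally show ?thesis using n as as' by (intro bexI[of _ "s \<otimes> a'"] bexI[of _ "a \<otimes> s'"]) auto
    qed
    fix a assume a: "a \<in> carrier R"
    show "(\<psi> \<circ> \<phi>) a \<in> Units C \<longleftrightarrow> a \<notin> q" using \<psi>.unit_iff[of "\<phi> a"] mU[of "\<phi> a"] \<phi>.unit_iff[OF a] a by simp
    have "\<phi> a = \<zero>\<^bsub>B\<^esub>" if s: "s \<in> carrier B - m" "s \<otimes>\<^bsub>B\<^esub> \<phi> a = \<zero>\<^bsub>B\<^esub>" for s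
    proof -
      have "s \<in> Units B" using mU s by auto
      then obtain v where v: "v \<in> carrier B" "v \<otimes>\<^bsub>B\<^esub> s = \<one>\<^bsub>B\<^esub>" by (auto simp: Units_def)
      have sc: "s \<in> carrier B" using s(1) by blast
      have "\<phi> a = (v \<otimes>\<^bsub>B\<^esub> s) \<otimes>\<^bsub>B\<^esub> \<phi> a" using v a by simp
      also have "\<dots> = v \<otimes>\<^bsub>B\<^esub> (s \<otimes>\<^bsub>B\<^esub> \<phi> a)" by (rule \<phi>.C.m_assoc[OF v(1) sc \<phi>.h.hom_closed[OF a]])
      also have "\<dots> = \<zero>\<^bsub>B\<^esub>" using s(2) v(1) by simp
      finally show ?thesis .
    qed
    moreover have "\<one>\<^bsub>B\<^esub> \<in> carrier B - m" using mU by auto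
    ultimately have "\<psi> (\<phi> a) = \<zero>\<^bsub>C\<^esub> \<longleftrightarrow> \<phi> a = \<zero>\<^bsub>B\<^esub>"
      using \<psi>.ker_iff[of "\<phi> a"] a by (auto intro!: bexI[of _ "\<one>\<^bsub>B\<^esub>"])
    then show "(\<psi> \<circ> \<phi>) a = \<zero>\<^bsub>C\<^esub> \<longleftrightarrow> (\<exists>s \<in> carrier R - q. s \<otimes> a \<in> P)" using \<phi>.ker_iff[OF a] by simp
  qed
  show ?thesis by (rule localizing_hom.regular_local_ring_parameters[OF * C P(1)])
qed


section \<open>The complete intersection locus and powers of ideals\<close>

context noetherian_cring begin

text \<open>Noetherian induction on \<open>J\<close> takes the place of a decomposition into
  irreducible components. If \<open>J\<close> is prime and good, all exceptional primes above it
  contain s. If it is prime and not good, it is maximal and the only one. If it is proper and not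
  prime, a product a b in \<open>J\<close> puts each of them above J + (a) or J + (b).\<close>

lemma finite_exceptional_primes:
  assumes "ideal J R"
    and "\<And>q. primeideal q R \<Longrightarrow> J \<subseteq> q \<Longrightarrow> good q \<Longrightarrow>
      \<exists>s \<in> carrier R - q. \<forall>p. primeideal p R \<longrightarrow> s \<notin> p \<longrightarrow> good p"
    and "\<And>q. primeideal q R \<Longrightarrow> J \<subseteq> q \<Longrightarrow> \<not> good q \<Longrightarrow> maximalideal q R"
  shows "finite {p. primeideal p R \<and> J \<subseteq> p \<and> \<not> good p}"
  using assms
proof (induction J rule: ideal_induct)
  case (step J)
  define Bad where "Bad K = {p. primeideal p R \<and> K \<subseteq> p \<and> \<not> good p}" for K
  have ind: "finite (Bad (adjoin J x))" if x: "x \<in> carrier R" "x \<notin> J" for x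
    unfolding Bad_def
  proof (rule step.IH)
    show "ideal (adjoin J x) R" by (rule adjoin_ideal[OF step.hyps x(1)])
    have sub: "J \<subseteq> adjoin J x" and mem: "x \<in> adjoin J x"
      using subset_adjoin[OF step.hyps x(1)] mem_adjoin[OF step.hyps x(1)] by auto
    then show "J \<subset> adjoin J x" using x(2) by (auto simp: psubset_eq)
    show "\<exists>s \<in> carrier R - q. \<forall>p. primeideal p R \<longrightarrow> s \<notin> p \<longrightarrow> good p"
      if "primeideal q R" "adjoin J x \<subseteq> q" "good q" for q
      by (rule step.prems(1)[OF that(1) subset_trans[OF sub that(2)] that(3)])
    show "maximalideal q R" if "primeideal q R" "adjoin J x \<subseteq> q" "\<not> good q" for q
      by (rule step.prems(2)[OF that(1) subset_trans[OF sub that(2)] that(3)])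
  qed
  have BadI: "p \<in> Bad (adjoin J x)" if "p \<in> Bad J" "x \<in> p" for p x
    using that adjoin_subset[OF prime_ideal, of p J x] unfolding Bad_def by blast
  consider "J = carrier R" | "primeideal J R" "good J" | "primeideal J R" "\<not> good J"
    | "J \<noteq> carrier R" "\<not> primeideal J R" by blast
  then have "finite (Bad J)"
  proof cases
    case 1
    then have "Bad J = {}" using prime_one one_closed unfolding Bad_def by blast
    then show ?thesis by simp
  next
    case 2
    obtain s where s: "s \<in> carrier R - J" "\<forall>p. primeideal p R \<longrightarrow> s \<notin> p \<longrightarrow> good p"
      using step.prems(1)[OF 2(1) subset_refl 2(2)] by (elim bexE)
    have "Bad J \<subseteq> Bad (adjoin J s)" using s(2) BadI unfolding Bad_def by blast
    then show ?thesis using ind[of s] s(1) finite_subset by blast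
  next
    case 3
    note J = step.prems(2)[OF 3(1) subset_refl 3(2)]
    have "p = J" if "p \<in> Bad J" for p
    proof -
      have p: "primeideal p R" "J \<subseteq> p" using that unfolding Bad_def by auto
      then show ?thesis
        using maximalideal.I_maximal[OF J prime_ideal[OF p(1)] p(2) prime_carrier[OF p(1)]] prime_one[OF p(1)] by auto
    qed
    then have "Bad J \<subseteq> {J}" by blast
    then show ?thesis by (rule finite_subset) simp
  next
    case 4
    obtain a b where ab: "a \<in> carrier R" "b \<in> carrier R" "a \<otimes> b \<in> J" "a \<notin> J" "b \<notin> J"
      using not_prime_ideal_witnesses[OF step.hyps 4(2,1)] .
    have "Bad J \<subseteq> Bad (adjoin J a) \<union> Bad (adjoin J b)"
    proof
      fix p assume p: "p \<in> Bad J"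
      then have "a \<otimes> b \<in> p" "primeideal p R" using ab(3) unfolding Bad_def by auto
      then have "a \<in> p \<or> b \<in> p" using prime_mult[of p R a b] ab by blast
      then show "p \<in> Bad (adjoin J a) \<union> Bad (adjoin J b)" using BadI[OF p] by blast
    qed
    then show ?thesis using ind[of a] ind[of b] ab finite_subset by blast
  qed
  then show ?case unfolding Bad_def .
qed

text \<open>For z to be a nonzerodivisor modulo J at q means that \<open>colon J z\<close> lies in
  \<open>sat q J\<close>. One t outside q then carries this colon ideal into \<open>J\<close>, which
  gives the same property at all primes avoiding t; the multipliers of the successive members are
  multiplied.\<close>

lemma regular_seq_at_open:
  assumes q: "primeideal q R"
  shows "ideal J R \<Longrightarrow> set zs \<subseteq> carrier R \<Longrightarrow> regular_seq_at q J zs \<Longrightarrow>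
    \<exists>s \<in> carrier R - q. \<forall>p. primeideal p R \<longrightarrow> s \<notin> p \<longrightarrow> regular_seq_at p J zs"
proof (induction zs arbitrary: J)
  case Nil
  then show ?case using prime_compl_one[OF q] by auto
next
  case (Cons z zs)
  have z: "z \<in> carrier R" "set zs \<subseteq> carrier R" using Cons.prems(2) by auto
  obtain s where s: "s \<in> carrier R - q" "\<And>p. primeideal p R \<Longrightarrow> s \<notin> p \<Longrightarrow> regular_seq_at p (adjoin J z) zs"
    using Cons.IH[OF adjoin_ideal[OF Cons.prems(1) z(1)] z(2)] Cons.prems(3) by auto
  have "colon J z \<subseteq> sat q J" using Cons.prems(3) m_comm[OF _ z(1)] by (auto simp: colon_def)
  then obtain t where t: "t \<in> carrier R - q" "\<And>k. k \<in> colon J z \<Longrightarrow> t \<otimes> k \<in> J"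
    using sat_uniform[OF q Cons.prems(1) colon_ideal[OF Cons.prems(1) z(1)]] by metis
  have st: "s \<otimes> t \<in> carrier R - q" using prime_compl_mult[OF q] s t by blast
  have "regular_seq_at p J (z # zs)" if p: "primeideal p R" "s \<otimes> t \<notin> p" for p
  proof -
    have n: "s \<notin> p" "t \<notin> p" using ideal_mem(7,8)[OF prime_ideal[OF p(1)]] p(2) s(1) t(1) by auto
    have "r \<in> sat p J" if "r \<in> carrier R" "r \<otimes> z \<in> J" for r
      using t(2)[of r] t(1) n that z(1) by (intro satI[of _ t]) (auto simp: colon_def m_comm)
    then show ?thesis using s(2)[OF p(1) n(1)] by simp
  qed
  then show ?case using st by blast
qed

definition complete_intersection_at :: "'a set \<Rightarrow> 'a set \<Rightarrow> bool" where
  "complete_intersection_at P q \<longleftrightarrow>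
    (\<exists>zs. set zs \<subseteq> P \<and> P \<subseteq> sat q (adjoin_list {\<zero>} zs) \<and> regular_seq_at q {\<zero>} zs)"

lemma complete_intersection_at_open:
  assumes q: "primeideal q R" and P: "ideal P R" and "complete_intersection_at P q"
  shows "\<exists>s \<in> carrier R - q. \<forall>p. primeideal p R \<longrightarrow> s \<notin> p \<longrightarrow> complete_intersection_at P p"
proof -
  obtain zs where zs: "set zs \<subseteq> P" "P \<subseteq> sat q (adjoin_list {\<zero>} zs)" "regular_seq_at q {\<zero>} zs"
    using assms(3) unfolding complete_intersection_at_def by blast
  have zc: "set zs \<subseteq> carrier R" using zs(1) ideal_mem(1)[OF P] by blast
  obtain s where s: "s \<in> carrier R - q" "\<And>p. primeideal p R \<Longrightarrow> s \<notin> p \<Longrightarrow> regular_seq_at p {\<zero>} zs"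
    using regular_seq_at_open[OF q zeroideal zc zs(3)] by blast
  obtain t where t: "t \<in> carrier R - q" "\<And>k. k \<in> P \<Longrightarrow> t \<otimes> k \<in> adjoin_list {\<zero>} zs"
    using sat_uniform[OF q adjoin_list_ideal[OF zeroideal zc] P zs(2)] by metis
  have st: "s \<otimes> t \<in> carrier R - q" using prime_compl_mult[OF q] s t by blast
  have "complete_intersection_at P p" if p: "primeideal p R" "s \<otimes> t \<notin> p" for p
  proof -
    have n: "s \<notin> p" "t \<notin> p" using ideal_mem(7,8)[OF prime_ideal[OF p(1)]] p(2) s(1) t(1) by auto
    have "P \<subseteq> sat p (adjoin_list {\<zero>} zs)"
      using t n ideal_mem(2)[OF P] by (auto intro!: satI[of _ t])
    then show ?thesis unfolding complete_intersection_at_def using zs(1) s(2)[OF p(1) n(1)] by blast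
  qed
  then show ?thesis using st by blast
qed

lemma finite_not_complete_intersection:
  assumes R: "regular_ring R" and P: "primeideal P R"
    and B: "\<And>q. primeideal q R \<Longrightarrow> \<not> maximalideal q R \<Longrightarrow> P \<subseteq> q \<Longrightarrow>
           regular_ring (quot_localization_at R P q)"
  shows "finite {p. primeideal p R \<and> P \<subseteq> p \<and> \<not> complete_intersection_at P p}"
proof (rule finite_exceptional_primes)
  note iP = prime_ideal[OF P]
  show "ideal P R" by (rule iP)
  show "\<exists>s \<in> carrier R - q. \<forall>p. primeideal p R \<longrightarrow> s \<notin> p \<longrightarrow> complete_intersection_at P p"
    if "primeideal q R" "complete_intersection_at P q" for q
    by (rule complete_intersection_at_open[OF that(1) iP that(2)])
  fix q assume q: "primeideal q R" "P \<subseteq> q" "\<not> complete_intersection_at P q"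
  show "maximalideal q R"
  proof (rule ccontr)
    assume n: "\<not> maximalideal q R"
    obtain xs P0 Q where xs: "set xs \<subseteq> q" "q \<subseteq> sat q (adjoin_list {\<zero>} xs)"
      "prime_chain (length xs) P0 Q" "{\<zero>} \<subseteq> P0" "Q \<subseteq> q"
      using regular_ring_parameters[OF R q(1)] by (elim exE conjE)
    obtain ys P1 Q1 where ys: "set ys \<subseteq> q" "q \<subseteq> sat q (adjoin_list P ys)"
      "prime_chain (length ys) P1 Q1" "P \<subseteq> P1" "Q1 \<subseteq> q"
      using quotient_regular_parameters[OF cring_axioms q(1) iP q(2) B[OF q(1) n q(2)]] by (elim exE conjE)
    have "{\<zero>} \<subseteq> P" using ideal_mem(3)[OF iP] by simp
    \<comment> \<open>The exchange starts from the zero ideal with generators coming from R_q, while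
      \<open>ys\<close> and its chain come from (R/P)_q.\<close>
    from regular_generators_at[OF q(1) P q(2) ys zeroideal this xs] q(3)
    show False unfolding complete_intersection_at_def by blast
  qed
qed

section \<open>Powers of ideals and a weak Artin-Rees property\<close>

lemma ideal_power_ideal: "ideal I R \<Longrightarrow> ideal (ideal_power R I n) R"
  by (induction n) (auto intro: oneideal ideal_prod_is_ideal)

lemma ideal_power_Suc_subset: "ideal I R \<Longrightarrow> ideal_power R I (Suc n) \<subseteq> ideal_power R I n"
  using ideal_prod_inter[OF _ ideal_power_ideal, of I I n] by auto

lemma ideal_power_antimono:
  assumes "ideal I R" "m \<le> n"
  shows "ideal_power R I n \<subseteq> ideal_power R I m"
  using assms(2) by (rule lift_Suc_antimono_le[of "ideal_power R I", rotated]) (rule ideal_power_Suc_subset[OF assms(1)])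

lemma ideal_power_one: "ideal I R \<Longrightarrow> ideal_power R I (Suc 0) = I"
  using ideal_prod_one[of I] by simp

lemma pow_mem_ideal_power:
  assumes "ideal I R" "x \<in> I"
  shows "x [^] n \<in> ideal_power R I n"
proof (induction n)
  case (Suc n)
  have xc: "x \<in> carrier R" using ideal_mem(2)[OF assms] .
  have "x \<otimes> x [^] n \<in> ideal_power R I (Suc n)" using ideal_prod.prod[OF assms(2) Suc] by simp
  then show ?case using xc by (simp add: m_comm)
qed simp

lemma ideal_power_add:
  assumes "ideal I R"
  shows "ideal_power R I (m + n) = ideal_power R I m \<cdot> ideal_power R I n"
proof (induction m)
  case 0
  then show ?case using ideal_prod_one[OF ideal_power_ideal[OF assms], of n]
      ideal_prod_commute[OF oneideal ideal_power_ideal[OF assms], of n] by simp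
next
  case (Suc m)
  then show ?case by (simp add: ideal_prod_assoc assms ideal_power_ideal)
qed

text \<open>The product of K + (y) and K : y lies in K, so it is enough that both factors contain a
  power of \<open>Q\<close>. Taking for y the last power of some x in \<open>Q\<close> that is
  outside \<open>K\<close> makes both ideals strictly larger than \<open>K\<close>, since x itself
  lies in K : y.\<close>

lemma ideal_power_subset_radical:
  assumes Q: "ideal Q R"
  shows "ideal K R \<Longrightarrow> (\<And>x. x \<in> Q \<Longrightarrow> \<exists>m::nat. x [^] m \<in> K) \<Longrightarrow> \<exists>N. ideal_power R Q N \<subseteq> K"
proof (induction K rule: ideal_induct)
  case (step K)
  note K = ideal_mem[OF step.hyps]
  show ?case
  proof (cases "Q \<subseteq> K")
    case True
    then show ?thesis using ideal_power_one[OF Q] by metis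
  next
    case False
    then obtain x where x: "x \<in> Q" "x \<notin> K" by blast
    have xc: "x \<in> carrier R" using ideal_mem(2)[OF Q x(1)] .
    define m where "m = (LEAST m::nat. x [^] m \<in> K)"
    have m: "x [^] m \<in> K" unfolding m_def by (rule LeastI_ex) (rule step.prems[OF x(1)])
    have "m \<noteq> 0"
    proof
      assume "m = 0"
      then have "\<one> \<in> K" using m by simp
      then show False using K(7)[of x \<one>] x xc by simp
    qed
    then obtain l where l: "m = Suc l" by (cases m) auto
    define y where "y = x [^] l"
    have yc: "y \<in> carrier R" using xc by (simp add: y_def)
    have yK: "y \<notin> K" unfolding y_def using not_less_Least[of l "\<lambda>m. x [^] m \<in> K"] l m_def by simp
    have yx: "y \<otimes> x \<in> K" using m l by (simp add: y_def)
    have "\<exists>N. ideal_power R Q N \<subseteq> adjoin K y"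
    proof (rule step.IH)
      show "ideal (adjoin K y) R" by (rule adjoin_ideal[OF step.hyps yc])
      show "K \<subset> adjoin K y" using subset_adjoin[OF step.hyps yc] mem_adjoin[OF step.hyps yc] yK by (auto simp: psubset_eq)
      show "\<exists>m::nat. x [^] m \<in> adjoin K y" if "x \<in> Q" for x
        using step.prems[OF that] subset_adjoin[OF step.hyps yc] by blast
    qed
    then obtain N1 where N1: "ideal_power R Q N1 \<subseteq> adjoin K y" ..
    have "\<exists>N. ideal_power R Q N \<subseteq> colon K y"
    proof (rule step.IH)
      show "ideal (colon K y) R" by (rule colon_ideal[OF step.hyps yc])
      have "x \<in> colon K y" using yx xc by (simp add: colon_def)
      then show "K \<subset> colon K y" using subset_colon[OF step.hyps yc] x(2) by (auto simp: psubset_eq)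
      show "\<exists>m::nat. x [^] m \<in> colon K y" if "x \<in> Q" for x
        using step.prems[OF that] subset_colon[OF step.hyps yc] by blast
    qed
    then obtain N2 where N2: "ideal_power R Q N2 \<subseteq> colon K y" ..
    have "ideal_power R Q N1 \<cdot> ideal_power R Q N2 \<subseteq> K"
    proof (rule ideal_prod_subset[OF step.hyps])
      fix a b assume ab: "a \<in> ideal_power R Q N1" "b \<in> ideal_power R Q N2"
      then have "a \<in> adjoin K y" using N1 by blast
      then obtain k c where kc: "k \<in> K" "c \<in> carrier R" "a = k \<oplus> c \<otimes> y" by (rule adjoinE)
      have b: "b \<in> carrier R" "y \<otimes> b \<in> K" using ab(2) N2 by (auto simp: colon_def)
      have kcar: "k \<in> carrier R" using K(2) kc(1) .
      have "a \<otimes> b = k \<otimes> b \<oplus> c \<otimes> (y \<otimes> b)" unfolding kc(3) using kc(2) kcar b(1) yc by algebra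
      then show "a \<otimes> b \<in> K" using K(4,7,8) kc b by simp
    qed
    then show ?thesis using ideal_power_add[OF Q, of N1 N2] by metis
  qed
qed

text \<open>Starting from \<open>T = Q\<^sup>n J\<close>, suitable powers of elements of \<open>Q\<close> are adjoined without changing the
  intersection with \<open>J\<close>, until \<open>Q\<close> lies in the radical.\<close>

lemma artin_rees_weak:
  assumes Q: "ideal Q R" and J: "ideal J R"
  shows "\<exists>N. ideal_power R Q N \<inter> J \<subseteq> ideal_power R Q n \<cdot> J"
proof -
  note Qn = ideal_power_ideal[OF Q, of n]
  define T where "T = ideal_power R Q n \<cdot> J"
  have T: "ideal T R" unfolding T_def by (rule ideal_prod_is_ideal[OF Qn J])
  have "\<exists>K'. ideal K' R \<and> K' \<inter> J \<subseteq> T \<and> (\<forall>x \<in> Q. \<exists>m::nat. x [^] m \<in> K')"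
    if "ideal K R" "T \<subseteq> K" "K \<inter> J \<subseteq> T" for K
    using that
  proof (induction K rule: ideal_induct)
    case (step K)
    note K = ideal_mem[OF step.hyps]
    show ?case
    proof (cases "\<forall>x \<in> Q. \<exists>m::nat. x [^] m \<in> K")
      case True
      then show ?thesis using step by blast
    next
      case False
      then obtain x where x: "x \<in> Q" "\<And>m::nat. x [^] m \<notin> K" by blast
      have xc: "x \<in> carrier R" using ideal_mem(2)[OF Q x(1)] .
      then have xm: "x [^] (m::nat) \<in> carrier R" for m by simp
      define f where "f m = colon K (x [^] (m::nat))" for m
      have "f m \<subseteq> f (Suc m)" for m
      proof
        fix r assume "r \<in> f m"
        then have r: "r \<in> carrier R" "x [^] m \<otimes> r \<in> K" by (auto simp: f_def colon_def)
        have "x [^] Suc m \<otimes> r = x \<otimes> (x [^] m \<otimes> r)" using r xc xm[of m] by (simp add: m_ac)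
        then show "r \<in> f (Suc m)" using r K(7)[OF xc] by (simp add: f_def colon_def)
      qed
      moreover have "ideal (f m) R" for m unfolding f_def by (rule colon_ideal[OF step.hyps xm])
      \<comment> \<open>At this exponent the ideals K : x^m stop growing; \<open>stable\<close>
        extends the single equality to all later exponents.\<close>
      ultimately obtain m where m: "f (Suc m) = f m" using ideal_chain_stable[of f] by metis
      have stable: "r \<in> carrier R \<Longrightarrow> x [^] (m + i) \<otimes> r \<in> K \<Longrightarrow> x [^] m \<otimes> r \<in> K" for i r
      proof (induction i arbitrary: r)
        case (Suc i)
        have "x [^] (m + i) \<otimes> (x \<otimes> r) = x [^] (m + Suc i) \<otimes> r" using Suc.prems(1) xc xm[of "m + i"] by (simp add: m_ac)
        then have "x [^] m \<otimes> (x \<otimes> r) \<in> K" using Suc.IH[of "x \<otimes> r"] Suc.prems xc by simp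
        moreover have "x [^] m \<otimes> (x \<otimes> r) = x [^] Suc m \<otimes> r" using Suc.prems(1) xc xm[of m] by (simp add: m_ac)
        ultimately have "r \<in> f (Suc m)" using Suc.prems(1) by (simp add: f_def colon_def)
        then have "r \<in> f m" using m by simp
        then show ?case by (simp add: f_def colon_def)
      qed simp
      let ?K = "adjoin K (x [^] m)"
      have sub: "K \<subseteq> ?K" and mem: "x [^] m \<in> ?K"
        using subset_adjoin[OF step.hyps xm] mem_adjoin[OF step.hyps xm] by auto
      have "?K \<inter> J \<subseteq> T"
      proof
        fix y assume y: "y \<in> ?K \<inter> J"
        then obtain k c where kc: "k \<in> K" "c \<in> carrier R" "y = k \<oplus> c \<otimes> x [^] m" by (auto elim: adjoinE)
        have kcar: "k \<in> carrier R" using K(2) kc(1) .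
        \<comment> \<open>Since y is in \<open>J\<close>, x^n y is in Q^n J and so in
          \<open>K\<close>. This puts x^(m+n) c into \<open>K\<close>; stability lowers the exponent
          to m, and y itself lies in \<open>K\<close>.\<close>
        have "x [^] n \<otimes> y \<in> T" unfolding T_def
          using y pow_mem_ideal_power[OF Q x(1), of n] by (auto intro: ideal_prod.prod)
        then have 1: "x [^] n \<otimes> y \<in> K" using step.prems by blast
        have "x [^] (m + n) \<otimes> c = (x [^] m \<otimes> x [^] n) \<otimes> c" using xc by (simp add: nat_pow_mult)
        also have "\<dots> = x [^] n \<otimes> y \<ominus> x [^] n \<otimes> k"
          unfolding kc(3) using kc(2) kcar xm[of m] xm[of n] by algebra
        also have "\<dots> \<in> K" using 1 K(6,7) kc xm by simp
        finally have "x [^] m \<otimes> c \<in> K" by (rule stable[OF kc(2)])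
        then have "c \<otimes> x [^] m \<in> K" using m_comm[OF kc(2) xm[of m]] by simp
        then have "y \<in> K" unfolding kc(3) using kc K(4) by blast
        then show "y \<in> T" using y step.prems by blast
      qed
      moreover have "K \<subset> ?K" using sub mem x(2)[of m] by (auto simp: psubset_eq)
      moreover have "ideal ?K R" by (rule adjoin_ideal[OF step.hyps xm])
      ultimately show ?thesis using step.IH[of ?K] step.prems(1) sub by (metis subset_trans)
    qed
  qed
  from this[OF T] obtain K where K: "ideal K R" "K \<inter> J \<subseteq> T" "\<forall>x \<in> Q. \<exists>m::nat. x [^] m \<in> K" by auto
  obtain N where "ideal_power R Q N \<subseteq> K" using ideal_power_subset_radical[OF Q K(1)] K(3) by blast
  then show ?thesis using K(2) unfolding T_def by blast
qed

end


section \<open>Divisibility of injective modules\<close>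

context module begin

lemma smult_diff_right:
  assumes "a \<in> carrier R" "x \<in> carrier M" "y \<in> carrier M"
  shows "a \<odot>\<^bsub>M\<^esub> (x \<ominus>\<^bsub>M\<^esub> y) = a \<odot>\<^bsub>M\<^esub> x \<ominus>\<^bsub>M\<^esub> a \<odot>\<^bsub>M\<^esub> y"
  using assms by (simp add: M.minus_eq smult_r_distr smult_r_minus)

lemma smult_diff_left:
  assumes "a \<in> carrier R" "b \<in> carrier R" "x \<in> carrier M"
  shows "(a \<ominus> b) \<odot>\<^bsub>M\<^esub> x = a \<odot>\<^bsub>M\<^esub> x \<ominus>\<^bsub>M\<^esub> b \<odot>\<^bsub>M\<^esub> x"
  using assms by (simp add: R.minus_eq M.minus_eq smult_l_distr smult_l_minus)

lemma smult_lcomm: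
  assumes "a \<in> carrier R" "b \<in> carrier R" "x \<in> carrier M"
  shows "a \<odot>\<^bsub>M\<^esub> (b \<odot>\<^bsub>M\<^esub> x) = b \<odot>\<^bsub>M\<^esub> (a \<odot>\<^bsub>M\<^esub> x)"
  using assms by (simp add: smult_assoc1[symmetric] R.m_comm)

lemma diff_eq_zero_iff:
  assumes "x \<in> carrier M" "y \<in> carrier M"
  shows "x \<ominus>\<^bsub>M\<^esub> y = \<zero>\<^bsub>M\<^esub> \<longleftrightarrow> x = y"
  using assms M.minus_equality[of x "\<ominus>\<^bsub>M\<^esub> y"] by (auto simp: M.minus_eq M.r_neg)

lemma diff_zero: "x \<in> carrier M \<Longrightarrow> x \<ominus>\<^bsub>M\<^esub> \<zero>\<^bsub>M\<^esub> = x"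
  using M.minus_equality[of "\<zero>\<^bsub>M\<^esub>" "\<zero>\<^bsub>M\<^esub>"] by (simp add: M.minus_eq)

lemma annihilator_ideal:
  assumes "x \<in> carrier M"
  shows "ideal {r \<in> carrier R. r \<odot>\<^bsub>M\<^esub> x = \<zero>\<^bsub>M\<^esub>} R"
  using assms by (intro R.cring_idealI) (auto simp: smult_l_distr smult_assoc1)

end

lemma (in cring) self_module_module: "module R (self_module R)"
proof (rule moduleI)
  show "cring R" by (rule cring_axioms)
  show "abelian_group (self_module R)"
    by (rule abelian_groupI) (auto simp: self_module_def a_ac intro: l_neg exI[of _ "\<ominus> _"] bexI[of _ "\<ominus> _"])
qed (auto simp: self_module_def l_distr r_distr m_assoc)

lemma (in cring) ideal_module:
  assumes "ideal I R"
  shows "module R ((self_module R)\<lparr>carrier := I\<rparr>)"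
proof -
  interpret M: module R "self_module R" by (rule self_module_module)
  have "submodule I R (self_module R)"
  proof (rule M.submoduleI)
    note I = ideal_mem[OF assms]
    show "I \<subseteq> carrier (self_module R)" "\<zero>\<^bsub>self_module R\<^esub> \<in> I"
      using I by (auto simp: self_module_def)
    show "x \<oplus>\<^bsub>self_module R\<^esub> y \<in> I" if "x \<in> I" "y \<in> I" for x y using I(4)[OF that] by (simp add: self_module_def)
    show "r \<odot>\<^bsub>self_module R\<^esub> x \<in> I" if "r \<in> carrier R" "x \<in> I" for r x using I(7)[OF that] by (simp add: self_module_def)
    show "\<ominus>\<^bsub>self_module R\<^esub> x \<in> I" if "x \<in> I" for x
    proof -
      have "\<ominus>\<^bsub>self_module R\<^esub> x = \<ominus> x" by (simp add: a_inv_def m_inv_def self_module_def)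
      then show ?thesis using I(5)[OF that] by simp
    qed
  qed
  then show ?thesis by (rule submodule.submodule_is_module[OF _ self_module_module])
qed

text \<open>The easy half of Baer's criterion: an extension of \<open>g\<close> to the whole ring is
  determined by the image y of 1. Ideals are modules over the element type of \<open>R\<close>, so
  they fall under the definition of injectivity.\<close>

lemma (in cring) injective_extension:
  assumes M: "injective_module R M" and I: "ideal I R"
    and g: "\<And>x. x \<in> I \<Longrightarrow> g x \<in> carrier M" "\<And>x y. x \<in> I \<Longrightarrow> y \<in> I \<Longrightarrow> g (x \<oplus> y) = g x \<oplus>\<^bsub>M\<^esub> g y"
      "\<And>r x. r \<in> carrier R \<Longrightarrow> x \<in> I \<Longrightarrow> g (r \<otimes> x) = r \<odot>\<^bsub>M\<^esub> g x"
  obtains y where "y \<in> carrier M" "\<And>x. x \<in> I \<Longrightarrow> g x = x \<odot>\<^bsub>M\<^esub> y"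
proof -
  let ?A = "(self_module R)\<lparr>carrier := I\<rparr>" and ?B = "self_module R"
  have id: "(\<lambda>x. x) \<in> mod_hom R ?A ?B" using ideal_mem(1)[OF I] by (auto simp: mod_hom_def self_module_def)
  have gh: "g \<in> mod_hom R ?A M" using g by (auto simp: mod_hom_def self_module_def)
  have ext: "\<forall>(A :: ('a, 'a) module) (B :: ('a, 'a) module). module R A \<longrightarrow> module R B \<longrightarrow>
       (\<forall>f \<in> mod_hom R A B. inj_on f (carrier A) \<longrightarrow>
         (\<forall>g \<in> mod_hom R A M. \<exists>h \<in> mod_hom R B M. \<forall>x \<in> carrier A. h (f x) = g x))"
    using M unfolding injective_module_def by (rule conjunct2)
  have "\<exists>h \<in> mod_hom R ?B M. \<forall>x \<in> carrier ?A. h ((\<lambda>x. x) x) = g x"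
    using ext[rule_format, OF ideal_module[OF I] self_module_module id _ gh] by simp
  then obtain h where h: "h \<in> mod_hom R ?B M" "\<And>x. x \<in> I \<Longrightarrow> h x = g x" by auto
  have "g x = x \<odot>\<^bsub>M\<^esub> h \<one>" if x: "x \<in> I" for x
  proof -
    have xc: "x \<in> carrier R" using ideal_mem(2)[OF I x] .
    have "\<forall>r \<in> carrier R. \<forall>x \<in> carrier R. h (r \<otimes> x) = r \<odot>\<^bsub>M\<^esub> h x"
      using h(1) by (simp add: mod_hom_def self_module_def)
    then have "h (x \<otimes> \<one>) = x \<odot>\<^bsub>M\<^esub> h \<one>" using xc one_closed by blast
    then show ?thesis using h(2)[OF x] xc by simp
  qed
  moreover have "h \<one> \<in> carrier M" using h(1) by (auto simp: mod_hom_def self_module_def)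
  ultimately show ?thesis using that by blast
qed

text \<open>The map \<open>z c + i \<mapsto> (t c) f\<close> on \<open>I + (z)\<close> is extended by zero to \<open>I + (z) + Q\<^sup>N\<close>, which is
  possible for large \<open>N\<close> by the Artin--Rees property, and then to \<open>R\<close>.\<close>

lemma (in noetherian_cring) injective_divisible:
  assumes M: "injective_module R M" and p: "primeideal p R"
    and I: "ideal I R" and Q: "ideal Q R" and z: "z \<in> carrier R"
    and reg: "\<And>r. r \<in> carrier R \<Longrightarrow> r \<otimes> z \<in> I \<Longrightarrow> r \<in> sat p I"
    and f: "f \<in> carrier M" "\<And>a. a \<in> I \<Longrightarrow> a \<odot>\<^bsub>M\<^esub> f = \<zero>\<^bsub>M\<^esub>"
      "\<And>a. a \<in> ideal_power R Q n \<Longrightarrow> a \<odot>\<^bsub>M\<^esub> f = \<zero>\<^bsub>M\<^esub>"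
  shows "\<exists>t \<in> carrier R - p. \<exists>g \<in> carrier M. (\<forall>a \<in> I. a \<odot>\<^bsub>M\<^esub> g = \<zero>\<^bsub>M\<^esub>) \<and>
    (\<exists>N. \<forall>a \<in> ideal_power R Q N. a \<odot>\<^bsub>M\<^esub> g = \<zero>\<^bsub>M\<^esub>) \<and> z \<odot>\<^bsub>M\<^esub> g = t \<odot>\<^bsub>M\<^esub> f"
proof -
  interpret M: module R M using M by (simp add: injective_module_def)
  note Im = ideal_mem[OF I]
  have "colon I z \<subseteq> sat p I" using reg m_comm[OF _ z] by (auto simp: colon_def)
  \<comment> \<open>A single t carries all of \<open>colon I z\<close> into \<open>I\<close>, and
    \<open>I\<close> annihilates f. So t c f depends only on c z modulo \<open>I\<close>, not on the
    choice of c.\<close>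
  then obtain t where t: "t \<in> carrier R - p" "\<And>k. k \<in> colon I z \<Longrightarrow> t \<otimes> k \<in> I"
    using sat_uniform[OF p I colon_ideal[OF I z]] by metis
  have tc: "t \<in> carrier R" using t by blast
  let ?J = "adjoin I z"
  have J: "ideal ?J R" by (rule adjoin_ideal[OF I z])
  note Jm = ideal_mem[OF J]
  \<comment> \<open>Extension by zero requires the map to vanish where Q^N meets I + (z). It
    vanishes on Q^n (I + (z)) because Q^n annihilates f.\<close>
  obtain N where N: "ideal_power R Q N \<inter> ?J \<subseteq> ideal_power R Q n \<cdot> ?J" using artin_rees_weak[OF Q J] by metis
  have QN: "ideal (ideal_power R Q N) R" and Qn: "ideal (ideal_power R Q n) R" by (rule ideal_power_ideal[OF Q])+
  note QNm = ideal_mem[OF QN]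
  have wd1: "(t \<otimes> c) \<odot>\<^bsub>M\<^esub> f = \<zero>\<^bsub>M\<^esub>" if c: "c \<in> carrier R" "c \<otimes> z \<in> I" for c
  proof -
    have "c \<in> colon I z" using c z by (simp add: colon_def m_comm)
    then show ?thesis using t(2) f(2) by blast
  qed
  have wd2: "\<exists>i \<in> I. \<exists>c \<in> carrier R. y = i \<oplus> c \<otimes> z \<and> (t \<otimes> c) \<odot>\<^bsub>M\<^esub> f = \<zero>\<^bsub>M\<^esub>"
    if "y \<in> ideal_power R Q n \<cdot> ?J" for y
    using that
  proof induction
    case (prod a j)
    obtain i c where ic: "i \<in> I" "c \<in> carrier R" "j = i \<oplus> c \<otimes> z" using prod(2) by (rule adjoinE)
    have ac: "a \<in> carrier R" "i \<in> carrier R" using ideal_mem(2)[OF Qn prod(1)] Im(2)[OF ic(1)] .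
    have "a \<otimes> j = a \<otimes> i \<oplus> (a \<otimes> c) \<otimes> z" unfolding ic(3) using ac ic(2) z by algebra
    moreover have "(t \<otimes> (a \<otimes> c)) \<odot>\<^bsub>M\<^esub> f = (t \<otimes> c) \<odot>\<^bsub>M\<^esub> (a \<odot>\<^bsub>M\<^esub> f)"
      using ac ic(2) tc f(1) by (simp add: M.smult_assoc1[symmetric] m_ac)
    then have "(t \<otimes> (a \<otimes> c)) \<odot>\<^bsub>M\<^esub> f = \<zero>\<^bsub>M\<^esub>" using f(3)[OF prod(1)] tc ic(2) by simp
    moreover have "a \<otimes> i \<in> I" "a \<otimes> c \<in> carrier R" using Im(7) ac ic by auto
    ultimately show ?case by blast
  next
    case (sum y y')
    then obtain i c i' c' where ic: "i \<in> I" "c \<in> carrier R" "y = i \<oplus> c \<otimes> z" "(t \<otimes> c) \<odot>\<^bsub>M\<^esub> f = \<zero>\<^bsub>M\<^esub>"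
      "i' \<in> I" "c' \<in> carrier R" "y' = i' \<oplus> c' \<otimes> z" "(t \<otimes> c') \<odot>\<^bsub>M\<^esub> f = \<zero>\<^bsub>M\<^esub>" by blast
    have "y \<oplus> y' = (i \<oplus> i') \<oplus> (c \<oplus> c') \<otimes> z"
      unfolding ic(3,7) using Im(2)[OF ic(1)] Im(2)[OF ic(5)] ic(2,6) z by algebra
    moreover have "(t \<otimes> (c \<oplus> c')) \<odot>\<^bsub>M\<^esub> f = \<zero>\<^bsub>M\<^esub>"
      using ic tc f(1) by (simp add: r_distr M.smult_l_distr)
    moreover have "i \<oplus> i' \<in> I" "c \<oplus> c' \<in> carrier R" using Im(4) ic by auto
    ultimately show ?case by blast
  qed
  define A where "A = {(i \<oplus> c \<otimes> z) \<oplus> b | i c b. i \<in> I \<and> c \<in> carrier R \<and> b \<in> ideal_power R Q N}"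
  have AI: "(i \<oplus> c \<otimes> z) \<oplus> b \<in> A" if "i \<in> I" "c \<in> carrier R" "b \<in> ideal_power R Q N" for i c b
    using that unfolding A_def by blast
  have AE: "\<exists>i c b. x = (i \<oplus> c \<otimes> z) \<oplus> b \<and> i \<in> I \<and> c \<in> carrier R \<and> b \<in> ideal_power R Q N" if "x \<in> A" for x
    using that unfolding A_def by blast
  \<comment> \<open>The map is first a relation over all presentations of x;
    \<open>rel_unique\<close> is its well-definedness.\<close>
  define rel where "rel x y \<longleftrightarrow> (\<exists>i c b. x = (i \<oplus> c \<otimes> z) \<oplus> b \<and> i \<in> I \<and> c \<in> carrier R \<and>
      b \<in> ideal_power R Q N \<and> y = (t \<otimes> c) \<odot>\<^bsub>M\<^esub> f)" for x y
  have rel_unique: "y = y'" if r: "rel x y" "rel x y'" for x y y'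
  proof -
    obtain i c b where 1: "x = (i \<oplus> c \<otimes> z) \<oplus> b" "i \<in> I" "c \<in> carrier R" "b \<in> ideal_power R Q N" "y = (t \<otimes> c) \<odot>\<^bsub>M\<^esub> f"
      using r(1) unfolding rel_def by blast
    obtain i' c' b' where 2: "x = (i' \<oplus> c' \<otimes> z) \<oplus> b'" "i' \<in> I" "c' \<in> carrier R" "b' \<in> ideal_power R Q N" "y' = (t \<otimes> c') \<odot>\<^bsub>M\<^esub> f"
      using r(2) unfolding rel_def by blast
    have car: "i \<in> carrier R" "i' \<in> carrier R" "b \<in> carrier R" "b' \<in> carrier R"
      using 1 2 Im(2) QNm(2) by auto
    have e: "(i \<oplus> c \<otimes> z) \<oplus> b = (i' \<oplus> c' \<otimes> z) \<oplus> b'" using 1(1) 2(1) by simp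
    define y0 where "y0 = (i \<ominus> i') \<oplus> (c \<ominus> c') \<otimes> z"
    have "y0 = ((i \<oplus> c \<otimes> z) \<oplus> b) \<ominus> ((i' \<oplus> c' \<otimes> z) \<oplus> b') \<oplus> (b' \<ominus> b)"
      unfolding y0_def using car 1(3) 2(3) z by algebra
    also have "\<dots> = b' \<ominus> b" unfolding e using car 2(3) z by algebra
    finally have "y0 \<in> ideal_power R Q N" using QNm(6) 1(4) 2(4) by simp
    moreover have "y0 \<in> ?J" unfolding y0_def adjoin_def using Im(6)[OF 1(2) 2(2)] 1(3) 2(3) by blast
    ultimately obtain i0 c0 where 0: "i0 \<in> I" "c0 \<in> carrier R" "y0 = i0 \<oplus> c0 \<otimes> z" "(t \<otimes> c0) \<odot>\<^bsub>M\<^esub> f = \<zero>\<^bsub>M\<^esub>"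
      using N wd2[of y0] by blast
    have i0: "i0 \<in> carrier R" using Im(2) 0 by blast
    have "((c \<ominus> c') \<ominus> c0) \<otimes> z = y0 \<ominus> (i \<ominus> i') \<ominus> c0 \<otimes> z"
      unfolding y0_def using car 1(3) 2(3) z 0(2) by algebra
    also have "\<dots> = i0 \<ominus> (i \<ominus> i')" unfolding 0(3) using car 1(3) 2(3) z 0(2) i0 by algebra
    also have "\<dots> \<in> I" using Im(6) 0(1) 1(2) 2(2) by blast
    finally have "(t \<otimes> ((c \<ominus> c') \<ominus> c0)) \<odot>\<^bsub>M\<^esub> f = \<zero>\<^bsub>M\<^esub>" using 1(3) 2(3) 0(2) by (intro wd1) auto
    moreover have "t \<otimes> ((c \<ominus> c') \<ominus> c0) = (t \<otimes> c \<ominus> t \<otimes> c') \<ominus> t \<otimes> c0" using tc 1(3) 2(3) 0(2) by algebra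
    ultimately have "((t \<otimes> c) \<odot>\<^bsub>M\<^esub> f \<ominus>\<^bsub>M\<^esub> (t \<otimes> c') \<odot>\<^bsub>M\<^esub> f) \<ominus>\<^bsub>M\<^esub> \<zero>\<^bsub>M\<^esub> = \<zero>\<^bsub>M\<^esub>"
      using tc 1(3) 2(3) 0(2,4) f(1) by (simp add: M.smult_diff_left)
    then show ?thesis using 1(5) 2(5) tc 1(3) 2(3) f(1) by (simp add: M.diff_zero M.diff_eq_zero_iff)
  qed
  define h where "h x = (THE y. rel x y)" for x
  have h: "h ((i \<oplus> c \<otimes> z) \<oplus> b) = (t \<otimes> c) \<odot>\<^bsub>M\<^esub> f"
    if "i \<in> I" "c \<in> carrier R" "b \<in> ideal_power R Q N" for i c b
  proof -
    have "rel ((i \<oplus> c \<otimes> z) \<oplus> b) ((t \<otimes> c) \<odot>\<^bsub>M\<^esub> f)" unfolding rel_def using that by blast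
    then show ?thesis unfolding h_def using rel_unique by blast
  qed
  have A: "ideal A R"
  proof (rule cring_idealI)
    show "A \<subseteq> carrier R" unfolding A_def using Im(2) QNm(2) z by auto
    have "\<zero> = (\<zero> \<oplus> \<zero> \<otimes> z) \<oplus> \<zero>" using z by simp
    then show "\<zero> \<in> A" using AI[OF Im(3) zero_closed QNm(3)] by simp
    fix x assume "x \<in> A"
    then obtain i c b where x: "x = (i \<oplus> c \<otimes> z) \<oplus> b" "i \<in> I" "c \<in> carrier R" "b \<in> ideal_power R Q N" using AE by blast
    { fix y assume "y \<in> A"
      then obtain i' c' b' where y: "y = (i' \<oplus> c' \<otimes> z) \<oplus> b'" "i' \<in> I" "c' \<in> carrier R" "b' \<in> ideal_power R Q N" using AE by blast
      have "x \<oplus> y = ((i \<oplus> i') \<oplus> (c \<oplus> c') \<otimes> z) \<oplus> (b \<oplus> b')"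
        unfolding x(1) y(1) using x(3) y(3) z Im(2)[OF x(2)] Im(2)[OF y(2)] QNm(2)[OF x(4)] QNm(2)[OF y(4)] by algebra
      then show "x \<oplus> y \<in> A" using AI Im(4) QNm(4) x y by auto }
    { fix r assume r: "r \<in> carrier R"
      have "r \<otimes> x = (r \<otimes> i \<oplus> (r \<otimes> c) \<otimes> z) \<oplus> (r \<otimes> b)"
        unfolding x(1) using r x(3) z Im(2)[OF x(2)] QNm(2)[OF x(4)] by algebra
      then show "r \<otimes> x \<in> A" using AI Im(7) QNm(7) x r by auto }
  qed
  obtain g where g: "g \<in> carrier M" "\<And>x. x \<in> A \<Longrightarrow> h x = x \<odot>\<^bsub>M\<^esub> g"
  proof (rule injective_extension[OF M A, of h])
    fix x assume "x \<in> A"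
    then obtain i c b where x: "x = (i \<oplus> c \<otimes> z) \<oplus> b" "i \<in> I" "c \<in> carrier R" "b \<in> ideal_power R Q N" using AE by blast
    show "h x \<in> carrier M" using h[OF x(2-4)] x tc f(1) by simp
    { fix y assume "y \<in> A"
      then obtain i' c' b' where y: "y = (i' \<oplus> c' \<otimes> z) \<oplus> b'" "i' \<in> I" "c' \<in> carrier R" "b' \<in> ideal_power R Q N" using AE by blast
      have "x \<oplus> y = ((i \<oplus> i') \<oplus> (c \<oplus> c') \<otimes> z) \<oplus> (b \<oplus> b')"
        unfolding x(1) y(1) using x(3) y(3) z Im(2)[OF x(2)] Im(2)[OF y(2)] QNm(2)[OF x(4)] QNm(2)[OF y(4)] by algebra
      then have "h (x \<oplus> y) = (t \<otimes> (c \<oplus> c')) \<odot>\<^bsub>M\<^esub> f" using h Im(4) QNm(4) x y by auto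
      also have "\<dots> = h x \<oplus>\<^bsub>M\<^esub> h y"
        unfolding x(1) y(1) h[OF x(2-4)] h[OF y(2-4)] using tc x(3) y(3) f(1) by (simp add: r_distr M.smult_l_distr)
      finally show "h (x \<oplus> y) = h x \<oplus>\<^bsub>M\<^esub> h y" . }
    { fix r assume r: "r \<in> carrier R"
      have "r \<otimes> x = (r \<otimes> i \<oplus> (r \<otimes> c) \<otimes> z) \<oplus> (r \<otimes> b)"
        unfolding x(1) using r x(3) z Im(2)[OF x(2)] QNm(2)[OF x(4)] by algebra
      then have "h (r \<otimes> x) = (t \<otimes> (r \<otimes> c)) \<odot>\<^bsub>M\<^esub> f" using h Im(7) QNm(7) x r by auto
      also have "\<dots> = r \<odot>\<^bsub>M\<^esub> h x"
        unfolding x(1) h[OF x(2-4)] using r tc x(3) f(1) by (simp add: M.smult_assoc1[symmetric] m_lcomm)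
      finally show "h (r \<otimes> x) = r \<odot>\<^bsub>M\<^esub> h x" . }
  next
    fix y assume "y \<in> carrier M" "\<And>x. x \<in> A \<Longrightarrow> h x = x \<odot>\<^bsub>M\<^esub> y"
    then show thesis by (rule that)
  qed
  have 1: "a \<odot>\<^bsub>M\<^esub> g = \<zero>\<^bsub>M\<^esub>" if a: "a \<in> I" for a
  proof -
    have "a = (a \<oplus> \<zero> \<otimes> z) \<oplus> \<zero>" using Im(2)[OF a] z by simp
    then show ?thesis using g(2)[of a] AI[OF a zero_closed QNm(3)] h[OF a zero_closed QNm(3)] tc f(1) by simp
  qed
  have 2: "a \<odot>\<^bsub>M\<^esub> g = \<zero>\<^bsub>M\<^esub>" if a: "a \<in> ideal_power R Q N" for a
  proof -
    have "a = (\<zero> \<oplus> \<zero> \<otimes> z) \<oplus> a" using QNm(2)[OF a] z by simp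
    then show ?thesis using g(2)[of a] AI[OF Im(3) zero_closed a] h[OF Im(3) zero_closed a] tc f(1) by simp
  qed
  have "z = (\<zero> \<oplus> \<one> \<otimes> z) \<oplus> \<zero>" using z by simp
  then have 3: "z \<odot>\<^bsub>M\<^esub> g = t \<odot>\<^bsub>M\<^esub> f"
    using g(2)[of z] AI[OF Im(3) one_closed QNm(3)] h[OF Im(3) one_closed QNm(3)] tc by simp
  show ?thesis using t(1) g(1) 1 2 3 by blast
qed


section \<open>Complexes filtered by annihilators of a sequence\<close>

locale module_complex = cring R for R (structure) +
  fixes p :: "'a set" and E :: "nat \<Rightarrow> ('a, 'e) module" and \<delta> :: "nat \<Rightarrow> 'e \<Rightarrow> 'e"
  assumes p: "primeideal p R"
    and E_module: "module R (E i)"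
    and d_hom: "\<delta> i \<in> mod_hom R (E i) (E (Suc i))"
    and d_d: "x \<in> carrier (E i) \<Longrightarrow> \<delta> (Suc i) (\<delta> i x) = \<zero>\<^bsub>E (Suc (Suc i))\<^esub>"
begin

sublocale E: module R "E i" for i by (rule E_module)

lemma d_closed [simp]: "x \<in> carrier (E i) \<Longrightarrow> \<delta> i x \<in> carrier (E (Suc i))"
  and d_add: "x \<in> carrier (E i) \<Longrightarrow> y \<in> carrier (E i) \<Longrightarrow> \<delta> i (x \<oplus>\<^bsub>E i\<^esub> y) = \<delta> i x \<oplus>\<^bsub>E (Suc i)\<^esub> \<delta> i y"
  and d_smult: "r \<in> carrier R \<Longrightarrow> x \<in> carrier (E i) \<Longrightarrow> \<delta> i (r \<odot>\<^bsub>E i\<^esub> x) = r \<odot>\<^bsub>E (Suc i)\<^esub> \<delta> i x"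
  using d_hom[of i] by (auto simp: mod_hom_def)

lemma minus_smult: "x \<in> carrier (E i) \<Longrightarrow> \<ominus>\<^bsub>E i\<^esub> x = (\<ominus> \<one>) \<odot>\<^bsub>E i\<^esub> x"
  by (simp add: E.smult_l_minus)

lemma d_diff:
  assumes "x \<in> carrier (E i)" "y \<in> carrier (E i)"
  shows "\<delta> i (x \<ominus>\<^bsub>E i\<^esub> y) = \<delta> i x \<ominus>\<^bsub>E (Suc i)\<^esub> \<delta> i y"
proof -
  have "\<delta> i (\<ominus>\<^bsub>E i\<^esub> y) = \<ominus>\<^bsub>E (Suc i)\<^esub> \<delta> i y"
    using assms d_smult[of "\<ominus> \<one>" y i] by (simp add: minus_smult)
  then show ?thesis using assms by (simp add: E.M.minus_eq d_add)
qed

lemma d_zero [simp]: "\<delta> i \<zero>\<^bsub>E i\<^esub> = \<zero>\<^bsub>E (Suc i)\<^esub>"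
  using d_smult[of \<zero> "\<zero>\<^bsub>E i\<^esub>" i] by simp

definition subcomplex :: "(nat \<Rightarrow> 'e set) \<Rightarrow> bool" where
  "subcomplex X \<longleftrightarrow> (\<forall>j. X j \<subseteq> carrier (E j) \<and> \<zero>\<^bsub>E j\<^esub> \<in> X j \<and>
    (\<forall>x \<in> X j. \<forall>y \<in> X j. x \<oplus>\<^bsub>E j\<^esub> y \<in> X j) \<and>
    (\<forall>r \<in> carrier R. \<forall>x \<in> X j. r \<odot>\<^bsub>E j\<^esub> x \<in> X j) \<and> (\<forall>x \<in> X j. \<delta> j x \<in> X (Suc j)))"

lemma subcomplexD:
  assumes "subcomplex X"
  shows "x \<in> X j \<Longrightarrow> x \<in> carrier (E j)" "\<zero>\<^bsub>E j\<^esub> \<in> X j"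
    "x \<in> X j \<Longrightarrow> y \<in> X j \<Longrightarrow> x \<oplus>\<^bsub>E j\<^esub> y \<in> X j"
    "r \<in> carrier R \<Longrightarrow> x \<in> X j \<Longrightarrow> r \<odot>\<^bsub>E j\<^esub> x \<in> X j"
    "x \<in> X j \<Longrightarrow> \<delta> j x \<in> X (Suc j)"
  using assms unfolding subcomplex_def by blast+

lemma subcomplex_diff:
  assumes "subcomplex X" "x \<in> X j" "y \<in> X j"
  shows "x \<ominus>\<^bsub>E j\<^esub> y \<in> X j"
  using subcomplexD[OF assms(1)] assms(2,3) minus_smult[of y j] by (simp add: E.M.minus_eq)

definition boundaries :: "(nat \<Rightarrow> 'e set) \<Rightarrow> nat \<Rightarrow> 'e set" where
  "boundaries X j = (case j of 0 \<Rightarrow> {\<zero>\<^bsub>E 0\<^esub>} | Suc i \<Rightarrow> \<delta> i ` X i)"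

lemma boundaries_simps [simp]:
  "boundaries X 0 = {\<zero>\<^bsub>E 0\<^esub>}" "boundaries X (Suc i) = \<delta> i ` X i"
  by (simp_all add: boundaries_def)

lemma boundaries_mono: "(\<And>j. X j \<subseteq> Y j) \<Longrightarrow> boundaries X j \<subseteq> boundaries Y j"
  by (cases j) auto

lemma boundariesD:
  assumes X: "subcomplex X"
  shows "x \<in> boundaries X j \<Longrightarrow> x \<in> X j" "\<zero>\<^bsub>E j\<^esub> \<in> boundaries X j"
    "x \<in> boundaries X j \<Longrightarrow> y \<in> boundaries X j \<Longrightarrow> x \<oplus>\<^bsub>E j\<^esub> y \<in> boundaries X j"
    "r \<in> carrier R \<Longrightarrow> x \<in> boundaries X j \<Longrightarrow> r \<odot>\<^bsub>E j\<^esub> x \<in> boundaries X j"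
    "x \<in> boundaries X j \<Longrightarrow> \<delta> j x = \<zero>\<^bsub>E (Suc j)\<^esub>"
    "x \<in> boundaries X j \<Longrightarrow> x \<in> carrier (E j)"
proof -
  note X' = subcomplexD[OF X]
  show 1: "x \<in> boundaries X j \<Longrightarrow> x \<in> X j" for x j using X' by (cases j) auto
  show "\<zero>\<^bsub>E j\<^esub> \<in> boundaries X j"
  proof (cases j)
    case (Suc i)
    have "\<delta> i \<zero>\<^bsub>E i\<^esub> \<in> \<delta> i ` X i" using X'(2) by blast
    then show ?thesis using Suc by simp
  qed simp
  show "x \<oplus>\<^bsub>E j\<^esub> y \<in> boundaries X j" if xy: "x \<in> boundaries X j" "y \<in> boundaries X j"
  proof (cases j)
    case (Suc i)
    then obtain a b where ab: "x = \<delta> i a" "y = \<delta> i b" "a \<in> X i" "b \<in> X i" using xy by auto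
    then have "x \<oplus>\<^bsub>E j\<^esub> y = \<delta> i (a \<oplus>\<^bsub>E i\<^esub> b)" using X'(1) Suc by (simp add: d_add)
    then show ?thesis using X'(3)[OF ab(3,4)] Suc by simp
  qed (use xy in auto)
  show "r \<odot>\<^bsub>E j\<^esub> x \<in> boundaries X j" if rx: "r \<in> carrier R" "x \<in> boundaries X j"
  proof (cases j)
    case (Suc i)
    then obtain a where a: "x = \<delta> i a" "a \<in> X i" using rx by auto
    then have "r \<odot>\<^bsub>E j\<^esub> x = \<delta> i (r \<odot>\<^bsub>E i\<^esub> a)" using X'(1) Suc rx by (simp add: d_smult)
    then show ?thesis using X'(4)[OF rx(1) a(2)] Suc by simp
  qed (use rx in auto)
  show "x \<in> boundaries X j \<Longrightarrow> \<delta> j x = \<zero>\<^bsub>E (Suc j)\<^esub>" using X'(1) d_d by (cases j) auto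
  show "x \<in> boundaries X j \<Longrightarrow> x \<in> carrier (E j)" using 1 X'(1) by blast
qed

text \<open>The j-th cohomology of \<open>X\<close> vanishes after localization at \<open>p\<close>.
  Each class has its own multiplier, as the terms need not be finitely generated.\<close>

definition acyclic_at :: "(nat \<Rightarrow> 'e set) \<Rightarrow> nat \<Rightarrow> bool" where
  "acyclic_at X j \<longleftrightarrow> (\<forall>e \<in> X j. \<delta> j e = \<zero>\<^bsub>E (Suc j)\<^esub> \<longrightarrow>
    (\<exists>t \<in> carrier R - p. t \<odot>\<^bsub>E j\<^esub> e \<in> boundaries X j))"

lemma acyclic_atE:
  assumes "acyclic_at X j" "e \<in> X j" "\<delta> j e = \<zero>\<^bsub>E (Suc j)\<^esub>"
  obtains t where "t \<in> carrier R" "t \<notin> p" "t \<odot>\<^bsub>E j\<^esub> e \<in> boundaries X j"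
  using assms unfolding acyclic_at_def by blast

end

text \<open>In the applications \<open>X k j\<close> consists of the elements of \<open>E j\<close>, possibly with an extra torsion
  condition, that are annihilated by \<open>z 0, \<dots>, z (k - 1)\<close>.\<close>

locale divisible_tower = module_complex R p E \<delta>
  for R :: "('a, 'm) ring_scheme" (structure) and p and E :: "nat \<Rightarrow> ('a, 'e) module" and \<delta> +
  fixes X :: "nat \<Rightarrow> nat \<Rightarrow> 'e set" and z :: "nat \<Rightarrow> 'a" and c :: nat
  assumes X: "subcomplex (X k)"
    and z: "k < c \<Longrightarrow> z k \<in> carrier R"
    and X_Suc: "k < c \<Longrightarrow> X (Suc k) j = {e \<in> X k j. z k \<odot>\<^bsub>E j\<^esub> e = \<zero>\<^bsub>E j\<^esub>}"
    and div: "k < c \<Longrightarrow> f \<in> X k j \<Longrightarrow> \<exists>t \<in> carrier R - p. \<exists>g \<in> X k j. t \<odot>\<^bsub>E j\<^esub> f = z k \<odot>\<^bsub>E j\<^esub> g"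
begin

lemmas XD = subcomplexD[OF X] and XB = boundariesD[OF X] and X_diff = subcomplex_diff[OF X]

lemma mult_p: "s \<in> carrier R \<Longrightarrow> s \<notin> p \<Longrightarrow> t \<in> carrier R \<Longrightarrow> t \<notin> p \<Longrightarrow> s \<otimes> t \<notin> p"
  using prime_compl_mult[OF p, of s t] by blast

lemma one_p: "\<one> \<notin> p"
  by (rule prime_one[OF p])

lemma boundary_divisible:
  assumes k: "k < c" and b: "b \<in> boundaries (X k) i"
  obtains t b' where "t \<in> carrier R" "t \<notin> p" "b' \<in> boundaries (X k) i" "t \<odot>\<^bsub>E i\<^esub> b = z k \<odot>\<^bsub>E i\<^esub> b'"
proof (cases i)
  case 0
  show ?thesis
  proof (rule that[of \<one> "\<zero>\<^bsub>E i\<^esub>"])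
    show "\<zero>\<^bsub>E i\<^esub> \<in> boundaries (X k) i" by (rule XB(2))
    show "\<one> \<odot>\<^bsub>E i\<^esub> b = z k \<odot>\<^bsub>E i\<^esub> \<zero>\<^bsub>E i\<^esub>" using b 0 z[OF k] by simp
  qed (use one_p in auto)
next
  case (Suc j)
  then obtain f where f: "b = \<delta> j f" "f \<in> X k j" using b by auto
  obtain t g where t: "t \<in> carrier R - p" "g \<in> X k j" "t \<odot>\<^bsub>E j\<^esub> f = z k \<odot>\<^bsub>E j\<^esub> g" using div[OF k f(2)] by blast
  have "t \<odot>\<^bsub>E i\<^esub> b = \<delta> j (t \<odot>\<^bsub>E j\<^esub> f)" using f(1) t(1) XD(1)[OF f(2)] Suc by (simp add: d_smult)
  also have "\<dots> = z k \<odot>\<^bsub>E i\<^esub> \<delta> j g" unfolding t(3) using z[OF k] XD(1)[OF t(2)] Suc by (simp add: d_smult)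
  finally show ?thesis using that[of t "\<delta> j g"] t Suc by auto
qed

text \<open>Boundaries can be divided by \<open>z k\<close> up to a factor outside \<open>p\<close>.
  A multiple of z_k x that is a boundary is thus, up to such a factor, z_k times a boundary b, and
  subtracting b from the matching multiple of x leaves an element annihilated by z_k.\<close>

lemma annihilate_next:
  assumes k: "k < c" and x: "x \<in> X k j"
    and s: "s \<in> carrier R" "s \<notin> p" "s \<odot>\<^bsub>E j\<^esub> (z k \<odot>\<^bsub>E j\<^esub> x) \<in> boundaries (X k) j"
  obtains t b where "t \<in> carrier R" "t \<notin> p" "b \<in> boundaries (X k) j" "t \<odot>\<^bsub>E j\<^esub> x \<ominus>\<^bsub>E j\<^esub> b \<in> X (Suc k) j"
proof -
  note zk = z[OF k]
  have xc: "x \<in> carrier (E j)" by (rule XD(1)[OF x])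
  obtain r b where r: "r \<in> carrier R" "r \<notin> p" "b \<in> boundaries (X k) j"
    "r \<odot>\<^bsub>E j\<^esub> (s \<odot>\<^bsub>E j\<^esub> (z k \<odot>\<^bsub>E j\<^esub> x)) = z k \<odot>\<^bsub>E j\<^esub> b"
    by (rule boundary_divisible[OF k s(3)])
  have bc: "b \<in> carrier (E j)" by (rule XB(6)[OF r(3)])
  let ?y = "(r \<otimes> s) \<odot>\<^bsub>E j\<^esub> x \<ominus>\<^bsub>E j\<^esub> b"
  have "z k \<odot>\<^bsub>E j\<^esub> ?y = z k \<odot>\<^bsub>E j\<^esub> ((r \<otimes> s) \<odot>\<^bsub>E j\<^esub> x) \<ominus>\<^bsub>E j\<^esub> z k \<odot>\<^bsub>E j\<^esub> b"
    using zk r(1) s(1) xc bc by (simp add: E.smult_diff_right)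
  also have "z k \<odot>\<^bsub>E j\<^esub> ((r \<otimes> s) \<odot>\<^bsub>E j\<^esub> x) = r \<odot>\<^bsub>E j\<^esub> (s \<odot>\<^bsub>E j\<^esub> (z k \<odot>\<^bsub>E j\<^esub> x))"
    using zk r(1) s(1) xc by (simp add: E.smult_assoc1[symmetric] m_ac)
  also have "\<dots> \<ominus>\<^bsub>E j\<^esub> z k \<odot>\<^bsub>E j\<^esub> b = \<zero>\<^bsub>E j\<^esub>" unfolding r(4) using zk bc by (simp add: E.diff_eq_zero_iff)
  finally have "?y \<in> X (Suc k) j"
    using X_Suc[OF k] X_diff[OF XD(4)[OF _ x] XB(1)[OF r(3)], of "r \<otimes> s"] r(1) s(1) by simp
  then show thesis using that[of "r \<otimes> s" b] mult_p[OF r(1,2) s(1,2)] r(1,3) s(1) by simp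
qed

text \<open>Locally at \<open>p\<close>, multiplication by \<open>z k\<close> on \<open>X k\<close>
  is surjective with kernel \<open>X (Suc k)\<close>. In the long exact sequence, vanishing of the
  cohomology of \<open>X k\<close> in degree j - 1 makes the map from H^j of
  \<open>X (Suc k)\<close> to H^j of \<open>X k\<close> injective.\<close>

lemma boundary_lift:
  assumes k: "k < c" and e: "e \<in> X (Suc k) j" "e \<in> boundaries (X k) j"
    and ac: "\<And>i. j = Suc i \<Longrightarrow> acyclic_at (X k) i"
  shows "\<exists>t \<in> carrier R - p. t \<odot>\<^bsub>E j\<^esub> e \<in> boundaries (X (Suc k)) j"
proof (cases j)
  case 0
  then have "\<one> \<odot>\<^bsub>E j\<^esub> e \<in> boundaries (X (Suc k)) j" using e by simp
  then show ?thesis using prime_compl_one[OF p] by blast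
next
  case (Suc i)
  note zk = z[OF k]
  obtain f where f: "e = \<delta> i f" "f \<in> X k i" using e Suc by auto
  have fc: "f \<in> carrier (E i)" by (rule XD(1)[OF f(2)])
  have ze: "z k \<odot>\<^bsub>E j\<^esub> e = \<zero>\<^bsub>E j\<^esub>" using e(1) X_Suc[OF k] by blast
  let ?u = "z k \<odot>\<^bsub>E i\<^esub> f"
  have u: "?u \<in> X k i" using XD(4) zk f by blast
  have "\<delta> i ?u = \<zero>\<^bsub>E (Suc i)\<^esub>" using ze f fc zk Suc by (simp add: d_smult)
  with ac[OF Suc] u obtain t where t: "t \<in> carrier R" "t \<notin> p" "t \<odot>\<^bsub>E i\<^esub> ?u \<in> boundaries (X k) i" by (rule acyclic_atE)
  obtain q b where q: "q \<in> carrier R" "q \<notin> p" "b \<in> boundaries (X k) i" "q \<odot>\<^bsub>E i\<^esub> f \<ominus>\<^bsub>E i\<^esub> b \<in> X (Suc k) i"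
    by (rule annihilate_next[OF k f(2) t])
  have "\<delta> i (q \<odot>\<^bsub>E i\<^esub> f \<ominus>\<^bsub>E i\<^esub> b) = q \<odot>\<^bsub>E j\<^esub> e"
    using q(1) fc XB(5,6)[OF q(3)] f(1) Suc by (simp add: d_diff d_smult E.diff_zero)
  then have "q \<odot>\<^bsub>E j\<^esub> e \<in> boundaries (X (Suc k)) j" using q(4) Suc by force
  then show ?thesis using q by blast
qed

lemma X_subset_Suc: "k < c \<Longrightarrow> X (Suc k) j \<subseteq> X k j"
  using X_Suc by blast

lemma X_subset_0: "k \<le> c \<Longrightarrow> X k j \<subseteq> X 0 j"
proof (induction k)
  case (Suc k)
  then show ?case using X_subset_Suc[of k j] by auto
qed simp

text \<open>When H^j of \<open>X (Suc k)\<close> vanishes at \<open>p\<close>, multiplication by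
  \<open>z k\<close> is injective on H^j of \<open>X k\<close> there. As every element is also
  annihilated by a power of \<open>z k\<close>, nothing is left; the induction is on this
  power.\<close>

lemma acyclic_descend:
  assumes k: "k < c" and ac: "acyclic_at (X (Suc k)) j"
    and nil: "\<And>e. e \<in> X k j \<Longrightarrow> \<exists>n::nat. (z k [^] n) \<odot>\<^bsub>E j\<^esub> e = \<zero>\<^bsub>E j\<^esub>"
  shows "acyclic_at (X k) j"
proof -
  note zk = z[OF k]
  have "\<exists>t \<in> carrier R - p. t \<odot>\<^bsub>E j\<^esub> e \<in> boundaries (X k) j"
    if "e \<in> X k j" "\<delta> j e = \<zero>\<^bsub>E (Suc j)\<^esub>" "(z k [^] n) \<odot>\<^bsub>E j\<^esub> e = \<zero>\<^bsub>E j\<^esub>" for e and n :: nat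
    using that
  proof (induction n arbitrary: e)
    case 0
    then have "\<one> \<odot>\<^bsub>E j\<^esub> e \<in> boundaries (X k) j" using XD(1)[OF 0(1)] XB(2)[where j = j] by simp
    then show ?case using prime_compl_one[OF p] by blast
  next
    case (Suc n)
    have ec: "e \<in> carrier (E j)" by (rule XD(1)[OF Suc.prems(1)])
    let ?e = "z k \<odot>\<^bsub>E j\<^esub> e"
    have "(z k [^] n) \<odot>\<^bsub>E j\<^esub> ?e = \<zero>\<^bsub>E j\<^esub>" using Suc.prems(3) zk ec by (simp add: E.smult_assoc1[symmetric])
    then obtain t where t: "t \<in> carrier R - p" "t \<odot>\<^bsub>E j\<^esub> ?e \<in> boundaries (X k) j"
      using Suc.IH[OF XD(4)[OF zk Suc.prems(1)]] Suc.prems(2) zk ec by (auto simp: d_smult)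
    have tc: "t \<in> carrier R" "t \<notin> p" using t by auto
    obtain q b where q: "q \<in> carrier R" "q \<notin> p" "b \<in> boundaries (X k) j" "q \<odot>\<^bsub>E j\<^esub> e \<ominus>\<^bsub>E j\<^esub> b \<in> X (Suc k) j"
      by (rule annihilate_next[OF k Suc.prems(1) tc t(2)])
    have bc: "b \<in> carrier (E j)" by (rule XB(6)[OF q(3)])
    let ?f = "q \<odot>\<^bsub>E j\<^esub> e \<ominus>\<^bsub>E j\<^esub> b"
    have "\<delta> j ?f = \<zero>\<^bsub>E (Suc j)\<^esub>"
      using q(1) ec bc XB(5)[OF q(3)] Suc.prems(2) by (simp add: d_diff d_smult E.diff_zero)
    with ac q(4) obtain r where r: "r \<in> carrier R" "r \<notin> p" "r \<odot>\<^bsub>E j\<^esub> ?f \<in> boundaries (X (Suc k)) j" by (rule acyclic_atE)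
    then have "r \<odot>\<^bsub>E j\<^esub> ?f \<in> boundaries (X k) j" using boundaries_mono[of "X (Suc k)" "X k", OF X_subset_Suc[OF k]] by blast
    then have "r \<odot>\<^bsub>E j\<^esub> ?f \<oplus>\<^bsub>E j\<^esub> r \<odot>\<^bsub>E j\<^esub> b \<in> boundaries (X k) j" using XB(3,4) r(1) q(3) by blast
    moreover have "r \<odot>\<^bsub>E j\<^esub> ?f \<oplus>\<^bsub>E j\<^esub> r \<odot>\<^bsub>E j\<^esub> b = (r \<otimes> q) \<odot>\<^bsub>E j\<^esub> e"
      using r(1) q(1) ec bc
      by (simp add: E.smult_r_distr E.smult_r_minus E.smult_assoc1 E.M.minus_eq E.M.a_assoc E.M.l_neg)
    ultimately show ?case using mult_p[OF r(1,2) q(1,2)] r(1) q(1) by (intro bexI[of _ "r \<otimes> q"]) auto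
  qed
  then show ?thesis unfolding acyclic_at_def using nil by blast
qed

lemma boundary_lift_tower:
  assumes "k \<le> c" and ac: "\<And>i l. j = Suc i \<Longrightarrow> l < c \<Longrightarrow> acyclic_at (X l) i"
  shows "u \<in> X k j \<Longrightarrow> u \<in> boundaries (X 0) j \<Longrightarrow> \<exists>t \<in> carrier R - p. t \<odot>\<^bsub>E j\<^esub> u \<in> boundaries (X k) j"
  using assms(1)
proof (induction k arbitrary: u)
  case 0
  then have "\<one> \<odot>\<^bsub>E j\<^esub> u \<in> boundaries (X 0) j" using XD(1)[OF 0(1)] by simp
  then show ?case using prime_compl_one[OF p] by blast
next
  case (Suc k)
  then have k: "k < c" by simp
  have uk: "u \<in> X k j" using X_subset_Suc[OF k] Suc.prems(1) by blast
  obtain t where t: "t \<in> carrier R - p" "t \<odot>\<^bsub>E j\<^esub> u \<in> boundaries (X k) j" using Suc.IH[OF uk Suc.prems(2)] k by auto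
  have "t \<odot>\<^bsub>E j\<^esub> u \<in> X (Suc k) j" using XD(4) t Suc.prems(1) by blast
  then obtain s where s: "s \<in> carrier R - p" "s \<odot>\<^bsub>E j\<^esub> (t \<odot>\<^bsub>E j\<^esub> u) \<in> boundaries (X (Suc k)) j"
    using boundary_lift[OF k _ t(2) ac] k by blast
  have "(s \<otimes> t) \<odot>\<^bsub>E j\<^esub> u \<in> boundaries (X (Suc k)) j" using s t XD(1)[OF uk] by (simp add: E.smult_assoc1)
  then show ?case using prime_compl_mult[OF p s(1) t(1)] by blast
qed

text \<open>Corrections by boundaries make the element annihilated by one \<open>z k\<close> after
  the other. The correction for \<open>z k\<close> has to come from \<open>X k\<close>, so as not to
  spoil the earlier ones; \<open>boundary_lift_tower\<close> ensures this.\<close>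

lemma representative:
  assumes "k \<le> c" and ac: "\<And>i l. j = Suc i \<Longrightarrow> l < c \<Longrightarrow> acyclic_at (X l) i"
    and e: "e \<in> X 0 j" and ze: "\<And>l. l < c \<Longrightarrow> z l \<odot>\<^bsub>E j\<^esub> e \<in> boundaries (X 0) j"
  shows "\<exists>t \<in> carrier R - p. \<exists>b \<in> boundaries (X 0) j. t \<odot>\<^bsub>E j\<^esub> e \<ominus>\<^bsub>E j\<^esub> b \<in> X k j"
  using assms(1)
proof (induction k)
  case 0
  have "\<one> \<odot>\<^bsub>E j\<^esub> e \<ominus>\<^bsub>E j\<^esub> \<zero>\<^bsub>E j\<^esub> \<in> X 0 j" using e XD(1)[OF e] by (simp add: E.diff_zero)
  then show ?case using prime_compl_one[OF p] XB(2) by blast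
next
  case (Suc k)
  then have k: "k < c" by simp
  note zk = z[OF k]
  obtain t b where t: "t \<in> carrier R" "t \<notin> p" "b \<in> boundaries (X 0) j" "t \<odot>\<^bsub>E j\<^esub> e \<ominus>\<^bsub>E j\<^esub> b \<in> X k j"
    using Suc.IH k by auto
  have ec: "e \<in> carrier (E j)" and bc: "b \<in> carrier (E j)" by (rule XD(1)[OF e], rule XB(6)[OF t(3)])
  define e' where "e' = t \<odot>\<^bsub>E j\<^esub> e \<ominus>\<^bsub>E j\<^esub> b"
  have e'c: "e' \<in> carrier (E j)" using XD(1) t(4) by (simp add: e'_def)
  have "z k \<odot>\<^bsub>E j\<^esub> e' = z k \<odot>\<^bsub>E j\<^esub> (t \<odot>\<^bsub>E j\<^esub> e) \<ominus>\<^bsub>E j\<^esub> z k \<odot>\<^bsub>E j\<^esub> b"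
    unfolding e'_def using zk t(1) ec bc by (simp add: E.smult_diff_right)
  also have "\<dots> = t \<odot>\<^bsub>E j\<^esub> (z k \<odot>\<^bsub>E j\<^esub> e) \<oplus>\<^bsub>E j\<^esub> (\<ominus> z k) \<odot>\<^bsub>E j\<^esub> b"
    using zk t(1) ec bc E.smult_lcomm[of t "z k" e j] by (simp add: E.M.minus_eq E.smult_l_minus)
  also have "\<dots> \<in> boundaries (X 0) j"
    using XB(3)[OF XB(4)[OF t(1) ze[OF k]] XB(4)[OF _ t(3)]] zk by simp
  finally have 1: "z k \<odot>\<^bsub>E j\<^esub> e' \<in> boundaries (X 0) j" .
  have "z k \<odot>\<^bsub>E j\<^esub> e' \<in> X k j" using XD(4) zk t(4) by (simp add: e'_def)
  then obtain s where s: "s \<in> carrier R" "s \<notin> p" "s \<odot>\<^bsub>E j\<^esub> (z k \<odot>\<^bsub>E j\<^esub> e') \<in> boundaries (X k) j"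
    using boundary_lift_tower[OF _ ac _ 1, of k] k by auto
  obtain q b' where q: "q \<in> carrier R" "q \<notin> p" "b' \<in> boundaries (X k) j" "q \<odot>\<^bsub>E j\<^esub> e' \<ominus>\<^bsub>E j\<^esub> b' \<in> X (Suc k) j"
    by (rule annihilate_next[OF k t(4)[folded e'_def] s])
  have b'c: "b' \<in> carrier (E j)" by (rule XB(6)[OF q(3)])
  have X0: "X k j' \<subseteq> X 0 j'" for j'
    using X_subset_0 k by simp
  have b'0: "b' \<in> boundaries (X 0) j" using boundaries_mono[of "X k" "X 0", OF X0] q(3) by blast
  have "q \<odot>\<^bsub>E j\<^esub> e' \<ominus>\<^bsub>E j\<^esub> b' = (q \<otimes> t) \<odot>\<^bsub>E j\<^esub> e \<ominus>\<^bsub>E j\<^esub> (q \<odot>\<^bsub>E j\<^esub> b \<oplus>\<^bsub>E j\<^esub> b')"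
    unfolding e'_def using q(1) t(1) ec bc b'c
    by (simp add: E.smult_r_distr E.smult_r_minus E.smult_assoc1 E.M.minus_eq E.M.minus_add E.M.a_assoc)
  moreover have "q \<odot>\<^bsub>E j\<^esub> b \<oplus>\<^bsub>E j\<^esub> b' \<in> boundaries (X 0) j" by (rule XB(3)[OF XB(4)[OF q(1) t(3)] b'0])
  moreover have "q \<otimes> t \<in> carrier R - p" using mult_p[OF q(1,2) t(1,2)] q(1) t(1) by simp
  ultimately show ?case using q(4) by metis
qed

end


section \<open>Koszul cohomology\<close>

text \<open>For the elements annihilated by \<open>I k\<close> in an injective resolution E of R,
  the complex \<open>X k\<close> is Hom(R/I_k, E), with cohomology Ext(R/I_k, R). The assumptions
  are stated so that they also apply inside the torsion of E.\<close>

locale koszul_tower = divisible_tower R p E \<delta> X z c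
  for R :: "('a, 'm) ring_scheme" (structure) and p and E :: "nat \<Rightarrow> ('a, 'e) module" and \<delta> X z c +
  fixes I :: "nat \<Rightarrow> 'a set"
  assumes I: "k \<le> c \<Longrightarrow> ideal (I k) R"
    and I_Suc: "k < c \<Longrightarrow> I (Suc k) = adjoin (I k) (z k)"
    and killed: "k \<le> c \<Longrightarrow> a \<in> I k \<Longrightarrow> e \<in> X k j \<Longrightarrow> a \<odot>\<^bsub>E j\<^esub> e = \<zero>\<^bsub>E j\<^esub>"
    and reg: "k < c \<Longrightarrow> r \<in> carrier R \<Longrightarrow> r \<otimes> z k \<in> I k \<Longrightarrow> r \<in> sat p (I k)"
begin

text \<open>Locally at \<open>p\<close>, H^k of \<open>X k\<close> is isomorphic to R/I_k, with the
  class of \<open>w\<close> corresponding to 1. That \<open>I k\<close> annihilates this class is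
  the assumption \<open>killed\<close>.\<close>

definition generator :: "nat \<Rightarrow> 'e \<Rightarrow> bool" where
  "generator k w \<longleftrightarrow> w \<in> X k k \<and> \<delta> k w = \<zero>\<^bsub>E (Suc k)\<^esub> \<and>
    (\<forall>e \<in> X k k. \<delta> k e = \<zero>\<^bsub>E (Suc k)\<^esub> \<longrightarrow>
      (\<exists>t \<in> carrier R - p. \<exists>r \<in> carrier R. \<exists>b \<in> boundaries (X k) k. t \<odot>\<^bsub>E k\<^esub> e = r \<odot>\<^bsub>E k\<^esub> w \<oplus>\<^bsub>E k\<^esub> b)) \<and>
    (\<forall>r \<in> carrier R. r \<odot>\<^bsub>E k\<^esub> w \<in> boundaries (X k) k \<longrightarrow> r \<in> sat p (I k))"

lemma generatorE:
  assumes "generator k w" "e \<in> X k k" "\<delta> k e = \<zero>\<^bsub>E (Suc k)\<^esub>"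
  obtains t r b where "t \<in> carrier R" "t \<notin> p" "r \<in> carrier R" "b \<in> boundaries (X k) k"
    "t \<odot>\<^bsub>E k\<^esub> e = r \<odot>\<^bsub>E k\<^esub> w \<oplus>\<^bsub>E k\<^esub> b"
  using assms unfolding generator_def by blast

lemma generatorD:
  assumes "generator k w"
  shows "w \<in> X k k" "\<delta> k w = \<zero>\<^bsub>E (Suc k)\<^esub>" "w \<in> carrier (E k)"
    "r \<in> carrier R \<Longrightarrow> r \<odot>\<^bsub>E k\<^esub> w \<in> boundaries (X k) k \<Longrightarrow> r \<in> sat p (I k)"
  using assms XD(1) unfolding generator_def by blast+

text \<open>By the long exact sequence at \<open>p\<close>, H^j of \<open>X (Suc k)\<close> embeds
  into H^j of \<open>X k\<close> when j is not k + 1. For j = k the target is R/I_k; the image is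
  annihilated by the nonzerodivisor \<open>z k\<close> and so vanishes.\<close>

lemma acyclic_step:
  assumes k: "k < c" and ac: "\<And>j. j \<noteq> k \<Longrightarrow> acyclic_at (X k) j" and w: "generator k w" and j: "j \<noteq> Suc k"
  shows "acyclic_at (X (Suc k)) j"
  unfolding acyclic_at_def
proof (intro ballI impI)
  fix e assume e: "e \<in> X (Suc k) j" "\<delta> j e = \<zero>\<^bsub>E (Suc j)\<^esub>"
  note zk = z[OF k]
  have ek: "e \<in> X k j" and ze: "z k \<odot>\<^bsub>E j\<^esub> e = \<zero>\<^bsub>E j\<^esub>" using X_Suc[OF k] e(1) by auto
  have ec: "e \<in> carrier (E j)" by (rule XD(1)[OF ek])
  obtain t where t: "t \<in> carrier R" "t \<notin> p" "t \<odot>\<^bsub>E j\<^esub> e \<in> boundaries (X k) j"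
  proof (cases "j = k")
    case False
    show thesis by (rule acyclic_atE[OF ac[OF False] ek e(2)]) (rule that)
  next
    case True
    note [simp] = True
    have ek': "e \<in> X k k" "\<delta> k e = \<zero>\<^bsub>E (Suc k)\<^esub>" using ek e(2) by simp_all
    obtain t r b where t: "t \<in> carrier R" "t \<notin> p" "r \<in> carrier R" "b \<in> boundaries (X k) k"
      "t \<odot>\<^bsub>E k\<^esub> e = r \<odot>\<^bsub>E k\<^esub> w \<oplus>\<^bsub>E k\<^esub> b" by (rule generatorE[OF w ek'])
    have wc: "w \<in> carrier (E k)" and bc: "b \<in> carrier (E k)" by (rule generatorD(3)[OF w], rule XB(6)[OF t(4)])
    have "t \<odot>\<^bsub>E k\<^esub> (z k \<odot>\<^bsub>E k\<^esub> e) = z k \<odot>\<^bsub>E k\<^esub> (t \<odot>\<^bsub>E k\<^esub> e)"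
      using E.smult_lcomm[OF t(1) zk] ec by simp
    also have "\<dots> = (r \<otimes> z k) \<odot>\<^bsub>E k\<^esub> w \<oplus>\<^bsub>E k\<^esub> z k \<odot>\<^bsub>E k\<^esub> b"
      unfolding t(5) using t(3) zk wc bc by (simp add: E.smult_r_distr E.smult_assoc1[symmetric] m_comm)
    finally have "(r \<otimes> z k) \<odot>\<^bsub>E k\<^esub> w \<oplus>\<^bsub>E k\<^esub> z k \<odot>\<^bsub>E k\<^esub> b = \<zero>\<^bsub>E k\<^esub>" using ze t(1) by simp
    then have "(r \<otimes> z k) \<odot>\<^bsub>E k\<^esub> w = \<ominus>\<^bsub>E k\<^esub> (z k \<odot>\<^bsub>E k\<^esub> b)"
      using E.M.minus_equality[where y = "(r \<otimes> z k) \<odot>\<^bsub>E k\<^esub> w" and i = k and x = "z k \<odot>\<^bsub>E k\<^esub> b"] t(3) zk wc bc by simp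
    also have "\<dots> = (\<ominus> z k) \<odot>\<^bsub>E k\<^esub> b" using zk bc by (simp add: E.smult_l_minus)
    also have "\<dots> \<in> boundaries (X k) k" using XB(4)[OF _ t(4)] zk by simp
    finally have "r \<otimes> z k \<in> sat p (I k)" using generatorD(4)[OF w] t(3) zk by simp
    then obtain s where s: "s \<in> carrier R" "s \<notin> p" "s \<otimes> (r \<otimes> z k) \<in> I k" by (rule satE)
    then have "s \<otimes> r \<in> sat p (I k)" using reg[OF k, of "s \<otimes> r"] t(3) zk by (simp add: m_assoc)
    then obtain u where u: "u \<in> carrier R" "u \<notin> p" "u \<otimes> (s \<otimes> r) \<in> I k" by (rule satE)
    have "((u \<otimes> s) \<otimes> t) \<odot>\<^bsub>E k\<^esub> e = (u \<otimes> s) \<odot>\<^bsub>E k\<^esub> (t \<odot>\<^bsub>E k\<^esub> e)" using u(1) s(1) t(1) ec by (simp add: E.smult_assoc1)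
    also have "\<dots> = (u \<otimes> (s \<otimes> r)) \<odot>\<^bsub>E k\<^esub> w \<oplus>\<^bsub>E k\<^esub> (u \<otimes> s) \<odot>\<^bsub>E k\<^esub> b"
      unfolding t(5) using u(1) s(1) t(3) wc bc by (simp add: E.smult_r_distr E.smult_assoc1)
    also have "(u \<otimes> (s \<otimes> r)) \<odot>\<^bsub>E k\<^esub> w = \<zero>\<^bsub>E k\<^esub>" using killed[OF _ u(3) generatorD(1)[OF w]] k by simp
    finally have "((u \<otimes> s) \<otimes> t) \<odot>\<^bsub>E k\<^esub> e = (u \<otimes> s) \<odot>\<^bsub>E k\<^esub> b" using u(1) s(1) bc by simp
    also have "\<dots> \<in> boundaries (X k) k" using XB(4)[OF _ t(4), of "u \<otimes> s"] u s by simp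
    finally show thesis
      using that[of "(u \<otimes> s) \<otimes> t"] mult_p[OF _ mult_p[OF u(1,2) s(1,2)] t(1,2)] u(1) s(1) t(1) by simp
  qed
  have te: "t \<odot>\<^bsub>E j\<^esub> e \<in> X (Suc k) j" using XD(4) t(1) e(1) by blast
  have ac': "acyclic_at (X k) i" if "j = Suc i" for i using ac j that by auto
  obtain s where s: "s \<in> carrier R - p" "s \<odot>\<^bsub>E j\<^esub> (t \<odot>\<^bsub>E j\<^esub> e) \<in> boundaries (X (Suc k)) j"
    using boundary_lift[OF k te t(3) ac'] by blast
  have "(s \<otimes> t) \<odot>\<^bsub>E j\<^esub> e \<in> boundaries (X (Suc k)) j" using s t(1) ec by (simp add: E.smult_assoc1)
  moreover have "s \<otimes> t \<in> carrier R - p" using mult_p s t by simp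
  ultimately show "\<exists>t \<in> carrier R - p. t \<odot>\<^bsub>E j\<^esub> e \<in> boundaries (X (Suc k)) j" by blast
qed

text \<open>As H^(k+1) of \<open>X k\<close> vanishes at \<open>p\<close>, the connecting
  homomorphism identifies H^(k+1) of \<open>X (Suc k)\<close> with the cokernel of
  \<open>z k\<close> on R/I_k, which is R/I_(k+1).\<close>

lemma generator_step:
  assumes k: "k < c" and ac: "acyclic_at (X k) (Suc k)" and w: "generator k w"
  shows "\<exists>w. generator (Suc k) w"
proof -
  note zk = z[OF k] and W = generatorD[OF w]
  obtain a v where a: "a \<in> carrier R" "a \<notin> p" "v \<in> X k k" "a \<odot>\<^bsub>E k\<^esub> w = z k \<odot>\<^bsub>E k\<^esub> v"
    using div[OF k W(1)] by auto
  have vc: "v \<in> carrier (E k)" by (rule XD(1)[OF a(3)])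
  \<comment> \<open>The connecting homomorphism applied to \<open>w\<close>: divide by
    \<open>z k\<close>, up to the factor a outside \<open>p\<close>, then take the
    differential.\<close>
  define w' where "w' = \<delta> k v"
  have w'c: "w' \<in> carrier (E (Suc k))" unfolding w'_def using vc by simp
  have "z k \<odot>\<^bsub>E (Suc k)\<^esub> w' = \<delta> k (a \<odot>\<^bsub>E k\<^esub> w)" unfolding w'_def a(4) using zk vc by (simp add: d_smult)
  also have "\<dots> = \<zero>\<^bsub>E (Suc k)\<^esub>" using a(1) W(2,3) by (simp add: d_smult)
  finally have w'X: "w' \<in> X (Suc k) (Suc k)" using X_Suc[OF k] XD(5)[OF a(3)] by (simp add: w'_def)
  \<comment> \<open>Surjectivity of the connecting homomorphism: a multiple of e is the boundary of
    some f in \<open>X k\<close>, and z_k f is a cocycle that can be compared with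
    \<open>w\<close>.\<close>
  have gen: "\<exists>t \<in> carrier R - p. \<exists>r \<in> carrier R. \<exists>b \<in> boundaries (X (Suc k)) (Suc k).
      t \<odot>\<^bsub>E (Suc k)\<^esub> e = r \<odot>\<^bsub>E (Suc k)\<^esub> w' \<oplus>\<^bsub>E (Suc k)\<^esub> b"
    if e: "e \<in> X (Suc k) (Suc k)" "\<delta> (Suc k) e = \<zero>\<^bsub>E (Suc (Suc k))\<^esub>" for e
  proof -
    have ek: "e \<in> X k (Suc k)" and ze: "z k \<odot>\<^bsub>E (Suc k)\<^esub> e = \<zero>\<^bsub>E (Suc k)\<^esub>" using X_Suc[OF k] e(1) by auto
    have ec: "e \<in> carrier (E (Suc k))" by (rule XD(1)[OF ek])
    obtain t where t: "t \<in> carrier R" "t \<notin> p" "t \<odot>\<^bsub>E (Suc k)\<^esub> e \<in> boundaries (X k) (Suc k)"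
      using ac ek e(2) by (rule acyclic_atE)
    then obtain f where f: "t \<odot>\<^bsub>E (Suc k)\<^esub> e = \<delta> k f" "f \<in> X k k" by auto
    have fc: "f \<in> carrier (E k)" by (rule XD(1)[OF f(2)])
    have zf: "z k \<odot>\<^bsub>E k\<^esub> f \<in> X k k" by (rule XD(4)[OF zk f(2)])
    have "\<delta> k (z k \<odot>\<^bsub>E k\<^esub> f) = z k \<odot>\<^bsub>E (Suc k)\<^esub> (t \<odot>\<^bsub>E (Suc k)\<^esub> e)" unfolding f(1) using zk fc by (simp add: d_smult)
    also have "\<dots> = t \<odot>\<^bsub>E (Suc k)\<^esub> (z k \<odot>\<^bsub>E (Suc k)\<^esub> e)" by (rule E.smult_lcomm[OF zk t(1) ec])
    finally have dz: "\<delta> k (z k \<odot>\<^bsub>E k\<^esub> f) = \<zero>\<^bsub>E (Suc k)\<^esub>" unfolding ze using t(1) by simp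
    obtain s r b where s: "s \<in> carrier R" "s \<notin> p" "r \<in> carrier R" "b \<in> boundaries (X k) k"
      "s \<odot>\<^bsub>E k\<^esub> (z k \<odot>\<^bsub>E k\<^esub> f) = r \<odot>\<^bsub>E k\<^esub> w \<oplus>\<^bsub>E k\<^esub> b" by (rule generatorE[OF w zf dz])
    obtain u b' where u: "u \<in> carrier R" "u \<notin> p" "b' \<in> boundaries (X k) k" "u \<odot>\<^bsub>E k\<^esub> b = z k \<odot>\<^bsub>E k\<^esub> b'"
      by (rule boundary_divisible[OF k s(4)])
    have bc: "b \<in> carrier (E k)" and b'c: "b' \<in> carrier (E k)" by (rule XB(6)[OF s(4)], rule XB(6)[OF u(3)])
    let ?q = "(a \<otimes> u) \<otimes> s"
    let ?y = "(u \<otimes> r) \<odot>\<^bsub>E k\<^esub> v \<oplus>\<^bsub>E k\<^esub> a \<odot>\<^bsub>E k\<^esub> b'"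
    have "z k \<odot>\<^bsub>E k\<^esub> (?q \<odot>\<^bsub>E k\<^esub> f) = (a \<otimes> u) \<odot>\<^bsub>E k\<^esub> (s \<odot>\<^bsub>E k\<^esub> (z k \<odot>\<^bsub>E k\<^esub> f))"
      using zk a(1) u(1) s(1) fc by (simp add: E.smult_assoc1[symmetric] m_ac)
    also have "\<dots> = (u \<otimes> r) \<odot>\<^bsub>E k\<^esub> (a \<odot>\<^bsub>E k\<^esub> w) \<oplus>\<^bsub>E k\<^esub> a \<odot>\<^bsub>E k\<^esub> (u \<odot>\<^bsub>E k\<^esub> b)"
      unfolding s(5) using a(1) u(1) s(3) W(3) bc
      by (simp add: E.smult_r_distr E.smult_assoc1[symmetric] m_ac)
    also have "\<dots> = z k \<odot>\<^bsub>E k\<^esub> ?y"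
      unfolding a(4) u(4) using zk a(1) u(1) s(3) vc b'c
      by (simp add: E.smult_r_distr E.smult_assoc1[symmetric] m_ac)
    finally have e1: "z k \<odot>\<^bsub>E k\<^esub> (?q \<odot>\<^bsub>E k\<^esub> f) = z k \<odot>\<^bsub>E k\<^esub> ?y" .
    have yX: "?y \<in> X k k" using XD(3)[OF XD(4)[OF _ a(3)] XD(4)[OF a(1) XB(1)[OF u(3)]], of "u \<otimes> r"] u s by simp
    have yc: "?y \<in> carrier (E k)" by (rule XD(1)[OF yX])
    have qc: "?q \<in> carrier R" using a(1) u(1) s(1) by simp
    let ?f = "?q \<odot>\<^bsub>E k\<^esub> f \<ominus>\<^bsub>E k\<^esub> ?y"
    have "z k \<odot>\<^bsub>E k\<^esub> ?f = z k \<odot>\<^bsub>E k\<^esub> (?q \<odot>\<^bsub>E k\<^esub> f) \<ominus>\<^bsub>E k\<^esub> z k \<odot>\<^bsub>E k\<^esub> ?y"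
      by (rule E.smult_diff_right[OF zk _ yc]) (use qc fc in simp)
    also have "\<dots> = \<zero>\<^bsub>E k\<^esub>" unfolding e1 using E.diff_eq_zero_iff zk yc by blast
    finally have fX: "?f \<in> X (Suc k) k" using X_Suc[OF k] X_diff[OF XD(4)[OF qc f(2)] yX] by simp
    have "\<delta> k ?f = ?q \<odot>\<^bsub>E (Suc k)\<^esub> \<delta> k f \<ominus>\<^bsub>E (Suc k)\<^esub> \<delta> k ?y"
      using d_diff[OF _ yc] qc fc by (simp add: d_smult)
    also have "\<delta> k ?y = (u \<otimes> r) \<odot>\<^bsub>E (Suc k)\<^esub> w'"
      using a(1) u(1) s(3) vc b'c XB(5)[OF u(3)] by (simp add: d_add d_smult w'_def)
    finally have df: "\<delta> k ?f = (?q \<otimes> t) \<odot>\<^bsub>E (Suc k)\<^esub> e \<ominus>\<^bsub>E (Suc k)\<^esub> (u \<otimes> r) \<odot>\<^bsub>E (Suc k)\<^esub> w'"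
      unfolding f(1)[symmetric] using qc t(1) ec by (simp add: E.smult_assoc1)
    have c1: "(?q \<otimes> t) \<odot>\<^bsub>E (Suc k)\<^esub> e \<in> carrier (E (Suc k))" "(u \<otimes> r) \<odot>\<^bsub>E (Suc k)\<^esub> w' \<in> carrier (E (Suc k))"
      using qc t(1) ec u(1) s(3) w'c by simp_all
    have "(?q \<otimes> t) \<odot>\<^bsub>E (Suc k)\<^esub> e = (u \<otimes> r) \<odot>\<^bsub>E (Suc k)\<^esub> w' \<oplus>\<^bsub>E (Suc k)\<^esub> \<delta> k ?f"
      unfolding df using c1 by (simp add: E.M.minus_eq E.M.a_ac E.M.r_neg E.M.r_neg1 E.M.r_neg2)
    moreover have "\<delta> k ?f \<in> boundaries (X (Suc k)) (Suc k)" using fX by simp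
    moreover have "?q \<otimes> t \<in> carrier R - p"
      using mult_p[OF qc mult_p[OF _ mult_p[OF a(1,2) u(1,2)] s(1,2)] t(1,2)] qc a(1) u(1) t(1) by simp
    moreover have "u \<otimes> r \<in> carrier R" using u s by simp
    ultimately show ?thesis by blast
  qed
  \<comment> \<open>Injectivity: a relation r w' = \<delta> u makes r v - u a cocycle of
    \<open>X k\<close>. Expressing it by \<open>w\<close> and a boundary and multiplying by
    \<open>z k\<close> shows that r, up to factors outside \<open>p\<close>, lies in I_k +
    (z_k).\<close>
  have ann: "r \<in> sat p (I (Suc k))" if r: "r \<in> carrier R" "r \<odot>\<^bsub>E (Suc k)\<^esub> w' \<in> boundaries (X (Suc k)) (Suc k)" for r
  proof -
    obtain u where u: "r \<odot>\<^bsub>E (Suc k)\<^esub> w' = \<delta> k u" "u \<in> X (Suc k) k" using r(2) by auto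
    have uk: "u \<in> X k k" and zu: "z k \<odot>\<^bsub>E k\<^esub> u = \<zero>\<^bsub>E k\<^esub>" using X_Suc[OF k] u(2) by auto
    have uc: "u \<in> carrier (E k)" by (rule XD(1)[OF uk])
    let ?y = "r \<odot>\<^bsub>E k\<^esub> v \<ominus>\<^bsub>E k\<^esub> u"
    have y: "?y \<in> X k k" by (rule X_diff[OF XD(4)[OF r(1) a(3)] uk])
    have "\<delta> k ?y = r \<odot>\<^bsub>E (Suc k)\<^esub> w' \<ominus>\<^bsub>E (Suc k)\<^esub> \<delta> k u" using r(1) vc uc by (simp add: d_diff d_smult w'_def)
    also have "\<dots> = \<zero>\<^bsub>E (Suc k)\<^esub>" unfolding u(1) using uc by (simp add: E.diff_eq_zero_iff)
    finally have dy: "\<delta> k ?y = \<zero>\<^bsub>E (Suc k)\<^esub>" .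
    obtain t d b where t: "t \<in> carrier R" "t \<notin> p" "d \<in> carrier R" "b \<in> boundaries (X k) k"
      "t \<odot>\<^bsub>E k\<^esub> ?y = d \<odot>\<^bsub>E k\<^esub> w \<oplus>\<^bsub>E k\<^esub> b" by (rule generatorE[OF w y dy])
    have bc: "b \<in> carrier (E k)" by (rule XB(6)[OF t(4)])
    have "z k \<odot>\<^bsub>E k\<^esub> (t \<odot>\<^bsub>E k\<^esub> ?y) = t \<odot>\<^bsub>E k\<^esub> (z k \<odot>\<^bsub>E k\<^esub> ?y)"
      by (rule E.smult_lcomm[OF zk t(1) XD(1)[OF y]])
    also have "z k \<odot>\<^bsub>E k\<^esub> ?y = z k \<odot>\<^bsub>E k\<^esub> (r \<odot>\<^bsub>E k\<^esub> v) \<ominus>\<^bsub>E k\<^esub> z k \<odot>\<^bsub>E k\<^esub> u"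
      using zk r(1) vc uc by (simp add: E.smult_diff_right)
    also have "\<dots> = r \<odot>\<^bsub>E k\<^esub> (z k \<odot>\<^bsub>E k\<^esub> v)"
      unfolding zu using zk r(1) vc E.smult_lcomm[OF zk r(1) vc] by (simp add: E.diff_zero)
    also have "\<dots> = (r \<otimes> a) \<odot>\<^bsub>E k\<^esub> w" unfolding a(4)[symmetric] using r(1) a(1) W(3) by (simp add: E.smult_assoc1)
    also have "t \<odot>\<^bsub>E k\<^esub> \<dots> = ((t \<otimes> a) \<otimes> r) \<odot>\<^bsub>E k\<^esub> w"
      using r(1) a(1) t(1) W(3) by (simp add: E.smult_assoc1[symmetric] m_ac)
    finally have e1: "((t \<otimes> a) \<otimes> r) \<odot>\<^bsub>E k\<^esub> w = (z k \<otimes> d) \<odot>\<^bsub>E k\<^esub> w \<oplus>\<^bsub>E k\<^esub> z k \<odot>\<^bsub>E k\<^esub> b"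
      unfolding t(5) using zk t(3) W(3) bc by (simp add: E.smult_r_distr E.smult_assoc1)
    let ?h = "(t \<otimes> a) \<otimes> r \<ominus> z k \<otimes> d"
    have "?h \<odot>\<^bsub>E k\<^esub> w = ((t \<otimes> a) \<otimes> r) \<odot>\<^bsub>E k\<^esub> w \<ominus>\<^bsub>E k\<^esub> (z k \<otimes> d) \<odot>\<^bsub>E k\<^esub> w"
      using r(1) a(1) t(1,3) zk W(3) by (simp add: E.smult_diff_left)
    also have "\<dots> = z k \<odot>\<^bsub>E k\<^esub> b"
      unfolding e1 using zk t(3) W(3) bc
      by (simp add: E.M.minus_eq E.M.a_ac E.M.r_neg E.M.r_neg1 E.M.r_neg2)
    also have "\<dots> \<in> boundaries (X k) k" by (rule XB(4)[OF zk t(4)])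
    finally have "?h \<in> sat p (I k)" using W(4)[of ?h] r(1) a(1) t(1,3) zk by simp
    then obtain s where s: "s \<in> carrier R" "s \<notin> p" "s \<otimes> ?h \<in> I k" by (rule satE)
    have "(s \<otimes> (t \<otimes> a)) \<otimes> r = s \<otimes> ?h \<oplus> (s \<otimes> d) \<otimes> z k" using s(1) r(1) a(1) t(1,3) zk by algebra
    then have "(s \<otimes> (t \<otimes> a)) \<otimes> r \<in> I (Suc k)"
      unfolding I_Suc[OF k] adjoin_def using s(1,3) t(3) by blast
    then show ?thesis
      using mult_p[OF s(1,2) _ mult_p[OF t(1,2) a(1,2)]] s t a r by (intro satI[of _ "s \<otimes> (t \<otimes> a)"]) auto
  qed
  have "generator (Suc k) w'"
    unfolding generator_def using w'X gen ann d_d[OF vc] by (auto simp: w'_def)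
  then show ?thesis ..
qed

lemma koszul_cohomology:
  assumes "\<And>j. j \<noteq> 0 \<Longrightarrow> acyclic_at (X 0) j" "generator 0 w"
  shows "k \<le> c \<Longrightarrow> (\<forall>j. j \<noteq> k \<longrightarrow> acyclic_at (X k) j) \<and> (\<exists>w. generator k w)"
proof (induction k)
  case 0
  then show ?case using assms by blast
next
  case (Suc k)
  then have k: "k < c" by simp
  from Suc have IH: "\<And>j. j \<noteq> k \<Longrightarrow> acyclic_at (X k) j" and "\<exists>w. generator k w" by simp_all
  then obtain w where w: "generator k w" by (elim exE)
  have "acyclic_at (X (Suc k)) j" if "j \<noteq> Suc k" for j using acyclic_step[OF k IH w that] .
  moreover have "\<exists>w. generator (Suc k) w" by (rule generator_step[OF k IH[OF n_not_Suc_n[symmetric]] w])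
  ultimately show ?case by simp
qed

end


section \<open>Local cohomology\<close>

lemma (in cring) regular_seq_at_nth:
  "regular_seq_at p J zs \<Longrightarrow> k < length zs \<Longrightarrow> r \<in> carrier R \<Longrightarrow>
    r \<otimes> zs ! k \<in> adjoin_list J (take k zs) \<Longrightarrow> r \<in> sat p (adjoin_list J (take k zs))"
proof (induction zs arbitrary: J k)
  case (Cons z zs)
  then show ?case by (cases k) auto
qed simp

lemma (in abelian_group) a_r_coset_subset:
  assumes B: "B \<subseteq> carrier G" "\<And>x y. x \<in> B \<Longrightarrow> y \<in> B \<Longrightarrow> x \<oplus> y \<in> B"
    and u: "u \<in> carrier G" and v: "v \<in> carrier G" "u \<ominus> v \<in> B"
  shows "B +> u \<subseteq> B +> v"
proof
  fix x assume "x \<in> B +> u"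
  then obtain b where b: "b \<in> B" "x = b \<oplus> u" by (auto simp: a_r_coset_def')
  have bc: "b \<in> carrier G" using b B(1) by blast
  have "x = (b \<oplus> (u \<ominus> v)) \<oplus> v" unfolding b(2) using u v(1) bc by (simp add: minus_eq a_assoc l_neg)
  moreover have "b \<oplus> (u \<ominus> v) \<in> B" using B(2)[OF b(1) v(2)] .
  ultimately show "x \<in> B +> v" unfolding a_r_coset_def' by blast
qed

locale injective_resolution_at = noetherian_cring R for R :: "('a, 'm) ring_scheme" (structure) +
  fixes p P :: "'a set" and E :: "nat \<Rightarrow> ('a, 'e) module" and \<epsilon> :: "'a \<Rightarrow> 'e" and \<delta> :: "nat \<Rightarrow> 'e \<Rightarrow> 'e"
  assumes p: "primeideal p R" and P: "primeideal P R"
    and resolution: "injective_resolution R (self_module R) E \<epsilon> \<delta>"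
begin

lemma E_injective: "injective_module R (E i)"
  and d_mod_hom: "\<delta> i \<in> mod_hom R (E i) (E (Suc i))"
  and e_hom: "\<epsilon> \<in> mod_hom R (self_module R) (E 0)"
  and e_inj: "inj_on \<epsilon> (carrier R)"
  and exact0: "\<epsilon> ` carrier R = {x \<in> carrier (E 0). \<delta> 0 x = \<zero>\<^bsub>E (Suc 0)\<^esub>}"
  and exact: "\<delta> i ` carrier (E i) = {x \<in> carrier (E (Suc i)). \<delta> (Suc i) x = \<zero>\<^bsub>E (Suc (Suc i))\<^esub>}"
  using resolution by (simp_all add: injective_resolution_def a_kernel_def' self_module_def)

sublocale module_complex R p E \<delta>
proof (intro module_complex.intro module_complex_axioms.intro cring_axioms p d_mod_hom)
  show "module R (E i)" for i using E_injective by (simp add: injective_module_def)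
  show "\<delta> (Suc i) (\<delta> i x) = \<zero>\<^bsub>E (Suc (Suc i))\<^esub>" if "x \<in> carrier (E i)" for i x
    using exact[of i] that by blast
qed

definition torsion :: "'a set \<Rightarrow> nat \<Rightarrow> 'e set" where
  "torsion Q j = {x \<in> carrier (E j). \<exists>n. \<forall>a \<in> ideal_power R Q n. a \<odot>\<^bsub>E j\<^esub> x = \<zero>\<^bsub>E j\<^esub>}"

lemma torsion_subcomplex:
  assumes Q: "ideal Q R"
  shows "subcomplex (torsion Q)"
  unfolding subcomplex_def
proof (intro allI conjI ballI)
  fix j
  show "torsion Q j \<subseteq> carrier (E j)" by (auto simp: torsion_def)
  have Qc: "a \<in> carrier R" if "a \<in> ideal_power R Q n" for a n
    using ideal_mem(2)[OF ideal_power_ideal[OF Q] that] .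
  show "\<zero>\<^bsub>E j\<^esub> \<in> torsion Q j" using Qc by (auto simp: torsion_def)
  fix x assume "x \<in> torsion Q j"
  then obtain n where x: "x \<in> carrier (E j)" "\<And>a. a \<in> ideal_power R Q n \<Longrightarrow> a \<odot>\<^bsub>E j\<^esub> x = \<zero>\<^bsub>E j\<^esub>"
    by (auto simp: torsion_def)
  { fix y assume "y \<in> torsion Q j"
    then obtain m where y: "y \<in> carrier (E j)" "\<And>a. a \<in> ideal_power R Q m \<Longrightarrow> a \<odot>\<^bsub>E j\<^esub> y = \<zero>\<^bsub>E j\<^esub>"
      by (auto simp: torsion_def)
    have "a \<odot>\<^bsub>E j\<^esub> (x \<oplus>\<^bsub>E j\<^esub> y) = \<zero>\<^bsub>E j\<^esub>" if a: "a \<in> ideal_power R Q (max m n)" for a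
    proof -
      have "a \<in> ideal_power R Q m" "a \<in> ideal_power R Q n"
        using a ideal_power_antimono[OF Q] by (meson max.cobounded1 max.cobounded2 subsetD)+
      then show ?thesis using x y Qc[OF a] by (simp add: E.smult_r_distr)
    qed
    then show "x \<oplus>\<^bsub>E j\<^esub> y \<in> torsion Q j" using x y by (auto simp: torsion_def) }
  { fix r assume r: "r \<in> carrier R"
    have "a \<odot>\<^bsub>E j\<^esub> (r \<odot>\<^bsub>E j\<^esub> x) = \<zero>\<^bsub>E j\<^esub>" if a: "a \<in> ideal_power R Q n" for a
      using E.smult_lcomm[OF Qc[OF a] r x(1)] x(2)[OF a] r by simp
    then show "r \<odot>\<^bsub>E j\<^esub> x \<in> torsion Q j" using x r by (auto simp: torsion_def) }
  have "a \<odot>\<^bsub>E (Suc j)\<^esub> \<delta> j x = \<zero>\<^bsub>E (Suc j)\<^esub>" if a: "a \<in> ideal_power R Q n" for a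
    using d_smult[OF Qc[OF a] x(1)] x(2)[OF a] by simp
  then show "\<delta> j x \<in> torsion Q (Suc j)" using x by (auto simp: torsion_def)
qed

text \<open>Cosets are replaced by representatives here once and for all. Scalar multiplication of a
  coset is a union over its members, whose terms coincide because the boundaries form a
  submodule.\<close>

lemma associated_prime_annihilator:
  assumes "p \<in> associated_primes R (local_cohomology R P E \<delta> i)"
  obtains e where "e \<in> torsion P i" "\<delta> i e = \<zero>\<^bsub>E (Suc i)\<^esub>"
    "p = {r \<in> carrier R. r \<odot>\<^bsub>E i\<^esub> e \<in> boundaries (torsion P) i}"
proof -
  define H where "H = local_cohomology R P E \<delta> i"
  define B where "B = boundaries (torsion P) i"
  have T: "subcomplex (torsion P)" by (rule torsion_subcomplex[OF prime_ideal[OF P]])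
  note Bd = boundariesD[OF T, where j = i, folded B_def]
  have B: "coboundaries (\<lambda>j. torsion_module R P (E j)) \<delta> i = B"
    by (cases i) (simp_all add: coboundaries_def B_def torsion_module_def torsion_def)
  have coset: "B +>\<^bsub>E i\<^esub> u = B +>\<^bsub>E i\<^esub> v"
    if "u \<in> carrier (E i)" "v \<in> carrier (E i)" "u \<ominus>\<^bsub>E i\<^esub> v \<in> B" for u v
  proof -
    have "v \<ominus>\<^bsub>E i\<^esub> u = (\<ominus> \<one>) \<odot>\<^bsub>E i\<^esub> (u \<ominus>\<^bsub>E i\<^esub> v)"
      using that(1,2) by (simp add: E.smult_l_minus E.M.minus_eq E.M.minus_add E.M.a_comm)
    also have "\<dots> \<in> B" using Bd(4)[OF _ that(3)] by simp
    finally show ?thesis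
      using E.M.a_r_coset_subset[of B, OF _ Bd(3)] Bd(6) that by (simp add: subset_antisym subsetI)
  qed
  obtain x where x: "x \<in> carrier H" "p = annihilator R H x"
    using assms unfolding H_def associated_primes_def by blast
  have "carrier H = (\<Union>a \<in> {e \<in> torsion P i. \<delta> i e = \<zero>\<^bsub>E (Suc i)\<^esub>}. {B +>\<^bsub>E i\<^esub> a})"
    unfolding H_def local_cohomology_def cohomology_def quot_module_def B
    by (simp add: A_RCOSETS_def' a_r_coset_def' a_kernel_def' torsion_module_def torsion_def)
  then obtain e where e: "e \<in> torsion P i" "\<delta> i e = \<zero>\<^bsub>E (Suc i)\<^esub>" "x = B +>\<^bsub>E i\<^esub> e" using x(1) by blast
  have ec: "e \<in> carrier (E i)" by (rule subcomplexD(1)[OF T e(1)])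
  have zero: "\<zero>\<^bsub>H\<^esub> = B" by (simp add: H_def local_cohomology_def cohomology_def quot_module_def B)
  have smult: "r \<odot>\<^bsub>H\<^esub> x = (\<Union>y \<in> x. B +>\<^bsub>E i\<^esub> (r \<odot>\<^bsub>E i\<^esub> y))" for r
    unfolding H_def local_cohomology_def cohomology_def quot_module_def B
    by (simp add: a_r_coset_def' torsion_module_def)
  have "r \<odot>\<^bsub>H\<^esub> x = \<zero>\<^bsub>H\<^esub> \<longleftrightarrow> r \<odot>\<^bsub>E i\<^esub> e \<in> B" if r: "r \<in> carrier R" for r
  proof -
    have "B +>\<^bsub>E i\<^esub> (r \<odot>\<^bsub>E i\<^esub> y) = B +>\<^bsub>E i\<^esub> (r \<odot>\<^bsub>E i\<^esub> e)" if y: "y \<in> x" for y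
    proof -
      obtain b where b: "b \<in> B" "y = b \<oplus>\<^bsub>E i\<^esub> e" using y unfolding e(3) by (auto simp: a_r_coset_def')
      have bc: "b \<in> carrier (E i)" by (rule Bd(6)[OF b(1)])
      have "r \<odot>\<^bsub>E i\<^esub> y \<ominus>\<^bsub>E i\<^esub> r \<odot>\<^bsub>E i\<^esub> e = r \<odot>\<^bsub>E i\<^esub> b"
        unfolding b(2) using r bc ec by (simp add: E.smult_r_distr E.M.minus_eq E.M.a_assoc E.M.r_neg)
      also have "\<dots> \<in> B" by (rule Bd(4)[OF r b(1)])
      finally show ?thesis using coset r bc ec b(2) by simp
    qed
    moreover have "\<zero>\<^bsub>E i\<^esub> \<oplus>\<^bsub>E i\<^esub> e \<in> x" unfolding e(3) a_r_coset_def' using Bd(2) by blast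
    ultimately have 1: "r \<odot>\<^bsub>H\<^esub> x = B +>\<^bsub>E i\<^esub> (r \<odot>\<^bsub>E i\<^esub> e)" unfolding smult by blast
    have 2: "B +>\<^bsub>E i\<^esub> \<zero>\<^bsub>E i\<^esub> = B" unfolding a_r_coset_def' using Bd(6) by auto
    show ?thesis
    proof
      assume "r \<odot>\<^bsub>H\<^esub> x = \<zero>\<^bsub>H\<^esub>"
      then have "B +>\<^bsub>E i\<^esub> (r \<odot>\<^bsub>E i\<^esub> e) = B" using 1 zero by simp
      moreover have "\<zero>\<^bsub>E i\<^esub> \<oplus>\<^bsub>E i\<^esub> r \<odot>\<^bsub>E i\<^esub> e \<in> B +>\<^bsub>E i\<^esub> (r \<odot>\<^bsub>E i\<^esub> e)" unfolding a_r_coset_def' using Bd(2) by blast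
      ultimately show "r \<odot>\<^bsub>E i\<^esub> e \<in> B" using r ec by simp
    next
      assume "r \<odot>\<^bsub>E i\<^esub> e \<in> B"
      then show "r \<odot>\<^bsub>H\<^esub> x = \<zero>\<^bsub>H\<^esub>"
        using coset[of "r \<odot>\<^bsub>E i\<^esub> e" "\<zero>\<^bsub>E i\<^esub>"] r ec 1 2 zero by (simp add: E.diff_zero)
    qed
  qed
  then have "p = {r \<in> carrier R. r \<odot>\<^bsub>E i\<^esub> e \<in> B}" unfolding x(2) annihilator_def by blast
  then show ?thesis using that e(1,2) unfolding B_def by blast
qed

text \<open>Representatives are P-torsion, so each element of \<open>P\<close> has a power
  annihilating the class; this power lies in the prime \<open>p\<close>.\<close>

lemma associated_prime_superset:
  assumes "p \<in> associated_primes R (local_cohomology R P E \<delta> i)"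
  shows "P \<subseteq> p"
proof
  obtain e where e: "e \<in> torsion P i" "p = {r \<in> carrier R. r \<odot>\<^bsub>E i\<^esub> e \<in> boundaries (torsion P) i}"
    using associated_prime_annihilator[OF assms] by metis
  obtain n where n: "\<And>a. a \<in> ideal_power R P n \<Longrightarrow> a \<odot>\<^bsub>E i\<^esub> e = \<zero>\<^bsub>E i\<^esub>" using e(1) by (auto simp: torsion_def)
  fix a assume a: "a \<in> P"
  then have ac: "a \<in> carrier R" using prime_carrier[OF P] by blast
  have "(a [^] n) \<odot>\<^bsub>E i\<^esub> e \<in> boundaries (torsion P) i"
    using n[OF pow_mem_ideal_power[OF prime_ideal[OF P] a]]
      boundariesD(2)[OF torsion_subcomplex[OF prime_ideal[OF P]]] by simp
  then have "a [^] n \<in> p" using e(2) ac by blast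
  then show "a \<in> p" using prime_pow[OF p ac] by blast
qed

end

section \<open>The full complex and its torsion part at a complete intersection\<close>

locale complete_intersection_resolution = injective_resolution_at R p P E \<epsilon> \<delta>
  for R :: "('a, 'm) ring_scheme" (structure) and p P and E :: "nat \<Rightarrow> ('a, 'e) module" and \<epsilon> \<delta> +
  fixes zs :: "'a list"
  assumes P_p: "P \<subseteq> p" and zs_P: "set zs \<subseteq> P" and P_zs: "P \<subseteq> sat p (adjoin_list {\<zero>} zs)"
    and regular: "regular_seq_at p {\<zero>} zs"
begin

definition I :: "nat \<Rightarrow> 'a set" where
  "I k = adjoin_list {\<zero>} (take k zs)"

text \<open>With \<open>Q = {\<zero>}\<close> every element is torsion and this is the full complex
  Hom(R/I_k, E); with \<open>Q = P\<close> it is the part inside the P-torsion of E. Both are towers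
  of the same kind.\<close>

definition X :: "'a set \<Rightarrow> nat \<Rightarrow> nat \<Rightarrow> 'e set" where
  "X Q k j = {x \<in> torsion Q j. \<forall>a \<in> I k. a \<odot>\<^bsub>E j\<^esub> x = \<zero>\<^bsub>E j\<^esub>}"

abbreviation c :: nat where "c \<equiv> length zs"

lemma zs_carrier: "set zs \<subseteq> carrier R"
  using zs_P prime_carrier[OF P] by blast

lemma nth_P: "k < c \<Longrightarrow> zs ! k \<in> P"
  using zs_P by auto

lemma nth_carrier: "k < c \<Longrightarrow> zs ! k \<in> carrier R"
  using zs_carrier by auto

lemma I_ideal: "ideal (I k) R"
  unfolding I_def using zs_carrier set_take_subset[of k zs] by (intro adjoin_list_ideal zeroideal) auto

lemma I_Suc: "k < c \<Longrightarrow> I (Suc k) = adjoin (I k) (zs ! k)"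
  by (simp add: I_def take_Suc_conv_app_nth adjoin_list_snoc)

lemma I_subset_P: "I k \<subseteq> P"
  unfolding I_def using zs_P set_take_subset[of k zs] ideal_mem(3)[OF prime_ideal[OF P]]
  by (intro adjoin_list_subset prime_ideal[OF P]) auto

lemma X_subcomplex:
  assumes Q: "ideal Q R"
  shows "subcomplex (X Q k)"
  unfolding subcomplex_def
proof (intro allI conjI ballI)
  fix j
  note T = subcomplexD[OF torsion_subcomplex[OF Q]]
  have Ic: "a \<in> carrier R" if "a \<in> I k" for a using ideal_mem(2)[OF I_ideal that] .
  show "X Q k j \<subseteq> carrier (E j)" using T(1) by (auto simp: X_def)
  show "\<zero>\<^bsub>E j\<^esub> \<in> X Q k j" using T(2) Ic by (auto simp: X_def)
  fix x assume x: "x \<in> X Q k j"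
  then have xc: "x \<in> carrier (E j)" using T(1) by (auto simp: X_def)
  show "x \<oplus>\<^bsub>E j\<^esub> y \<in> X Q k j" if y: "y \<in> X Q k j" for y
  proof -
    have "y \<in> carrier (E j)" using y T(1) by (auto simp: X_def)
    then show ?thesis using x y xc T(3) Ic by (auto simp: X_def E.smult_r_distr)
  qed
  show "r \<odot>\<^bsub>E j\<^esub> x \<in> X Q k j" if r: "r \<in> carrier R" for r
    using x xc T(4)[OF r] Ic r E.smult_lcomm[OF _ r xc] by (auto simp: X_def)
  show "\<delta> j x \<in> X Q k (Suc j)"
    using x xc T(5) Ic d_smult[OF _ xc] by (auto simp: X_def) (metis d_zero)
qed

lemma X_koszul_tower:
  assumes Q: "ideal Q R"
  shows "koszul_tower R p E \<delta> (X Q) (\<lambda>k. zs ! k) c I"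
proof (intro koszul_tower.intro divisible_tower.intro divisible_tower_axioms.intro koszul_tower_axioms.intro
    module_complex_axioms)
  have Ic: "a \<in> carrier R" if "a \<in> I k" for a k using ideal_mem(2)[OF I_ideal that] .
  have Xc: "x \<in> carrier (E j)" if "x \<in> X Q k j" for x k j
    using that by (simp add: X_def torsion_def)
  have reg: "r \<in> sat p (I k)" if "k < c" "r \<in> carrier R" "r \<otimes> zs ! k \<in> I k" for k r
    using regular_seq_at_nth[OF regular that(1,2)] that(3) by (simp add: I_def)
  show "subcomplex (X Q k)" for k by (rule X_subcomplex[OF Q])
  show "zs ! k \<in> carrier R" if "k < c" for k by (rule nth_carrier[OF that])
  show "X Q (Suc k) j = {e \<in> X Q k j. zs ! k \<odot>\<^bsub>E j\<^esub> e = \<zero>\<^bsub>E j\<^esub>}" if k: "k < c" for k j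
  proof (intro equalityI subsetI)
    note zk = nth_carrier[OF k]
    fix x assume x: "x \<in> X Q (Suc k) j"
    then show "x \<in> {e \<in> X Q k j. zs ! k \<odot>\<^bsub>E j\<^esub> e = \<zero>\<^bsub>E j\<^esub>}"
      using subset_adjoin[OF I_ideal zk, of k] mem_adjoin[OF I_ideal zk, of k] by (auto simp: X_def I_Suc[OF k])
  next
    note zk = nth_carrier[OF k]
    fix x assume x: "x \<in> {e \<in> X Q k j. zs ! k \<odot>\<^bsub>E j\<^esub> e = \<zero>\<^bsub>E j\<^esub>}"
    then have xc: "x \<in> carrier (E j)" using Xc by blast
    have "adjoin (I k) (zs ! k) \<subseteq> {r \<in> carrier R. r \<odot>\<^bsub>E j\<^esub> x = \<zero>\<^bsub>E j\<^esub>}"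
      using x zk Ic by (intro adjoin_subset E.annihilator_ideal xc) (auto simp: X_def)
    then show "x \<in> X Q (Suc k) j" using x by (auto simp: X_def I_Suc[OF k])
  qed
  show "\<exists>t \<in> carrier R - p. \<exists>g \<in> X Q k j. t \<odot>\<^bsub>E j\<^esub> f = zs ! k \<odot>\<^bsub>E j\<^esub> g"
    if k: "k < c" and f: "f \<in> X Q k j" for k j f
  proof -
    obtain n where n: "\<And>a. a \<in> ideal_power R Q n \<Longrightarrow> a \<odot>\<^bsub>E j\<^esub> f = \<zero>\<^bsub>E j\<^esub>"
      using f by (auto simp: X_def torsion_def)
    have fI: "a \<odot>\<^bsub>E j\<^esub> f = \<zero>\<^bsub>E j\<^esub>" if "a \<in> I k" for a using f that by (simp add: X_def)
    \<comment> \<open>Division must not lead out of the tower: the element g is again torsion for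
      \<open>Q\<close> and annihilated by \<open>I k\<close>.\<close>
    from injective_divisible[OF E_injective p I_ideal Q nth_carrier[OF k] reg[OF k] Xc[OF f] fI n]
    obtain t g where t: "t \<in> carrier R - p" "g \<in> carrier (E j)" "\<forall>a \<in> I k. a \<odot>\<^bsub>E j\<^esub> g = \<zero>\<^bsub>E j\<^esub>"
      "\<exists>N. \<forall>a \<in> ideal_power R Q N. a \<odot>\<^bsub>E j\<^esub> g = \<zero>\<^bsub>E j\<^esub>" "zs ! k \<odot>\<^bsub>E j\<^esub> g = t \<odot>\<^bsub>E j\<^esub> f" by blast
    have g: "g \<in> X Q k j" using t by (simp add: X_def torsion_def)
    have "\<exists>g \<in> X Q k j. t \<odot>\<^bsub>E j\<^esub> f = zs ! k \<odot>\<^bsub>E j\<^esub> g" by (rule bexI[OF _ g]) (rule t(5)[symmetric])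
    then show ?thesis using t(1) by (rule bexI)
  qed
  show "ideal (I k) R" for k by (rule I_ideal)
  show "I (Suc k) = adjoin (I k) (zs ! k)" if "k < c" for k by (rule I_Suc[OF that])
  show "a \<odot>\<^bsub>E j\<^esub> e = \<zero>\<^bsub>E j\<^esub>" if "a \<in> I k" "e \<in> X Q k j" for k a j e using that by (simp add: X_def)
  show "r \<in> sat p (I k)" if "k < c" "r \<in> carrier R" "r \<otimes> zs ! k \<in> I k" for k r by (rule reg[OF that])
qed

lemma torsion_zero_ideal: "torsion {\<zero>} j = carrier (E j)"
proof -
  \<comment> \<open>The exponent is 1 because the power with exponent 0 is the whole ring, even for
    the zero ideal.\<close>
  have "ideal_power R {\<zero>} (Suc 0) = {\<zero>}" by (rule ideal_power_one[OF zeroideal])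
  then have "\<forall>a \<in> ideal_power R {\<zero>} (Suc 0). a \<odot>\<^bsub>E j\<^esub> x = \<zero>\<^bsub>E j\<^esub>" if "x \<in> carrier (E j)" for x
    using that by simp
  then show ?thesis unfolding torsion_def by blast
qed

sublocale K: koszul_tower R p E \<delta> "X {\<zero>}" "\<lambda>k. zs ! k" c I
  by (rule X_koszul_tower[OF zeroideal])

sublocale G: koszul_tower R p E \<delta> "X P" "\<lambda>k. zs ! k" c I
  by (rule X_koszul_tower[OF prime_ideal[OF P]])

lemma I_0: "I 0 = {\<zero>}"
  by (simp add: I_def)

lemma X_0: "X Q 0 j = torsion Q j"
  by (auto simp: X_def I_0 torsion_def)

lemma K_0: "X {\<zero>} 0 j = carrier (E j)"
  by (simp add: X_0 torsion_zero_ideal)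

text \<open>The tower starts with E itself, whose only cohomology is R in degree 0, generated by the
  image of 1 under \<open>\<epsilon>\<close>; \<open>koszul_cohomology\<close> carries this to stage
  \<open>c\<close>.\<close>

lemma K_cohomology:
  "j \<noteq> c \<Longrightarrow> acyclic_at (X {\<zero>} c) j" "\<exists>w. K.generator c w"
proof -
  have ac: "acyclic_at (X {\<zero>} 0) j" if j: "j \<noteq> 0" for j
    unfolding acyclic_at_def
  proof (intro ballI impI)
    fix e assume e: "e \<in> X {\<zero>} 0 j" "\<delta> j e = \<zero>\<^bsub>E (Suc j)\<^esub>"
    obtain i where i: "j = Suc i" using j by (cases j) auto
    have "\<one> \<odot>\<^bsub>E j\<^esub> e \<in> boundaries (X {\<zero>} 0) j"
      using e exact[of i] by (auto simp: K_0 i)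
    then show "\<exists>t \<in> carrier R - p. t \<odot>\<^bsub>E j\<^esub> e \<in> boundaries (X {\<zero>} 0) j" using prime_compl_one[OF p] by blast
  qed
  have e_one: "\<epsilon> r = r \<odot>\<^bsub>E 0\<^esub> \<epsilon> \<one>" if r: "r \<in> carrier R" for r
  proof -
    have "\<forall>r \<in> carrier R. \<forall>x \<in> carrier R. \<epsilon> (r \<otimes> x) = r \<odot>\<^bsub>E 0\<^esub> \<epsilon> x"
      using e_hom by (simp add: mod_hom_def self_module_def)
    then have "\<epsilon> (r \<otimes> \<one>) = r \<odot>\<^bsub>E 0\<^esub> \<epsilon> \<one>" using r by blast
    then show ?thesis using r by simp
  qed
  have w: "\<epsilon> \<one> \<in> carrier (E 0)" "\<delta> 0 (\<epsilon> \<one>) = \<zero>\<^bsub>E (Suc 0)\<^esub>" using exact0 by blast+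
  have gen: "K.generator 0 (\<epsilon> \<one>)"
    unfolding K.generator_def
  proof (intro conjI ballI impI)
    show "\<epsilon> \<one> \<in> X {\<zero>} 0 0" using w by (simp add: K_0)
    show "\<delta> 0 (\<epsilon> \<one>) = \<zero>\<^bsub>E (Suc 0)\<^esub>" by (rule w)
    fix e assume e: "e \<in> X {\<zero>} 0 0" "\<delta> 0 e = \<zero>\<^bsub>E (Suc 0)\<^esub>"
    then have "e \<in> \<epsilon> ` carrier R" unfolding exact0 by (simp add: K_0)
    then obtain r where r: "r \<in> carrier R" "e = \<epsilon> r" by blast
    then have "\<one> \<odot>\<^bsub>E 0\<^esub> e = r \<odot>\<^bsub>E 0\<^esub> \<epsilon> \<one> \<oplus>\<^bsub>E 0\<^esub> \<zero>\<^bsub>E 0\<^esub>" using e_one[OF r(1)] w(1) by simp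
    moreover have "\<zero>\<^bsub>E 0\<^esub> \<in> boundaries (X {\<zero>} 0) 0" by simp
    ultimately show "\<exists>t \<in> carrier R - p. \<exists>r \<in> carrier R. \<exists>b \<in> boundaries (X {\<zero>} 0) 0.
        t \<odot>\<^bsub>E 0\<^esub> e = r \<odot>\<^bsub>E 0\<^esub> \<epsilon> \<one> \<oplus>\<^bsub>E 0\<^esub> b"
      using prime_compl_one[OF p] r(1) by blast
  next
    fix r assume r: "r \<in> carrier R" "r \<odot>\<^bsub>E 0\<^esub> \<epsilon> \<one> \<in> boundaries (X {\<zero>} 0) 0"
    then have "\<epsilon> r = \<epsilon> \<zero>" using e_one[OF r(1)] e_one[OF zero_closed] w(1) by simp
    then have "r = \<zero>" using e_inj r(1) by (simp add: inj_on_def)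
    then show "r \<in> sat p (I 0)" using ideal_mem(3)[OF sat_ideal[OF p I_ideal]] by simp
  qed
  note * = K.koszul_cohomology[OF ac gen order.refl]
  show "j \<noteq> c \<Longrightarrow> acyclic_at (X {\<zero>} c) j" "\<exists>w. K.generator c w" using * by simp_all
qed

lemma X_P_subset: "X P k j \<subseteq> X {\<zero>} k j"
  unfolding X_def torsion_zero_ideal by (auto simp: torsion_def)

text \<open>Locally at \<open>p\<close> the ideal \<open>P\<close> is generated by \<open>zs\<close>, so elements annihilated by \<open>zs\<close> are
  \<open>P\<close>-torsion.\<close>

lemma K_to_G:
  obtains s where "s \<in> carrier R" "s \<notin> p" "\<And>j b. b \<in> boundaries (X {\<zero>} c) j \<Longrightarrow> s \<odot>\<^bsub>E j\<^esub> b \<in> boundaries (X P c) j"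
proof -
  have "P \<subseteq> sat p (I c)" using P_zs by (simp add: I_def)
  then obtain s where s: "s \<in> carrier R - p" "\<And>a. a \<in> P \<Longrightarrow> s \<otimes> a \<in> I c"
    using sat_uniform[OF p I_ideal prime_ideal[OF P]] by metis
  have sc: "s \<in> carrier R" using s by blast
  have X: "s \<odot>\<^bsub>E j\<^esub> x \<in> X P c j" if x: "x \<in> X {\<zero>} c j" for x j
  proof -
    have xc: "x \<in> carrier (E j)" by (rule K.XD(1)[OF x])
    have "a \<odot>\<^bsub>E j\<^esub> (s \<odot>\<^bsub>E j\<^esub> x) = \<zero>\<^bsub>E j\<^esub>" if a: "a \<in> ideal_power R P (Suc 0)" for a
    proof -
      have aP: "a \<in> P" using a ideal_power_one[OF prime_ideal[OF P]] by blast
      then have ac: "a \<in> carrier R" using prime_carrier[OF P] by blast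
      have "(s \<otimes> a) \<odot>\<^bsub>E j\<^esub> x = \<zero>\<^bsub>E j\<^esub>" using s(2)[OF aP] x by (simp add: X_def)
      then show ?thesis using ac sc xc by (simp add: E.smult_assoc1[symmetric] m_comm)
    qed
    then have "s \<odot>\<^bsub>E j\<^esub> x \<in> torsion P j" unfolding torsion_def using sc xc by blast
    moreover have "s \<odot>\<^bsub>E j\<^esub> x \<in> X {\<zero>} c j" by (rule K.XD(4)[OF sc x])
    ultimately show ?thesis by (simp add: X_def)
  qed
  have "s \<odot>\<^bsub>E j\<^esub> b \<in> boundaries (X P c) j" if b: "b \<in> boundaries (X {\<zero>} c) j" for b j
  proof (cases j)
    case 0
    then show ?thesis using b sc by simp
  next
    case (Suc i)
    then obtain f where f: "b = \<delta> i f" "f \<in> X {\<zero>} c i" using b by auto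
    have "s \<odot>\<^bsub>E j\<^esub> b = \<delta> i (s \<odot>\<^bsub>E i\<^esub> f)" using f(1) Suc sc K.XD(1)[OF f(2)] by (simp add: d_smult)
    then show ?thesis using X[OF f(2)] Suc by simp
  qed
  then show ?thesis using that s by blast
qed

text \<open>Downward induction on \<open>k\<close>. At stage \<open>c\<close> the torsion complex
  agrees at \<open>p\<close> with the full one. On the way down every element is P-torsion, hence
  annihilated by a power of \<open>zs ! k\<close>, and \<open>acyclic_descend\<close> applies. Stage
  0 is the vanishing of H^j_P(R)_p.\<close>

lemma G_acyclic:
  assumes j: "j \<noteq> c" and k: "k \<le> c"
  shows "acyclic_at (X P k) j"
  using k
proof (induction k rule: inc_induct)
  case base
  obtain s where s: "s \<in> carrier R" "s \<notin> p" "\<And>j b. b \<in> boundaries (X {\<zero>} c) j \<Longrightarrow> s \<odot>\<^bsub>E j\<^esub> b \<in> boundaries (X P c) j"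
    using K_to_G by metis
  show ?case
    unfolding acyclic_at_def
  proof (intro ballI impI)
    fix e assume e: "e \<in> X P c j" "\<delta> j e = \<zero>\<^bsub>E (Suc j)\<^esub>"
    have eK: "e \<in> X {\<zero>} c j" using e(1) X_P_subset by blast
    obtain t where t: "t \<in> carrier R" "t \<notin> p" "t \<odot>\<^bsub>E j\<^esub> e \<in> boundaries (X {\<zero>} c) j"
      by (rule acyclic_atE[OF K_cohomology(1)[OF j] eK e(2)])
    have "(s \<otimes> t) \<odot>\<^bsub>E j\<^esub> e \<in> boundaries (X P c) j"
      using s(3)[OF t(3)] s(1) t(1) K.XD(1)[OF eK] by (simp add: E.smult_assoc1)
    then show "\<exists>t \<in> carrier R - p. t \<odot>\<^bsub>E j\<^esub> e \<in> boundaries (X P c) j"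
      using prime_compl_mult[OF p, of s t] s t by blast
  qed
next
  case (step k)
  show ?case
  proof (rule G.acyclic_descend[OF step(2,3)])
    fix e assume "e \<in> X P k j"
    then obtain n where "\<And>a. a \<in> ideal_power R P n \<Longrightarrow> a \<odot>\<^bsub>E j\<^esub> e = \<zero>\<^bsub>E j\<^esub>" by (auto simp: X_def torsion_def)
    then show "\<exists>n::nat. (zs ! k [^] n) \<odot>\<^bsub>E j\<^esub> e = \<zero>\<^bsub>E j\<^esub>"
      using pow_mem_ideal_power[OF prime_ideal[OF P] nth_P[OF step(2)]] by blast
  qed
qed

text \<open>The class of \<open>e\<close> is nonzero at \<open>p\<close> and annihilated by
  \<open>P\<close>, so up to a factor outside \<open>p\<close> it comes from Ext^c(R/I_c, R)_p,
  which is R_p/P R_p. This is a domain, so only elements of \<open>P\<close> can annihilate a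
  nonzero element of it.\<close>

lemma associated_prime_eq:
  assumes e: "e \<in> torsion P i" "\<delta> i e = \<zero>\<^bsub>E (Suc i)\<^esub>"
    and ann: "p = {r \<in> carrier R. r \<odot>\<^bsub>E i\<^esub> e \<in> boundaries (torsion P) i}"
  shows "p = P"
proof -
  have X0: "X P 0 = torsion P" using X_0 by blast
  have e0: "e \<in> X P 0 i" using e(1) by (simp add: X0)
  have ec: "e \<in> carrier (E i)" by (rule G.XD(1)[OF e0])
  have no: "t \<odot>\<^bsub>E i\<^esub> e \<notin> boundaries (X P 0) i" if "t \<in> carrier R" "t \<notin> p" for t
    using that ann by (simp add: X0)
  \<comment> \<open>No element outside \<open>p\<close> annihilates the class, so the cohomology in
    degree i survives at \<open>p\<close>.\<close>
  have i: "i = c"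
  proof (rule ccontr)
    assume "i \<noteq> c"
    then have ac0: "acyclic_at (X P 0) i" by (rule G_acyclic) simp
    show False by (rule acyclic_atE[OF ac0 e0 e(2)]) (use no in blast)
  qed
  have ac: "acyclic_at (X P l) j" if "i = Suc j" "l < c" for j l
    using G_acyclic[of j l] that i by simp
  have "\<exists>t \<in> carrier R - p. \<exists>b \<in> boundaries (X P 0) i. t \<odot>\<^bsub>E i\<^esub> e \<ominus>\<^bsub>E i\<^esub> b \<in> X P c i"
  proof (rule G.representative[OF order.refl ac e0])
    show "zs ! l \<odot>\<^bsub>E i\<^esub> e \<in> boundaries (X P 0) i" if "l < c" for l
      using nth_P[OF that] P_p ann by (auto simp: X0)
  qed
  then obtain t b where t: "t \<in> carrier R" "t \<notin> p" "b \<in> boundaries (X P 0) i" "t \<odot>\<^bsub>E i\<^esub> e \<ominus>\<^bsub>E i\<^esub> b \<in> X P c i"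
    by blast
  define e' where "e' = t \<odot>\<^bsub>E i\<^esub> e \<ominus>\<^bsub>E i\<^esub> b"
  have bc: "b \<in> carrier (E i)" by (rule G.XB(6)[OF t(3)])
  have e'X: "e' \<in> X P c i" using t(4) by (simp add: e'_def)
  have e'c: "e' \<in> carrier (E i)" by (rule G.XD(1)[OF e'X])
  have e'K: "e' \<in> X {\<zero>} c c" using e'X X_P_subset i by auto
  have "\<delta> i e' = \<zero>\<^bsub>E (Suc i)\<^esub>"
    unfolding e'_def using t(1) ec bc e(2) G.XB(5)[OF t(3)] by (simp add: d_diff d_smult E.diff_zero)
  then have e'd: "\<delta> c e' = \<zero>\<^bsub>E (Suc c)\<^esub>" using i by simp
  obtain w where w: "K.generator c w" using K_cohomology(2) by blast
  obtain u r b' where u: "u \<in> carrier R" "u \<notin> p" "r \<in> carrier R" "b' \<in> boundaries (X {\<zero>} c) c"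
    "u \<odot>\<^bsub>E c\<^esub> e' = r \<odot>\<^bsub>E c\<^esub> w \<oplus>\<^bsub>E c\<^esub> b'" by (rule K.generatorE[OF w e'K e'd])
  note W = K.generatorD[OF w]
  have b'c: "b' \<in> carrier (E c)" by (rule K.XB(6)[OF u(4)])
  have PI: "P \<subseteq> sat p (I c)" using P_zs by (simp add: I_def)
  \<comment> \<open>If r were in \<open>P\<close>, a multiple of it by an element outside
    \<open>p\<close> would lie in I_c and annihilate w. Then e' and with it e would locally be
    boundaries, against \<open>no\<close>.\<close>
  have rP: "r \<notin> P"
  proof
    assume "r \<in> P"
    then obtain s where s: "s \<in> carrier R" "s \<notin> p" "s \<otimes> r \<in> I c" using PI by (blast elim: satE)
    obtain s' where s': "s' \<in> carrier R" "s' \<notin> p"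
      "\<And>j b. b \<in> boundaries (X {\<zero>} c) j \<Longrightarrow> s' \<odot>\<^bsub>E j\<^esub> b \<in> boundaries (X P c) j" using K_to_G by metis
    have "(s \<otimes> u) \<odot>\<^bsub>E c\<^esub> e' = s \<odot>\<^bsub>E c\<^esub> (r \<odot>\<^bsub>E c\<^esub> w \<oplus>\<^bsub>E c\<^esub> b')"
      using s(1) u(1) e'c i unfolding u(5)[symmetric] by (simp add: E.smult_assoc1)
    also have "\<dots> = (s \<otimes> r) \<odot>\<^bsub>E c\<^esub> w \<oplus>\<^bsub>E c\<^esub> s \<odot>\<^bsub>E c\<^esub> b'"
      using s(1) u(3) W(3) b'c by (simp add: E.smult_r_distr E.smult_assoc1)
    also have "(s \<otimes> r) \<odot>\<^bsub>E c\<^esub> w = \<zero>\<^bsub>E c\<^esub>" using K.killed[OF order.refl s(3) W(1)] .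
    finally have "(s \<otimes> u) \<odot>\<^bsub>E c\<^esub> e' = s \<odot>\<^bsub>E c\<^esub> b'" using s(1) b'c by simp
    then have "(s \<otimes> u) \<odot>\<^bsub>E c\<^esub> e' \<in> boundaries (X {\<zero>} c) c" using K.XB(4)[OF s(1) u(4)] by simp
    from s'(3)[OF this] have "s' \<odot>\<^bsub>E c\<^esub> ((s \<otimes> u) \<odot>\<^bsub>E c\<^esub> e') \<in> boundaries (X P 0) c"
      using boundaries_mono[of "X P c" "X P 0", OF G.X_subset_0[OF order.refl]] by blast
    then have "(s' \<otimes> (s \<otimes> u)) \<odot>\<^bsub>E i\<^esub> e' \<in> boundaries (X P 0) i"
      using s'(1) s(1) u(1) e'c i by (simp add: E.smult_assoc1)
    moreover have sc: "s' \<otimes> (s \<otimes> u) \<in> carrier R" using s'(1) s(1) u(1) by simp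
    ultimately have "(s' \<otimes> (s \<otimes> u)) \<odot>\<^bsub>E i\<^esub> e' \<oplus>\<^bsub>E i\<^esub> (s' \<otimes> (s \<otimes> u)) \<odot>\<^bsub>E i\<^esub> b \<in> boundaries (X P 0) i"
      using G.XB(3,4) t(3) by blast
    moreover have "(s' \<otimes> (s \<otimes> u)) \<odot>\<^bsub>E i\<^esub> e' \<oplus>\<^bsub>E i\<^esub> (s' \<otimes> (s \<otimes> u)) \<odot>\<^bsub>E i\<^esub> b
        = (s' \<otimes> (s \<otimes> u)) \<odot>\<^bsub>E i\<^esub> (e' \<oplus>\<^bsub>E i\<^esub> b)" by (rule E.smult_r_distr[OF sc e'c bc, symmetric])
    moreover have "e' \<oplus>\<^bsub>E i\<^esub> b = t \<odot>\<^bsub>E i\<^esub> e"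
      unfolding e'_def using t(1) ec bc by (simp add: E.M.minus_eq E.M.a_assoc E.M.l_neg)
    ultimately have "((s' \<otimes> (s \<otimes> u)) \<otimes> t) \<odot>\<^bsub>E i\<^esub> e \<in> boundaries (X P 0) i"
      using sc t(1) ec by (simp add: E.smult_assoc1)
    moreover have "(s' \<otimes> (s \<otimes> u)) \<otimes> t \<notin> p"
      using G.mult_p[OF sc G.mult_p[OF s'(1,2) _ G.mult_p[OF s(1,2) u(1,2)]] t(1,2)] s(1) u(1) by simp
    ultimately show False using no sc t(1) by simp
  qed
  \<comment> \<open>That a annihilates the class of e' is transported to stage c, where this class
    corresponds to r up to a factor outside \<open>p\<close>. So s a r lies in
    \<open>sat p (I c)\<close> and hence in the prime \<open>P\<close>, which contains neither r nor
    s.\<close>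
  have "p \<subseteq> P"
  proof
    fix a assume a: "a \<in> p"
    then have acar: "a \<in> carrier R" using prime_carrier[OF p] by blast
    have "a \<odot>\<^bsub>E i\<^esub> e \<in> boundaries (X P 0) i" using a ann by (auto simp: X0)
    then have ab: "t \<odot>\<^bsub>E i\<^esub> (a \<odot>\<^bsub>E i\<^esub> e) \<oplus>\<^bsub>E i\<^esub> (\<ominus> a) \<odot>\<^bsub>E i\<^esub> b \<in> boundaries (X P 0) i"
      using G.XB(3,4) t(1,3) acar by simp
    have "a \<odot>\<^bsub>E i\<^esub> e' = a \<odot>\<^bsub>E i\<^esub> (t \<odot>\<^bsub>E i\<^esub> e) \<ominus>\<^bsub>E i\<^esub> a \<odot>\<^bsub>E i\<^esub> b"
      unfolding e'_def using acar t(1) ec bc by (simp add: E.smult_diff_right)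
    also have "\<dots> = t \<odot>\<^bsub>E i\<^esub> (a \<odot>\<^bsub>E i\<^esub> e) \<oplus>\<^bsub>E i\<^esub> (\<ominus> a) \<odot>\<^bsub>E i\<^esub> b"
      using acar t(1) ec bc E.smult_lcomm[OF acar t(1) ec] by (simp add: E.M.minus_eq E.smult_l_minus)
    finally have "a \<odot>\<^bsub>E i\<^esub> e' \<in> boundaries (X P 0) i" using ab by simp
    then obtain s where s: "s \<in> carrier R" "s \<notin> p" "s \<odot>\<^bsub>E i\<^esub> (a \<odot>\<^bsub>E i\<^esub> e') \<in> boundaries (X P c) i"
      using G.boundary_lift_tower[OF order.refl ac G.XD(4)[OF acar e'X]] by blast
    then have 1: "s \<odot>\<^bsub>E c\<^esub> (a \<odot>\<^bsub>E c\<^esub> e') \<in> boundaries (X {\<zero>} c) c"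
      using boundaries_mono[of "X P c" "X {\<zero>} c", OF X_P_subset] i by blast
    have "u \<odot>\<^bsub>E c\<^esub> (s \<odot>\<^bsub>E c\<^esub> (a \<odot>\<^bsub>E c\<^esub> e')) = (s \<otimes> a) \<odot>\<^bsub>E c\<^esub> (u \<odot>\<^bsub>E c\<^esub> e')"
      using s(1) u(1) acar e'c i by (simp add: E.smult_assoc1[symmetric] m_ac)
    also have "\<dots> = ((s \<otimes> a) \<otimes> r) \<odot>\<^bsub>E c\<^esub> w \<oplus>\<^bsub>E c\<^esub> (s \<otimes> a) \<odot>\<^bsub>E c\<^esub> b'"
      unfolding u(5) using s(1) u(3) acar W(3) b'c by (simp add: E.smult_r_distr E.smult_assoc1)
    finally have e1: "((s \<otimes> a) \<otimes> r) \<odot>\<^bsub>E c\<^esub> w \<oplus>\<^bsub>E c\<^esub> (s \<otimes> a) \<odot>\<^bsub>E c\<^esub> b' \<in> boundaries (X {\<zero>} c) c"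
      using K.XB(4)[OF u(1) 1] by simp
    have "((s \<otimes> a) \<otimes> r) \<odot>\<^bsub>E c\<^esub> w =
        (((s \<otimes> a) \<otimes> r) \<odot>\<^bsub>E c\<^esub> w \<oplus>\<^bsub>E c\<^esub> (s \<otimes> a) \<odot>\<^bsub>E c\<^esub> b') \<oplus>\<^bsub>E c\<^esub> (\<ominus> (s \<otimes> a)) \<odot>\<^bsub>E c\<^esub> b'"
      using s(1) u(3) acar W(3) b'c by (simp add: E.smult_l_minus E.M.a_assoc E.M.r_neg)
    also have "\<dots> \<in> boundaries (X {\<zero>} c) c" using K.XB(3)[OF e1 K.XB(4)[OF _ u(4)]] s(1) acar by simp
    finally have "(s \<otimes> a) \<otimes> r \<in> sat p (I c)" using W(4) s(1) acar u(3) by simp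
    then have "(s \<otimes> a) \<otimes> r \<in> P" using sat_mono[OF I_subset_P] sat_prime[OF P P_p] by blast
    then have "s \<otimes> a \<in> P" using prime_mult[OF P, of "s \<otimes> a" r] rP s(1) acar u(3) by auto
    then show "a \<in> P" using prime_mult[OF P s(1) acar] s(2) P_p by blast
  qed
  then show ?thesis using P_p by blast
qed

end

lemma (in noetherian_cring) associated_primes_subset:
  assumes P: "primeideal P R" and res: "injective_resolution R (self_module R) E \<epsilon> \<delta>"
  shows "associated_primes R (local_cohomology R P E \<delta> i) \<subseteq>
    insert P {p. primeideal p R \<and> P \<subseteq> p \<and> \<not> complete_intersection_at P p}"
proof
  fix p assume ass: "p \<in> associated_primes R (local_cohomology R P E \<delta> i)"
  then have p: "primeideal p R" by (simp add: associated_primes_def)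
  interpret injective_resolution_at R p P E \<epsilon> \<delta>
    by (intro injective_resolution_at.intro injective_resolution_at_axioms.intro noetherian_cring_axioms p P res)
  have Pp: "P \<subseteq> p" by (rule associated_prime_superset[OF ass])
  show "p \<in> insert P {p. primeideal p R \<and> P \<subseteq> p \<and> \<not> complete_intersection_at P p}"
  proof (cases "complete_intersection_at P p")
    case True
    then obtain zs where zs: "set zs \<subseteq> P" "P \<subseteq> sat p (adjoin_list {\<zero>} zs)" "regular_seq_at p {\<zero>} zs"
      unfolding complete_intersection_at_def by blast
    interpret complete_intersection_resolution R p P E \<epsilon> \<delta> zs
      by (intro complete_intersection_resolution.intro complete_intersection_resolution_axioms.intro
          injective_resolution_at_axioms Pp zs)
    obtain e where "e \<in> torsion P i" "\<delta> i e = \<zero>\<^bsub>E (Suc i)\<^esub>"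
      "p = {r \<in> carrier R. r \<odot>\<^bsub>E i\<^esub> e \<in> boundaries (torsion P) i}"
      by (rule associated_prime_annihilator[OF ass])
    then show ?thesis using associated_prime_eq by blast
  qed (use p Pp in blast)
qed

theorem theorem1p2:
  fixes R :: "('a, 'm) ring_scheme"
    and d :: nat
    and P :: "'a set"
    and E :: "nat \<Rightarrow> ('a, 'e) module"
    and \<epsilon> :: "'a \<Rightarrow> 'e"
    and \<delta> :: "nat \<Rightarrow> 'e \<Rightarrow> 'e"
  assumes "cring R"
    and "noetherian_ring R"
    and "regular_ring R"
    and "krull_dim R = enat d"
    and "contains_char_zero_field R"
    and "primeideal P R"
    and "\<And>q. primeideal q R \<Longrightarrow> \<not> maximalideal q R \<Longrightarrow> P \<subseteq> q \<Longrightarrow>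
           regular_ring (quot_localization_at R P q)"
    and "injective_resolution R (self_module R) E \<epsilon> \<delta>"
  shows "\<forall>i. finite (associated_primes R (local_cohomology R P E \<delta> i))"
proof
  fix i
  interpret noetherian_cring R by (intro noetherian_cring.intro assms(1,2))
  have "finite (insert P {p. primeideal p R \<and> P \<subseteq> p \<and> \<not> complete_intersection_at P p})"
    using finite_not_complete_intersection[OF assms(3,6,7)] by simp
  then show "finite (associated_primes R (local_cohomology R P E \<delta> i))"
    by (rule finite_subset[OF associated_primes_subset[OF assms(6,8)]])
qed

end
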